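(* Let $(\phi,\xi,\eta,g)$ be a submersive contact metric structure on $M^{2n+1}$, with Riemannian submersion $\pi\colon(M,g)\to(\hat M^{2n},\hat g)$ and projected almost Hermitian structure $(\hat g,\hat J)$ on $\hat M$. Then the contact metric structure on $M$ is harmonic if and only if the projected almost Hermitian structure on $\hat M$ is harmonic.
   Context: An almost contact metric structure on a Riemannian manifold $(M^{2n+1},g)$ consists of a $(1,1)$-tensor $\phi$, a unit vector field $\xi$ and its dual $1$-form $\eta=g(\xi,\cdot)$, with $\phi^2=-I+\eta\otimes\xi$ and $g(\phi X,\phi Y)=g(X,Y)-\eta(X)\eta(Y)$. It is a contact metric structure if $d\eta=\Phi$, where $\Phi(X,Y)=g(X,\phi Y)$ and $d\eta(X,Y)=\tfrac12\big(X\eta(Y)-Y\eta(X)-\eta([X,Y])\big)$. Everything is smooth. $\nabla$ is the Levi-Civita connection; $\mathcal{D}=\operatorname{im}\phi=\ker\eta$; $J=\phi|_{\mathcal D}$; $\bar\nabla$ is the connection in $\mathcal{D}\to M$ given by $\bar\nabla_XY=(\nabla_XY)_{\mathcal D}$ (orthogonal projection), $X\in TM$, $Y$ a section of $\mathcal D$. $\nabla^2_{X,Y}=\nabla_X\nabla_Y-\nabla_{\nabla_XY}$ and $\bar\nabla^2_{X,Y}=\bar\nabla_X\bar\nabla_Y-\bar\nabla_{\nabla_XY}$. For a local orthonormal frame $(E_i)$ of $TM$ (sums over repeated indices): $\nabla^*\nabla\xi=-\nabla^2_{E_i,E_i}\xi$, $\bar\nabla^*\bar\nabla J=-\bar\nabla^2_{E_i,E_i}J$,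 and $$\tau(\xi)=\nabla^*\nabla\xi-|\nabla\xi|^2\xi,\quad \tau(J)=[\bar\nabla^*\bar\nabla J,J],\quad T(\phi)=(\bar\nabla_{E_i}J)\big(\nabla_{E_i}\xi\big),$$ where $[\cdot,\cdot]$ is the commutator of endomorphisms of $\mathcal D$ (note that $\nabla_X\xi\in\mathcal D$). The almost contact metric structure is harmonic if it is given by a harmonic section of the associated bundle with fibre $SO(2n+1)/U(n)$; equivalently (known result, used here as the definition), if both $\tau(\xi)+\tfrac12 J\,T(\phi)=0$ and $\tau(J)=0$ hold. An almost contact metric structure on $M^{2n+1}$ is submersive if there exist an almost Hermitian manifold $(\hat M^{2n},\hat g,\hat J)$ and a Riemannian submersion $\pi\colon(M,g)\to(\hat M,\hat g)$ (onto) such that $d\pi(JZ)=\hat J\,d\pi(Z)$ for all $Z\in\mathcal D$, where $\mathcal D$ is the horizontal subbundle and $\xi$ is vertical; $(\hat g,\hat J)$ is called the projected almost Hermitian structure. An almost Hermitian structure $(\hat g,\hat J)$ is harmonic if $[\hat\nabla^*\hat\nabla\hat J,\hat J]=0$, where $\hat\nabla$ is the Levi-Civita connection of $\hat g$ and $\hat\nabla^*\hat\nabla=-\operatorname{tr}\hat\nabla^2$. *)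

theory Defs
  imports "HOL-Analysis.Analysis"
begin

text \<open>Only meaningful for open \<open>S\<close>, the only case used below.\<close>

primrec Ck_on :: "nat \<Rightarrow> 'a::euclidean_space set \<Rightarrow> ('a \<Rightarrow> 'b::real_normed_vector) \<Rightarrow> bool" where
  "Ck_on 0 S f \<longleftrightarrow> continuous_on S f"
| "Ck_on (Suc k) S f \<longleftrightarrow> (\<forall>x\<in>S. f differentiable (at x)) \<and>
     (\<forall>v. Ck_on k S (\<lambda>x. frechet_derivative f (at x) v))"

definition smooth_on :: "'a::euclidean_space set \<Rightarrow> ('a \<Rightarrow> 'b::real_normed_vector) \<Rightarrow> bool" where
  "smooth_on S f \<longleftrightarrow> (\<forall>k. Ck_on k S f)"

text \<open>
  A manifold is a Hausdorff, second countable space \<open>'m\<close> (by type class) with a smooth atlas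
  of charts into the Euclidean space \<open>'e\<close>. A chart is a pair of its domain and its coordinate map.
\<close>

type_synonym ('m, 'e) chart = "'m set \<times> ('m \<Rightarrow> 'e)"

definition chart_inv :: "('m, 'e) chart \<Rightarrow> 'e \<Rightarrow> 'm" where
  "chart_inv c = inv_into (fst c) (snd c)"

definition is_chart :: "('m::topological_space, 'e::euclidean_space) chart \<Rightarrow> bool" where
  "is_chart c \<longleftrightarrow> open (fst c) \<and> open (snd c ` fst c) \<and>
     homeomorphism (fst c) (snd c ` fst c) (snd c) (chart_inv c)"

definition smooth_atlas :: "('m::topological_space, 'e::euclidean_space) chart set \<Rightarrow> bool" where
  "smooth_atlas A \<longleftrightarrow> (\<forall>c\<in>A. is_chart c) \<and> (\<Union>c\<in>A. fst c) = UNIV \<and>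
     (\<forall>c\<in>A. \<forall>d\<in>A. smooth_on (snd c ` (fst c \<inter> fst d)) (snd d \<circ> chart_inv c))"

text \<open>
  The tangent space at \<open>p\<close> is the model space \<open>'e\<close>, a vector being given by its components in the
  chart \<open>chart_at A p\<close> chosen at \<open>p\<close>; \<open>comps A c p\<close> converts to the components in the chart \<open>c\<close>.
  The choice of charts at distinct points is unrelated, so a vector field \<open>'m \<Rightarrow> 'e\<close> must be
  converted to a fixed chart before it is differentiated.
\<close>

definition chart_at :: "('m, 'e) chart set \<Rightarrow> 'm \<Rightarrow> ('m, 'e) chart" where
  "chart_at A p = (SOME c. c \<in> A \<and> p \<in> fst c)"

definition comps ::
  "('m, 'e::euclidean_space) chart set \<Rightarrow> ('m, 'e) chart \<Rightarrow> 'm \<Rightarrow> 'e \<Rightarrow> 'e" where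
  "comps A c p = frechet_derivative (snd c \<circ> chart_inv (chart_at A p)) (at (snd (chart_at A p) p))"

text \<open>
  Fields and functions are total, but are regarded as defined on an open set \<open>U\<close> only; their values
  outside \<open>U\<close> are irrelevant.
\<close>

definition smooth_fun ::
  "('m, 'e::euclidean_space) chart set \<Rightarrow> 'm set \<Rightarrow> ('m \<Rightarrow> real) \<Rightarrow> bool" where
  "smooth_fun A U f \<longleftrightarrow> (\<forall>c\<in>A. smooth_on (snd c ` (U \<inter> fst c)) (f \<circ> chart_inv c))"

definition in_chart ::
  "('m, 'e::euclidean_space) chart set \<Rightarrow> ('m, 'e) chart \<Rightarrow> ('m \<Rightarrow> 'e) \<Rightarrow> 'e \<Rightarrow> 'e" where
  "in_chart A c X x = comps A c (chart_inv c x) (X (chart_inv c x))"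

definition smooth_vf ::
  "('m, 'e::euclidean_space) chart set \<Rightarrow> 'm set \<Rightarrow> ('m \<Rightarrow> 'e) \<Rightarrow> bool" where
  "smooth_vf A U X \<longleftrightarrow> (\<forall>c\<in>A. smooth_on (snd c ` (U \<inter> fst c)) (in_chart A c X))"

definition smooth_map ::
  "('m::topological_space, 'e::euclidean_space) chart set \<Rightarrow>
   ('b::topological_space, 'f::euclidean_space) chart set \<Rightarrow> ('m \<Rightarrow> 'b) \<Rightarrow> bool" where
  "smooth_map A B \<pi> \<longleftrightarrow> continuous_on UNIV \<pi> \<and>
     (\<forall>c\<in>A. \<forall>d\<in>B. smooth_on (snd c ` (fst c \<inter> \<pi> -` fst d)) (snd d \<circ> \<pi> \<circ> chart_inv c))"

definition tangent_map ::
  "('m, 'e::euclidean_space) chart set \<Rightarrow> ('b, 'f::euclidean_space) chart set \<Rightarrow>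
   ('m \<Rightarrow> 'b) \<Rightarrow> 'm \<Rightarrow> 'e \<Rightarrow> 'f" where
  "tangent_map A B \<pi> p =
     frechet_derivative (snd (chart_at B (\<pi> p)) \<circ> \<pi> \<circ> chart_inv (chart_at A p))
       (at (snd (chart_at A p) p))"

definition dir_deriv ::
  "('m, 'e::euclidean_space) chart set \<Rightarrow> ('m \<Rightarrow> 'e) \<Rightarrow> ('m \<Rightarrow> real) \<Rightarrow> 'm \<Rightarrow> real" where
  "dir_deriv A X f p =
     frechet_derivative (f \<circ> chart_inv (chart_at A p)) (at (snd (chart_at A p) p)) (X p)"

definition lie_bracket ::
  "('m, 'e::euclidean_space) chart set \<Rightarrow> ('m \<Rightarrow> 'e) \<Rightarrow> ('m \<Rightarrow> 'e) \<Rightarrow> 'm \<Rightarrow> 'e" where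
  "lie_bracket A X Y p = (let c = chart_at A p; x = snd c p in
     frechet_derivative (in_chart A c Y) (at x) (X p) -
     frechet_derivative (in_chart A c X) (at x) (Y p))"

definition smooth_endo ::
  "('m::topological_space, 'e::euclidean_space) chart set \<Rightarrow> ('m \<Rightarrow> 'e \<Rightarrow> 'e) \<Rightarrow> bool" where
  "smooth_endo A F \<longleftrightarrow> (\<forall>p. linear (F p)) \<and>
     (\<forall>U X. open U \<and> smooth_vf A U X \<longrightarrow> smooth_vf A U (\<lambda>p. F p (X p)))"

definition riemannian_metric ::
  "('m::topological_space, 'e::euclidean_space) chart set \<Rightarrow> ('m \<Rightarrow> 'e \<Rightarrow> 'e \<Rightarrow> real) \<Rightarrow> bool" where
  "riemannian_metric A g \<longleftrightarrow>
     (\<forall>p. bilinear (g p) \<and> (\<forall>u v. g p u v = g p v u) \<and> (\<forall>v. v \<noteq> 0 \<longrightarrow> g p v v > 0)) \<and>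
     (\<forall>U X Y. open U \<and> smooth_vf A U X \<and> smooth_vf A U Y \<longrightarrow>
        smooth_fun A U (\<lambda>p. g p (X p) (Y p)))"

text \<open>
  A connection acts on locally defined vector fields, i.e. it is given on every open set \<open>U\<close>,
  compatibly with restriction.
\<close>

type_synonym ('m, 'e) connection = "('m \<Rightarrow> 'e) \<Rightarrow> ('m \<Rightarrow> 'e) \<Rightarrow> 'm \<Rightarrow> 'e"

definition affine_connection ::
  "('m::topological_space, 'e::euclidean_space) chart set \<Rightarrow> ('m, 'e) connection \<Rightarrow> bool" where
  "affine_connection A nab \<longleftrightarrow> (\<forall>U X Y. open U \<and> smooth_vf A U X \<and> smooth_vf A U Y \<longrightarrow>
     smooth_vf A U (nab X Y) \<and>
     (\<forall>Z. smooth_vf A U Z \<longrightarrow> (\<forall>p\<in>U.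
        nab (\<lambda>q. X q + Z q) Y p = nab X Y p + nab Z Y p \<and>
        nab X (\<lambda>q. Y q + Z q) p = nab X Y p + nab X Z p)) \<and>
     (\<forall>f. smooth_fun A U f \<longrightarrow> (\<forall>p\<in>U.
        nab (\<lambda>q. f q *\<^sub>R X q) Y p = f p *\<^sub>R nab X Y p \<and>
        nab X (\<lambda>q. f q *\<^sub>R Y q) p = dir_deriv A X f p *\<^sub>R Y p + f p *\<^sub>R nab X Y p)))"

definition levi_civita ::
  "('m::topological_space, 'e::euclidean_space) chart set \<Rightarrow> ('m \<Rightarrow> 'e \<Rightarrow> 'e \<Rightarrow> real) \<Rightarrow>
   ('m, 'e) connection \<Rightarrow> bool" where
  "levi_civita A g nab \<longleftrightarrow> affine_connection A nab \<and>
     (\<forall>U X Y. open U \<and> smooth_vf A U X \<and> smooth_vf A U Y \<longrightarrow>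
        (\<forall>p\<in>U. nab X Y p - nab Y X p = lie_bracket A X Y p) \<and>
        (\<forall>Z. smooth_vf A U Z \<longrightarrow> (\<forall>p\<in>U.
           dir_deriv A X (\<lambda>q. g q (Y q) (Z q)) p = g p (nab X Y p) (Z p) + g p (Y p) (nab X Z p))))"

text \<open>As many orthonormal fields as the dimension, hence a basis at every point of \<open>U\<close>.\<close>

definition orthonormal_frame ::
  "('m, 'e::euclidean_space) chart set \<Rightarrow> ('m \<Rightarrow> 'e \<Rightarrow> 'e \<Rightarrow> real) \<Rightarrow> 'm set \<Rightarrow>
   (nat \<Rightarrow> 'm \<Rightarrow> 'e) \<Rightarrow> bool" where
  "orthonormal_frame A g U E \<longleftrightarrow> (\<forall>i<DIM('e). smooth_vf A U (E i)) \<and>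
     (\<forall>p\<in>U. \<forall>i<DIM('e). \<forall>j<DIM('e). g p (E i p) (E j p) = (if i = j then 1 else 0))"

text \<open>
  Endomorphism fields of a vector bundle (\<open>TM\<close> or a subbundle of it) are represented here by their
  action \<open>F\<close> on sections, and \<open>bnab\<close> is a connection in that bundle.
\<close>

definition act :: "('m \<Rightarrow> 'e \<Rightarrow> 'e) \<Rightarrow> ('m \<Rightarrow> 'e) \<Rightarrow> 'm \<Rightarrow> 'e" where
  "act F Z p = F p (Z p)"

definition cov_end ::
  "('m, 'e::euclidean_space) connection \<Rightarrow> ('m \<Rightarrow> 'e) \<Rightarrow>
   (('m \<Rightarrow> 'e) \<Rightarrow> 'm \<Rightarrow> 'e) \<Rightarrow> ('m \<Rightarrow> 'e) \<Rightarrow> 'm \<Rightarrow> 'e" where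
  "cov_end bnab X F Z p = bnab X (F Z) p - F (bnab X Z) p"

definition cov2_end ::
  "('m, 'e::euclidean_space) connection \<Rightarrow> ('m, 'e) connection \<Rightarrow> ('m \<Rightarrow> 'e) \<Rightarrow> ('m \<Rightarrow> 'e) \<Rightarrow>
   (('m \<Rightarrow> 'e) \<Rightarrow> 'm \<Rightarrow> 'e) \<Rightarrow> ('m \<Rightarrow> 'e) \<Rightarrow> 'm \<Rightarrow> 'e" where
  "cov2_end nab bnab X Y F Z p =
     cov_end bnab X (cov_end bnab Y F) Z p - cov_end bnab (nab X Y) F Z p"

definition rough_laplacian_end ::
  "('m, 'e::euclidean_space) connection \<Rightarrow> ('m, 'e) connection \<Rightarrow> (nat \<Rightarrow> 'm \<Rightarrow> 'e) \<Rightarrow>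
   (('m \<Rightarrow> 'e) \<Rightarrow> 'm \<Rightarrow> 'e) \<Rightarrow> ('m \<Rightarrow> 'e) \<Rightarrow> 'm \<Rightarrow> 'e" where
  "rough_laplacian_end nab bnab E F Z p = - (\<Sum>i<DIM('e). cov2_end nab bnab (E i) (E i) F Z p)"

definition cov2_vf ::
  "('m, 'e::euclidean_space) connection \<Rightarrow> ('m \<Rightarrow> 'e) \<Rightarrow> ('m \<Rightarrow> 'e) \<Rightarrow> ('m \<Rightarrow> 'e) \<Rightarrow> 'm \<Rightarrow> 'e" where
  "cov2_vf nab X Y Z p = nab X (nab Y Z) p - nab (nab X Y) Z p"

definition rough_laplacian_vf ::
  "('m, 'e::euclidean_space) connection \<Rightarrow> (nat \<Rightarrow> 'm \<Rightarrow> 'e) \<Rightarrow> ('m \<Rightarrow> 'e) \<Rightarrow> 'm \<Rightarrow> 'e" where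
  "rough_laplacian_vf nab E Z p = - (\<Sum>i<DIM('e). cov2_vf nab (E i) (E i) Z p)"

definition tau_end ::
  "('m, 'e::euclidean_space) connection \<Rightarrow> ('m, 'e) connection \<Rightarrow> (nat \<Rightarrow> 'm \<Rightarrow> 'e) \<Rightarrow>
   (('m \<Rightarrow> 'e) \<Rightarrow> 'm \<Rightarrow> 'e) \<Rightarrow> ('m \<Rightarrow> 'e) \<Rightarrow> 'm \<Rightarrow> 'e" where
  "tau_end nab bnab E J Z p =
     rough_laplacian_end nab bnab E J (J Z) p - J (rough_laplacian_end nab bnab E J Z) p"

definition almost_contact_metric ::
  "('m::topological_space, 'e::euclidean_space) chart set \<Rightarrow> ('m \<Rightarrow> 'e \<Rightarrow> 'e) \<Rightarrow> ('m \<Rightarrow> 'e) \<Rightarrow>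
   ('m \<Rightarrow> 'e \<Rightarrow> real) \<Rightarrow> ('m \<Rightarrow> 'e \<Rightarrow> 'e \<Rightarrow> real) \<Rightarrow> bool" where
  "almost_contact_metric A \<phi> \<xi> \<eta> g \<longleftrightarrow>
     riemannian_metric A g \<and> smooth_endo A \<phi> \<and> smooth_vf A UNIV \<xi> \<and>
     (\<forall>p. g p (\<xi> p) (\<xi> p) = 1) \<and> (\<forall>p v. \<eta> p v = g p (\<xi> p) v) \<and>
     (\<forall>p v. \<phi> p (\<phi> p v) = - v + \<eta> p v *\<^sub>R \<xi> p) \<and>
     (\<forall>p u v. g p (\<phi> p u) (\<phi> p v) = g p u v - \<eta> p u * \<eta> p v)"

definition ext_deriv ::
  "('m, 'e::euclidean_space) chart set \<Rightarrow> ('m \<Rightarrow> 'e \<Rightarrow> real) \<Rightarrow> ('m \<Rightarrow> 'e) \<Rightarrow> ('m \<Rightarrow> 'e) \<Rightarrow> 'm \<Rightarrow> real" where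
  "ext_deriv A \<eta> X Y p = 1/2 * (dir_deriv A X (\<lambda>q. \<eta> q (Y q)) p
     - dir_deriv A Y (\<lambda>q. \<eta> q (X q)) p - \<eta> p (lie_bracket A X Y p))"

definition contact_metric ::
  "('m::topological_space, 'e::euclidean_space) chart set \<Rightarrow> ('m \<Rightarrow> 'e \<Rightarrow> 'e) \<Rightarrow> ('m \<Rightarrow> 'e) \<Rightarrow>
   ('m \<Rightarrow> 'e \<Rightarrow> real) \<Rightarrow> ('m \<Rightarrow> 'e \<Rightarrow> 'e \<Rightarrow> real) \<Rightarrow> bool" where
  "contact_metric A \<phi> \<xi> \<eta> g \<longleftrightarrow> almost_contact_metric A \<phi> \<xi> \<eta> g \<and>
     (\<forall>U X Y. open U \<and> smooth_vf A U X \<and> smooth_vf A U Y \<longrightarrow>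
        (\<forall>p\<in>U. ext_deriv A \<eta> X Y p = g p (X p) (\<phi> p (Y p))))"

text \<open>The connection in \<open>ker \<eta>\<close>: the orthogonal projection of the Levi-Civita connection.\<close>

definition bar_nabla ::
  "('m, 'e::euclidean_space) connection \<Rightarrow> ('m \<Rightarrow> 'e) \<Rightarrow> ('m \<Rightarrow> 'e \<Rightarrow> real) \<Rightarrow> ('m, 'e) connection" where
  "bar_nabla nab \<xi> \<eta> X Y p = nab X Y p - \<eta> p (nab X Y p) *\<^sub>R \<xi> p"

definition tau_xi ::
  "('m \<Rightarrow> 'e::euclidean_space \<Rightarrow> 'e \<Rightarrow> real) \<Rightarrow> ('m, 'e) connection \<Rightarrow> (nat \<Rightarrow> 'm \<Rightarrow> 'e) \<Rightarrow>
   ('m \<Rightarrow> 'e) \<Rightarrow> 'm \<Rightarrow> 'e" where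
  "tau_xi g nab E \<xi> p = rough_laplacian_vf nab E \<xi> p -
     (\<Sum>i<DIM('e). g p (nab (E i) \<xi> p) (nab (E i) \<xi> p)) *\<^sub>R \<xi> p"

definition T_phi ::
  "('m, 'e::euclidean_space) connection \<Rightarrow> ('m, 'e) connection \<Rightarrow> (nat \<Rightarrow> 'm \<Rightarrow> 'e) \<Rightarrow>
   ('m \<Rightarrow> 'e) \<Rightarrow> (('m \<Rightarrow> 'e) \<Rightarrow> 'm \<Rightarrow> 'e) \<Rightarrow> 'm \<Rightarrow> 'e" where
  "T_phi nab bnab E \<xi> J p = (\<Sum>i<DIM('e). cov_end bnab (E i) J (nab (E i) \<xi>) p)"

text \<open>
  An endomorphism field of \<open>D = ker \<eta>\<close> vanishes iff it annihilates all local sections \<open>Z\<close> of \<open>D\<close>;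
  on such sections \<open>J\<close> acts as \<open>\<phi>\<close>. The connection \<open>nab\<close> is meant to be the Levi-Civita connection
  of \<open>g\<close>.
\<close>

definition harmonic_acm ::
  "('m::topological_space, 'e::euclidean_space) chart set \<Rightarrow> ('m \<Rightarrow> 'e \<Rightarrow> 'e) \<Rightarrow> ('m \<Rightarrow> 'e) \<Rightarrow>
   ('m \<Rightarrow> 'e \<Rightarrow> real) \<Rightarrow> ('m \<Rightarrow> 'e \<Rightarrow> 'e \<Rightarrow> real) \<Rightarrow> ('m, 'e) connection \<Rightarrow> bool" where
  "harmonic_acm A \<phi> \<xi> \<eta> g nab \<longleftrightarrow>
     (let bnab = bar_nabla nab \<xi> \<eta>; J = act \<phi> in
      \<forall>U E. open U \<and> orthonormal_frame A g U E \<longrightarrow>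
        (\<forall>p\<in>U. tau_xi g nab E \<xi> p + (1/2) *\<^sub>R J (T_phi nab bnab E \<xi> J) p = 0) \<and>
        (\<forall>Z. smooth_vf A U Z \<and> (\<forall>p\<in>U. \<eta> p (Z p) = 0) \<longrightarrow>
           (\<forall>p\<in>U. tau_end nab bnab E J Z p = 0)))"

definition almost_hermitian ::
  "('b::topological_space, 'f::euclidean_space) chart set \<Rightarrow> ('b \<Rightarrow> 'f \<Rightarrow> 'f \<Rightarrow> real) \<Rightarrow>
   ('b \<Rightarrow> 'f \<Rightarrow> 'f) \<Rightarrow> bool" where
  "almost_hermitian B h J \<longleftrightarrow> riemannian_metric B h \<and> smooth_endo B J \<and>
     (\<forall>p v. J p (J p v) = - v) \<and> (\<forall>p u v. h p (J p u) (J p v) = h p u v)"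

definition harmonic_ah ::
  "('b::topological_space, 'f::euclidean_space) chart set \<Rightarrow> ('b \<Rightarrow> 'f \<Rightarrow> 'f \<Rightarrow> real) \<Rightarrow>
   ('b \<Rightarrow> 'f \<Rightarrow> 'f) \<Rightarrow> ('b, 'f) connection \<Rightarrow> bool" where
  "harmonic_ah B h J nab \<longleftrightarrow>
     (\<forall>U E. open U \<and> orthonormal_frame B h U E \<longrightarrow>
        (\<forall>Z. smooth_vf B U Z \<longrightarrow> (\<forall>p\<in>U. tau_end nab nab E (act J) Z p = 0)))"

definition vertical ::
  "('m, 'e::euclidean_space) chart set \<Rightarrow> ('b, 'f::euclidean_space) chart set \<Rightarrow> ('m \<Rightarrow> 'b) \<Rightarrow>
   'm \<Rightarrow> 'e set" where
  "vertical A B \<pi> p = {v. tangent_map A B \<pi> p v = 0}"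

definition horizontal ::
  "('m, 'e::euclidean_space) chart set \<Rightarrow> ('m \<Rightarrow> 'e \<Rightarrow> 'e \<Rightarrow> real) \<Rightarrow>
   ('b, 'f::euclidean_space) chart set \<Rightarrow> ('m \<Rightarrow> 'b) \<Rightarrow> 'm \<Rightarrow> 'e set" where
  "horizontal A g B \<pi> p = {v. \<forall>w\<in>vertical A B \<pi> p. g p v w = 0}"

definition riemannian_submersion ::
  "('m::topological_space, 'e::euclidean_space) chart set \<Rightarrow> ('m \<Rightarrow> 'e \<Rightarrow> 'e \<Rightarrow> real) \<Rightarrow>
   ('b::topological_space, 'f::euclidean_space) chart set \<Rightarrow> ('b \<Rightarrow> 'f \<Rightarrow> 'f \<Rightarrow> real) \<Rightarrow>
   ('m \<Rightarrow> 'b) \<Rightarrow> bool" where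
  "riemannian_submersion A g B h \<pi> \<longleftrightarrow> smooth_map A B \<pi> \<and> surj \<pi> \<and>
     (\<forall>p. surj (tangent_map A B \<pi> p)) \<and>
     (\<forall>p. \<forall>u\<in>horizontal A g B \<pi> p. \<forall>v\<in>horizontal A g B \<pi> p.
        h (\<pi> p) (tangent_map A B \<pi> p u) (tangent_map A B \<pi> p v) = g p u v)"

definition submersive_onto ::
  "('m::topological_space, 'e::euclidean_space) chart set \<Rightarrow> ('m \<Rightarrow> 'e \<Rightarrow> 'e) \<Rightarrow> ('m \<Rightarrow> 'e) \<Rightarrow>
   ('m \<Rightarrow> 'e \<Rightarrow> real) \<Rightarrow> ('m \<Rightarrow> 'e \<Rightarrow> 'e \<Rightarrow> real) \<Rightarrow>
   ('b::topological_space, 'f::euclidean_space) chart set \<Rightarrow> ('b \<Rightarrow> 'f \<Rightarrow> 'f \<Rightarrow> real) \<Rightarrow>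
   ('b \<Rightarrow> 'f \<Rightarrow> 'f) \<Rightarrow> ('m \<Rightarrow> 'b) \<Rightarrow> bool" where
  "submersive_onto A \<phi> \<xi> \<eta> g B h J' \<pi> \<longleftrightarrow>
     almost_hermitian B h J' \<and> riemannian_submersion A g B h \<pi> \<and>
     (\<forall>p. horizontal A g B \<pi> p = {v. \<eta> p v = 0}) \<and>
     (\<forall>p. \<xi> p \<in> vertical A B \<pi> p) \<and>
     (\<forall>p v. \<eta> p v = 0 \<longrightarrow> tangent_map A B \<pi> p (\<phi> p v) = J' (\<pi> p) (tangent_map A B \<pi> p v))"

end

theory Submission
  imports Defs
begin

text \<open>
  The contact condition makes the flow of \<open>\<xi>\<close> commute with horizontal lifts \<open>X\<close> of fields of the base:
  \<open>[\<xi>, X]\<close> is vertical because \<open>\<xi>\<close> is vertical, and horizontal because \<open>d\<eta>(\<xi>, \<sqdot>) = 0\<close>, hence zero.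
  Therefore \<open>\<nabla>\<^sub>X \<xi> = - \<phi> X\<close> for all \<open>X\<close>, the derivative of \<open>J\<close> in the direction \<open>\<xi>\<close> vanishes, and
  by the Koszul formula the projected connection takes horizontal lifts to the lift of the Levi-Civita
  derivative of the base. Computing with the frame that consists of the lift of a frame of the base
  and \<open>\<xi>\<close>, one finds that \<open>\<tau>(J)\<close> is the lift of the tension field of the base. The
  remaining equation always holds: \<open>d\<Phi> = d\<^sup>2\<eta> = 0\<close> makes the divergence of \<open>J\<close> vanish, which gives
  \<open>T(\<phi>) = 0\<close> and \<open>\<tau>(\<xi>) = 0\<close>.
\<close>

section \<open>Smooth maps between Euclidean spaces\<close>

text \<open>Harmonicity is stated for all local orthonormal frames and all local sections, whereas
  the comparison with the base is made for an adapted frame and for lifts. Tensoriality bridges the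
  gap: second covariant derivatives are linear over functions in each direction, so their traces do
  not depend on the frame, and \<open>tau_end\<close> is linear over functions in the section, so it
  suffices to test it on the lifts of a frame. As fields are total functions and connections are
  constrained only by axioms on open sets, linearity over functions is also what allows a field to
  be replaced by one that agrees with it on \<open>U\<close>. Lifts are not parallel along \<xi>:
  the projected derivative along \<xi> acts on them as -J. This commutes with J, which is why J
  itself is parallel along \<xi>. The link from T(\<phi>) and \<tau>(\<xi>) to the divergence of J
  is \<nabla>\<xi> = -\<phi>, by which derivatives of \<xi> become derivatives of J; the multiple of
  \<xi> that remains in the Laplacian is cancelled by the squared norm of \<nabla>\<xi>, which is
  2n.\<close>

abbreviation fd :: "('a::real_normed_vector \<Rightarrow> 'b::real_normed_vector) \<Rightarrow> 'a \<Rightarrow> 'a \<Rightarrow> 'b" where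
  "fd f x \<equiv> frechet_derivative f (at x)"

text \<open>Both functions have the same set of derivatives at \<open>x\<close>, so the choice
  operator behind \<open>frechet_derivative\<close> picks the same one, even where that set is
  empty.\<close>

lemma fd_cong:
  assumes "open S" "x \<in> S" "\<And>y. y \<in> S \<Longrightarrow> f y = g y"
  shows "fd f x = fd g x"
proof -
  have "(f has_derivative F) (at x) \<longleftrightarrow> (g has_derivative F) (at x)" for F
    using has_derivative_transform_within_open[of f F x UNIV S g]
      has_derivative_transform_within_open[of g F x UNIV S f] assms by auto
  then show ?thesis by (simp add: frechet_derivative_def)
qed

lemma differentiable_cong_open:
  assumes "open S" "x \<in> S" "\<And>y. y \<in> S \<Longrightarrow> f y = g y" "f differentiable (at x)"
  shows "g differentiable (at x)"
  using assms has_derivative_transform_within_open[of f _ x UNIV S g]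
  unfolding differentiable_def by blast

lemma fd_eqI: "(f has_derivative F) (at x) \<Longrightarrow> fd f x = F"
  using frechet_derivative_at by blast

lemma fd_has: "f differentiable (at x) \<Longrightarrow> (f has_derivative fd f x) (at x)"
  using frechet_derivative_works by blast

lemma fd_linear_simps:
  assumes "f differentiable (at x)"
  shows "fd f x (u + v) = fd f x u + fd f x v" "fd f x (c *\<^sub>R u) = c *\<^sub>R fd f x u"
    "fd f x 0 = 0" "fd f x (- u) = - fd f x u" "fd f x (u - v) = fd f x u - fd f x v"
    "fd f x (sum h I) = (\<Sum>i\<in>I. fd f x (h i))"
proof -
  have "linear (fd f x)" using assms by (rule linear_frechet_derivative)
  then show "fd f x (u + v) = fd f x u + fd f x v" "fd f x (c *\<^sub>R u) = c *\<^sub>R fd f x u"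
    "fd f x 0 = 0" "fd f x (- u) = - fd f x u" "fd f x (u - v) = fd f x u - fd f x v"
    "fd f x (sum h I) = (\<Sum>i\<in>I. fd f x (h i))"
    by (simp_all add: linear_add linear_scale linear_0 linear_neg linear_diff linear_sum)
qed

text \<open>Reduces a direction that varies with the point to finitely many constant directions, the
  only ones of which \<open>Ck_on\<close> speaks.\<close>

lemma fd_euclidean:
  fixes f :: "'a::euclidean_space \<Rightarrow> 'b::real_normed_vector"
  assumes "f differentiable (at x)"
  shows "fd f x v = (\<Sum>b\<in>Basis. (v \<bullet> b) *\<^sub>R fd f x b)"
proof -
  have "fd f x v = fd f x (\<Sum>b\<in>Basis. (v \<bullet> b) *\<^sub>R b)" by (simp add: euclidean_representation)
  then show ?thesis using assms by (simp add: fd_linear_simps)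
qed

section \<open>Closure properties of the differentiability classes\<close>

lemma Ck_on_cong:
  "open S \<Longrightarrow> (\<And>x. x \<in> S \<Longrightarrow> f x = g x) \<Longrightarrow> Ck_on k S f \<Longrightarrow> Ck_on k S g"
proof (induction k arbitrary: f g)
  case 0
  then show ?case by (simp cong: continuous_on_cong)
next
  case (Suc k)
  have "g differentiable (at x)" if "x \<in> S" for x
    using differentiable_cong_open[OF Suc.prems(1) that Suc.prems(2)] Suc.prems(3) that by auto
  moreover have "Ck_on k S (\<lambda>x. fd g x v)" for v
  proof (rule Suc.IH[of "\<lambda>x. fd f x v"])
    show "fd f x v = fd g x v" if "x \<in> S" for x
      using fd_cong[OF Suc.prems(1) that Suc.prems(2)] by auto
  qed (use Suc.prems in auto)
  ultimately show ?case by simp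
qed

lemma Ck_on_subset: "Ck_on k S f \<Longrightarrow> T \<subseteq> S \<Longrightarrow> Ck_on k T f"
  by (induction k arbitrary: f) (auto intro: continuous_on_subset)

lemma Ck_on_local:
  "(\<And>x. x \<in> S \<Longrightarrow> \<exists>T. open T \<and> x \<in> T \<and> Ck_on k T f) \<Longrightarrow> Ck_on k S f"
proof (induction k arbitrary: f)
  case 0
  show ?case
    unfolding Ck_on.simps
  proof (rule continuous_at_imp_continuous_on, rule ballI)
    fix x assume "x \<in> S"
    then obtain T where "open T" "x \<in> T" "continuous_on T f" using 0 by auto
    then show "isCont f x" by (simp add: continuous_on_eq_continuous_at)
  qed
next
  case (Suc k)
  have "f differentiable (at x)" if "x \<in> S" for x
    using Suc.prems[OF that] by auto
  moreover have "Ck_on k S (\<lambda>x. fd f x v)" for v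
  proof (rule Suc.IH)
    fix x assume "x \<in> S"
    then obtain T where "open T" "x \<in> T" "Ck_on (Suc k) T f" using Suc.prems by blast
    then show "\<exists>T. open T \<and> x \<in> T \<and> Ck_on k T (\<lambda>x. fd f x v)" by auto
  qed
  ultimately show ?case by simp
qed

text \<open>The product, chain and quotient rules leave an undifferentiated factor, which has to be
  fed to the induction hypothesis at the lower order.\<close>

lemma Ck_on_SucD: "Ck_on (Suc k) S f \<Longrightarrow> Ck_on k S f"
proof (induction k arbitrary: f)
  case 0
  then show ?case
    by (simp add: continuous_at_imp_continuous_on differentiable_imp_continuous_within)
next
  case (Suc k)
  have "f differentiable (at x)" if "x \<in> S" for x using Suc.prems that by simp
  moreover have "Ck_on k S (\<lambda>x. fd f x v)" for v
    by (rule Suc.IH) (use Suc.prems in simp)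
  ultimately show ?case by simp
qed

lemma Ck_on_const: "Ck_on k S (\<lambda>x. c)"
  by (induction k arbitrary: c) auto

lemma Ck_on_bounded_linear:
  assumes L: "bounded_linear L"
  shows "open S \<Longrightarrow> Ck_on k S f \<Longrightarrow> Ck_on k S (\<lambda>x. L (f x))"
proof (induction k arbitrary: f)
  case 0
  then show ?case using L by (simp add: bounded_linear.continuous_on)
next
  case (Suc k)
  have d: "((\<lambda>x. L (f x)) has_derivative (\<lambda>v. L (fd f x v))) (at x)" if "x \<in> S" for x
    using Suc.prems that by (intro bounded_linear.has_derivative[OF L] fd_has) auto
  have "Ck_on k S (\<lambda>x. fd (\<lambda>x. L (f x)) x v)" for v
    by (rule Ck_on_cong[OF _ _ Suc.IH[of "\<lambda>x. fd f x v"]])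
      (use Suc.prems in \<open>auto simp: fd_eqI[OF d]\<close>)
  then show ?case using d by (auto simp: differentiable_def)
qed

lemma Ck_on_add:
  "open S \<Longrightarrow> Ck_on k S f \<Longrightarrow> Ck_on k S g \<Longrightarrow> Ck_on k S (\<lambda>x. f x + g x)"
proof (induction k arbitrary: f g)
  case 0
  then show ?case by (simp add: continuous_on_add)
next
  case (Suc k)
  have d: "((\<lambda>x. f x + g x) has_derivative (\<lambda>v. fd f x v + fd g x v)) (at x)" if "x \<in> S" for x
    using Suc.prems that by (intro has_derivative_add fd_has) auto
  have "Ck_on k S (\<lambda>x. fd (\<lambda>x. f x + g x) x v)" for v
    by (rule Ck_on_cong[OF _ _ Suc.IH[of "\<lambda>x. fd f x v" "\<lambda>x. fd g x v"]])
      (use Suc.prems in \<open>auto simp: fd_eqI[OF d]\<close>)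
  then show ?case using d by (auto simp: differentiable_def)
qed

lemma Ck_on_sum:
  assumes "open S" "\<And>i. i \<in> I \<Longrightarrow> Ck_on k S (f i)"
  shows "Ck_on k S (\<lambda>x. \<Sum>i\<in>I. f i x)"
  using assms(2)
  by (induction I rule: infinite_finite_induct) (auto intro!: Ck_on_const Ck_on_add assms(1))

lemma Ck_on_bilinear:
  assumes B: "bounded_bilinear P"
  shows "open S \<Longrightarrow> Ck_on k S f \<Longrightarrow> Ck_on k S g \<Longrightarrow> Ck_on k S (\<lambda>x. P (f x) (g x))"
proof (induction k arbitrary: f g)
  case 0
  then show ?case using bounded_bilinear.continuous_on[OF B] by simp
next
  case (Suc k)
  have d: "((\<lambda>x. P (f x) (g x)) has_derivative (\<lambda>v. P (f x) (fd g x v) + P (fd f x v) (g x))) (at x)"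
    if "x \<in> S" for x
    using Suc.prems that by (intro bounded_bilinear.FDERIV[OF B] fd_has) auto
  have "Ck_on k S (\<lambda>x. P (f x) (fd g x v) + P (fd f x v) (g x))" for v
    using Suc.prems Ck_on_SucD[OF Suc.prems(2)] Ck_on_SucD[OF Suc.prems(3)]
    by (intro Ck_on_add Suc.IH) auto
  then have "Ck_on k S (\<lambda>x. fd (\<lambda>x. P (f x) (g x)) x v)" for v
    by (rule Ck_on_cong[OF Suc.prems(1), rotated]) (auto simp: fd_eqI[OF d])
  then show ?case using d by (auto simp: differentiable_def)
qed

lemmas Ck_on_scaleR = Ck_on_bilinear[OF bounded_bilinear_scaleR]
lemmas Ck_on_mult = Ck_on_bilinear[OF bounded_bilinear_mult]

text \<open>Expanded in the basis, the chain rule gives a sum of products of a component of the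
  derivative of \<open>g\<close> and a partial derivative of \<open>f\<close> composed with
  \<open>g\<close>; the induction therefore varies \<open>f\<close> and keeps
  \<open>g\<close>.\<close>

lemma Ck_on_compose:
  fixes f :: "'b::euclidean_space \<Rightarrow> 'c::real_normed_vector"
    and g :: "'a::euclidean_space \<Rightarrow> 'b"
  shows "open S \<Longrightarrow> open T \<Longrightarrow> (\<And>x. x \<in> S \<Longrightarrow> g x \<in> T) \<Longrightarrow> Ck_on k T f \<Longrightarrow> Ck_on k S g \<Longrightarrow>
    Ck_on k S (\<lambda>x. f (g x))"
proof (induction k arbitrary: f)
  case 0
  then show ?case using continuous_on_compose2[of T f S g] by auto
next
  case (Suc k)
  have d: "((\<lambda>x. f (g x)) has_derivative (\<lambda>v. fd f (g x) (fd g x v))) (at x)" if "x \<in> S" for x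
    by (rule has_derivative_compose[where f = g and g = f])
      (use Suc.prems that in \<open>auto intro!: fd_has\<close>)
  have eq: "fd (\<lambda>x. f (g x)) x v = (\<Sum>b\<in>Basis. (fd g x v \<bullet> b) *\<^sub>R fd f (g x) b)" if "x \<in> S" for x v
    using fd_euclidean[of f "g x" "fd g x v"] Suc.prems that by (simp add: fd_eqI[OF d])
  have "Ck_on k S (\<lambda>x. \<Sum>b\<in>Basis. (fd g x v \<bullet> b) *\<^sub>R fd f (g x) b)" for v
    using Suc.prems Ck_on_SucD[OF Suc.prems(5)]
    by (intro Ck_on_sum Ck_on_scaleR Suc.IH Ck_on_bounded_linear[OF bounded_linear_inner_left]) auto
  then have "Ck_on k S (\<lambda>x. fd (\<lambda>x. f (g x)) x v)" for v
    by (rule Ck_on_cong[OF Suc.prems(1), rotated]) (simp add: eq)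
  then show ?case using d by (auto simp: differentiable_def)
qed

lemma Ck_on_inverse:
  fixes f :: "'a::euclidean_space \<Rightarrow> real"
  shows "open S \<Longrightarrow> (\<And>x. x \<in> S \<Longrightarrow> f x \<noteq> 0) \<Longrightarrow> Ck_on k S f \<Longrightarrow> Ck_on k S (\<lambda>x. inverse (f x))"
proof (induction k)
  case 0
  then show ?case by (auto intro: continuous_on_inverse)
next
  case (Suc k)
  have d: "((\<lambda>x. inverse (f x)) has_derivative (\<lambda>v. - (inverse (f x) * fd f x v * inverse (f x)))) (at x)"
    if "x \<in> S" for x
    using Suc.prems that by (intro Deriv.has_derivative_inverse fd_has) auto
  have *: "Ck_on k S (\<lambda>x. - (inverse (f x) * fd f x v * inverse (f x)))" for v
    using Suc.prems Ck_on_SucD[OF Suc.prems(3)]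
    by (intro Ck_on_bounded_linear[OF bounded_linear_minus[OF bounded_linear_ident]] Ck_on_mult Suc.IH) auto
  have "Ck_on k S (\<lambda>x. fd (\<lambda>x. inverse (f x)) x v)" for v
    by (rule Ck_on_cong[OF Suc.prems(1) _ *[of v]]) (simp add: fd_eqI[OF d])
  then show ?case using d by (auto simp: differentiable_def)
qed

lemma Ck_on_sqrt:
  fixes f :: "'a::euclidean_space \<Rightarrow> real"
  shows "open S \<Longrightarrow> (\<And>x. x \<in> S \<Longrightarrow> f x > 0) \<Longrightarrow> Ck_on k S f \<Longrightarrow> Ck_on k S (\<lambda>x. sqrt (f x))"
proof (induction k)
  case 0
  then show ?case by (auto intro: continuous_on_real_sqrt)
next
  case (Suc k)
  have d: "((\<lambda>x. sqrt (f x)) has_derivative (\<lambda>v. fd f x v * (inverse (sqrt (f x)) * (1/2)))) (at x)"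
    if "x \<in> S" for x
  proof -
    have "((\<lambda>x. sqrt (f x)) has_derivative (\<lambda>v. fd f x v * (inverse (sqrt (f x)) / 2))) (at x)"
      using Suc.prems that
      by (intro DERIV_compose_FDERIV[OF DERIV_real_sqrt] fd_has) auto
    then show ?thesis by simp
  qed
  have *: "Ck_on k S (\<lambda>x. fd f x v * (inverse (sqrt (f x)) * (1/2)))" for v
    using Suc.prems Ck_on_SucD[OF Suc.prems(3)]
    by (intro Ck_on_mult Ck_on_inverse Suc.IH Ck_on_const) (fastforce dest: less_imp_neq)+
  have "Ck_on k S (\<lambda>x. fd (\<lambda>x. sqrt (f x)) x v)" for v
    by (rule Ck_on_cong[OF Suc.prems(1) _ *[of v]]) (simp add: fd_eqI[OF d])
  then show ?case using d by (auto simp: differentiable_def)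
qed

lemma smooth_on_cong:
  "open S \<Longrightarrow> (\<And>x. x \<in> S \<Longrightarrow> f x = g x) \<Longrightarrow> smooth_on S f \<Longrightarrow> smooth_on S g"
  using Ck_on_cong unfolding smooth_on_def by blast

lemma smooth_on_subset: "smooth_on S f \<Longrightarrow> T \<subseteq> S \<Longrightarrow> smooth_on T f"
  using Ck_on_subset unfolding smooth_on_def by blast

lemma smooth_on_local:
  "(\<And>x. x \<in> S \<Longrightarrow> \<exists>T. open T \<and> x \<in> T \<and> smooth_on T f) \<Longrightarrow> smooth_on S f"
  unfolding smooth_on_def by (intro allI Ck_on_local) blast

lemma smooth_on_const: "smooth_on S (\<lambda>x. c)"
  and smooth_on_add: "open S \<Longrightarrow> smooth_on S f \<Longrightarrow> smooth_on S g \<Longrightarrow> smooth_on S (\<lambda>x. f x + g x)"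
  and smooth_on_sum:
    "open S \<Longrightarrow> (\<And>i. i \<in> I \<Longrightarrow> smooth_on S (F i)) \<Longrightarrow> smooth_on S (\<lambda>x. \<Sum>i\<in>I. F i x)"
  and smooth_on_scaleR:
    "open S \<Longrightarrow> smooth_on S r \<Longrightarrow> smooth_on S f \<Longrightarrow> smooth_on S (\<lambda>x. r x *\<^sub>R f x)"
  and smooth_on_mult:
    "open S \<Longrightarrow> smooth_on S r \<Longrightarrow> smooth_on S r' \<Longrightarrow> smooth_on S (\<lambda>x. r x * (r' x :: real))"
  and smooth_on_inverse:
    "open S \<Longrightarrow> (\<And>x. x \<in> S \<Longrightarrow> r x \<noteq> 0) \<Longrightarrow> smooth_on S r \<Longrightarrow> smooth_on S (\<lambda>x. inverse (r x))"
  and smooth_on_sqrt: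
    "open S \<Longrightarrow> (\<And>x. x \<in> S \<Longrightarrow> r x > 0) \<Longrightarrow> smooth_on S r \<Longrightarrow> smooth_on S (\<lambda>x. sqrt (r x))"
  and smooth_on_bounded_linear:
    "bounded_linear L \<Longrightarrow> open S \<Longrightarrow> smooth_on S f \<Longrightarrow> smooth_on S (\<lambda>x. L (f x))"
  unfolding smooth_on_def
  by (simp_all add: Ck_on_const Ck_on_add Ck_on_sum Ck_on_scaleR Ck_on_mult Ck_on_inverse Ck_on_sqrt
      Ck_on_bounded_linear)

lemma smooth_on_compose:
  "open S \<Longrightarrow> open T \<Longrightarrow> (\<And>x. x \<in> S \<Longrightarrow> g x \<in> T) \<Longrightarrow> smooth_on T f \<Longrightarrow> smooth_on S g \<Longrightarrow>
    smooth_on S (\<lambda>x. f (g x))"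
  unfolding smooth_on_def by (metis Ck_on_compose)

lemma smooth_on_differentiable: "smooth_on S f \<Longrightarrow> x \<in> S \<Longrightarrow> f differentiable (at x)"
  unfolding smooth_on_def by (metis Ck_on.simps(2))

lemma smooth_on_continuous: "smooth_on S f \<Longrightarrow> continuous_on S f"
  unfolding smooth_on_def by (metis Ck_on.simps(1))

lemma smooth_on_fd: "smooth_on S f \<Longrightarrow> smooth_on S (\<lambda>x. fd f x v)"
  unfolding smooth_on_def by (metis Ck_on.simps(2))

lemma smooth_on_ident: "smooth_on S (\<lambda>x. x)"
  unfolding smooth_on_def
proof
  show "Ck_on k S (\<lambda>x. x)" for k
    by (cases k) (auto intro: Ck_on_const)
qed

lemma smooth_on_fd_apply:
  fixes f :: "'a::euclidean_space \<Rightarrow> 'b::real_normed_vector"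
  assumes "open S" "smooth_on S f" "smooth_on S X"
  shows "smooth_on S (\<lambda>x. fd f x (X x))"
proof -
  have "smooth_on S (\<lambda>x. \<Sum>b\<in>Basis. (X x \<bullet> b) *\<^sub>R fd f x b)"
    using assms by (intro smooth_on_sum smooth_on_scaleR smooth_on_fd
        smooth_on_bounded_linear[OF bounded_linear_inner_left])
  then show ?thesis
    by (rule smooth_on_cong[OF assms(1), rotated])
      (simp add: fd_euclidean[OF smooth_on_differentiable[OF assms(2)], symmetric])
qed

section \<open>Symmetry of second derivatives\<close>

lemma has_derivative_along_line:
  fixes f :: "'a::euclidean_space \<Rightarrow> real"
  assumes "f differentiable (at (x + a *\<^sub>R u))"
  shows "((\<lambda>a. f (x + a *\<^sub>R u)) has_derivative (\<lambda>t. t * fd f (x + a *\<^sub>R u) u)) (at a within T)"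
proof -
  have "((\<lambda>a. x + a *\<^sub>R u) has_derivative (\<lambda>t. t *\<^sub>R u)) (at a within T)"
    by (auto intro!: derivative_eq_intros)
  from has_derivative_compose[OF this fd_has[OF assms]] show ?thesis
    by (simp add: fd_linear_simps assms)
qed

text \<open>
  The second difference over the parallelogram with sides \<open>s u\<close>, \<open>s v\<close>, divided by \<open>s\<^sup>2\<close>, is a mixed
  derivative at a nearby point by two applications of the mean value theorem, in either order.
\<close>

lemma second_difference_mvt:
  fixes f :: "'a::euclidean_space \<Rightarrow> real"
  assumes f: "smooth_on (ball x r) f" and s: "0 < s" "s * (norm u + norm v) < r"
  shows "\<exists>y. dist y x \<le> s * (norm u + norm v) \<and>
    f (x + s *\<^sub>R v + s *\<^sub>R u) - f (x + s *\<^sub>R u) - f (x + s *\<^sub>R v) + f x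
      = s * (s * fd (\<lambda>z. fd f z u) y v)"
proof -
  have nrm: "norm (b *\<^sub>R v + a *\<^sub>R u) \<le> s * (norm u + norm v)"
    if "0 \<le> a" "a \<le> s" "0 \<le> b" "b \<le> s" for a b
  proof -
    have "norm (b *\<^sub>R v + a *\<^sub>R u) \<le> b * norm v + a * norm u"
      using norm_triangle_ineq[of "b *\<^sub>R v" "a *\<^sub>R u"] that by simp
    also have "\<dots> \<le> s * norm v + s * norm u"
      using that by (intro add_mono mult_right_mono) auto
    finally show ?thesis by (simp add: algebra_simps)
  qed
  have mem: "x + b *\<^sub>R v + a *\<^sub>R u \<in> ball x r" if "0 \<le> a" "a \<le> s" "0 \<le> b" "b \<le> s" for a b
  proof -
    have "dist x (x + b *\<^sub>R v + a *\<^sub>R u) = norm (b *\<^sub>R v + a *\<^sub>R u)"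
      using norm_minus_cancel[of "b *\<^sub>R v + a *\<^sub>R u"] by (simp add: dist_norm)
    then show ?thesis using nrm[OF that] s by simp
  qed
  \<comment> \<open>The difference in direction \<open>v\<close>, as a function of the position
    along \<open>u\<close>; its increment over \<open>[0, s]\<close> is the second
    difference.\<close>
  define p where "p = (\<lambda>a. f (x + s *\<^sub>R v + a *\<^sub>R u) - f (x + a *\<^sub>R u))"
  have dp: "(p has_derivative (\<lambda>t. t * fd f (x + s *\<^sub>R v + a *\<^sub>R u) u - t * fd f (x + a *\<^sub>R u) u))
      (at a within {0..s})" if "0 \<le> a" "a \<le> s" for a
    using mem[of a s] mem[of a 0] that s unfolding p_def
    by (intro has_derivative_diff has_derivative_along_line smooth_on_differentiable[OF f]) auto
  obtain a where a: "0 < a" "a < s"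
    "p s - p 0 = (s - 0) * fd f (x + s *\<^sub>R v + a *\<^sub>R u) u - (s - 0) * fd f (x + a *\<^sub>R u) u"
    using mvt_simple[of 0 s p, OF s(1) dp] by auto
  \<comment> \<open>The derivative of \<open>p\<close> at \<open>a\<close> is again a difference in
    direction \<open>v\<close>, now of the derivative of \<open>f\<close> along \<open>u\<close>; it
    is the increment of \<open>q\<close> over \<open>[0, s]\<close>.\<close>
  define q where "q = (\<lambda>b. fd f (x + a *\<^sub>R u + b *\<^sub>R v) u)"
  have comm: "x + b *\<^sub>R v + a *\<^sub>R u = x + a *\<^sub>R u + b *\<^sub>R v" for a b
    by simp
  have dq: "(q has_derivative (\<lambda>t. t * fd (\<lambda>z. fd f z u) (x + a *\<^sub>R u + b *\<^sub>R v) v)) (at b within {0..s})"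
    if "0 \<le> b" "b \<le> s" for b
    using mem[of a b] a that unfolding q_def comm
    by (intro has_derivative_along_line smooth_on_differentiable[OF smooth_on_fd[OF f]]) auto
  obtain b where b: "0 < b" "b < s" "q s - q 0 = (s - 0) * fd (\<lambda>z. fd f z u) (x + a *\<^sub>R u + b *\<^sub>R v) v"
    using mvt_simple[of 0 s q, OF s(1) dq] by auto
  have "dist (x + b *\<^sub>R v + a *\<^sub>R u) x \<le> s * (norm u + norm v)"
    using nrm[of a b] a b by (simp add: dist_norm add.assoc)
  moreover have "f (x + s *\<^sub>R v + s *\<^sub>R u) - f (x + s *\<^sub>R u) - f (x + s *\<^sub>R v) + f x = p s - p 0"
    by (simp add: p_def)
  moreover have "p s - p 0 = s * (q s - q 0)"
    using a(3) unfolding q_def comm by (simp add: right_diff_distrib)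
  ultimately show ?thesis using b(3) unfolding comm
    by (intro exI[of _ "x + a *\<^sub>R u + b *\<^sub>R v"]) simp
qed

text \<open>The second difference is symmetric in \<open>u\<close> and \<open>v\<close>, so one
  mixed derivative at some \<open>y\<close> equals the other at some \<open>y'\<close>. By
  continuity both are within \<open>e\<close> of their values at \<open>x\<close> there, which
  excludes a gap of \<open>2 * e\<close>.\<close>

lemma smooth_on_second_fd_symmetric:
  fixes f :: "'a::euclidean_space \<Rightarrow> real"
  assumes S: "open S" "x \<in> S" and f: "smooth_on S f"
  shows "fd (\<lambda>z. fd f z u) x v = fd (\<lambda>z. fd f z v) x u"
proof (rule ccontr)
  let ?F = "\<lambda>y. fd (\<lambda>z. fd f z u) y v" and ?G = "\<lambda>y. fd (\<lambda>z. fd f z v) y u"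
  assume ne: "?F x \<noteq> ?G x"
  define e where "e = \<bar>?F x - ?G x\<bar> / 2"
  have e: "e > 0" using ne by (simp add: e_def)
  obtain r0 where r0: "r0 > 0" "ball x r0 \<subseteq> S" using S openE by blast
  have "isCont ?F x" "isCont ?G x"
    using smooth_on_continuous[OF smooth_on_fd[OF smooth_on_fd[OF f]]] S
    by (auto simp: continuous_on_eq_continuous_at)
  then obtain r1 r2 where r: "r1 > 0" "r2 > 0"
    "\<And>y. dist y x < r1 \<Longrightarrow> dist (?F y) (?F x) < e" "\<And>y. dist y x < r2 \<Longrightarrow> dist (?G y) (?G x) < e"
    using e unfolding continuous_at_eps_delta by metis
  define R where "R = min r0 (min r1 r2)"
  have R: "R > 0" using r r0 by (simp add: R_def)
  \<comment> \<open>The summand 1 keeps the denominator positive when \<open>u\<close> and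
    \<open>v\<close> vanish, and makes \<open>s * (norm u + norm v)\<close> strictly smaller than
    \<open>R\<close>.\<close>
  define s where "s = R / (norm u + norm v + 1)"
  have N: "norm u + norm v + 1 > 0" by (smt (verit) norm_ge_zero)
  have s: "s > 0" using R N by (simp add: s_def)
  have "s * (norm u + norm v) < s * (norm u + norm v + 1)" using s by simp
  also have "\<dots> = R" using N by (simp add: s_def)
  finally have sR: "s * (norm u + norm v) < R" .
  have fb: "smooth_on (ball x r0) f" using f r0 by (auto intro: smooth_on_subset)
  obtain y where y: "dist y x \<le> s * (norm u + norm v)"
    "f (x + s *\<^sub>R v + s *\<^sub>R u) - f (x + s *\<^sub>R u) - f (x + s *\<^sub>R v) + f x = s * (s * ?F y)"
    using second_difference_mvt[of x r0 f s u v, OF fb s] sR by (auto simp: R_def)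
  have "s * (norm v + norm u) < r0" using sR by (simp add: R_def add.commute[of "norm v"])
  then obtain y' where y': "dist y' x \<le> s * (norm u + norm v)"
    "f (x + s *\<^sub>R u + s *\<^sub>R v) - f (x + s *\<^sub>R v) - f (x + s *\<^sub>R u) + f x = s * (s * ?G y')"
    using second_difference_mvt[of x r0 f s v u, OF fb s] unfolding add.commute[of "norm v"] by blast
  have "x + s *\<^sub>R v + s *\<^sub>R u = x + s *\<^sub>R u + s *\<^sub>R v" by simp
  then have "f (x + s *\<^sub>R v + s *\<^sub>R u) = f (x + s *\<^sub>R u + s *\<^sub>R v)" by (rule arg_cong)
  with y(2) y'(2) have "s * (s * ?F y) = s * (s * ?G y')" by linarith
  then have "?F y = ?G y'" using s by simp
  moreover have "dist (?F y) (?F x) < e" "dist (?G y') (?G x) < e"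
    using y(1) y'(1) sR r by (auto simp: R_def)
  moreover have "2 * e = \<bar>?F x - ?G x\<bar>" by (simp add: e_def)
  ultimately show False unfolding dist_real_def by linarith
qed

section \<open>Functions, vector fields and Lie brackets on a manifold\<close>

locale manifold =
  fixes A :: "('m::topological_space, 'e::euclidean_space) chart set"
  assumes atlas: "smooth_atlas A"
begin

abbreviation at_chart :: "'m \<Rightarrow> ('m, 'e) chart" where "at_chart \<equiv> chart_at A"

lemma chart: "c \<in> A \<Longrightarrow> is_chart c"
  using atlas by (auto simp: smooth_atlas_def)

lemma chart_open: "c \<in> A \<Longrightarrow> open (fst c)"
  using chart by (auto simp: is_chart_def)

lemma chart_inv_left [simp]: "c \<in> A \<Longrightarrow> p \<in> fst c \<Longrightarrow> chart_inv c (snd c p) = p"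
  using chart by (auto simp: is_chart_def homeomorphism_def)

lemma chart_inv_left_pair [simp]: "(W, x) \<in> A \<Longrightarrow> p \<in> W \<Longrightarrow> chart_inv (W, x) (x p) = p"
  using chart_inv_left[of "(W, x)"] by simp

lemma chart_image_iff:
  assumes "c \<in> A"
  shows "x \<in> snd c ` (U \<inter> fst c) \<longleftrightarrow> x \<in> snd c ` fst c \<and> chart_inv c x \<in> U"
  using assms by auto

lemma chart_image_open:
  assumes c: "c \<in> A" and U: "open U"
  shows "open (snd c ` (U \<inter> fst c))"
proof -
  have "snd c ` (U \<inter> fst c) = chart_inv c -` U \<inter> snd c ` fst c"
    using chart_image_iff[OF c] by auto
  moreover have "continuous_on (snd c ` fst c) (chart_inv c)" "open (snd c ` fst c)"
    using chart[OF c] by (auto simp: is_chart_def homeomorphism_def)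
  ultimately show ?thesis using U by (metis continuous_on_open_vimage)
qed

lemma chart_image_open': "c \<in> A \<Longrightarrow> open U \<Longrightarrow> open (snd c ` (fst c \<inter> U))"
  using chart_image_open by (simp add: Int_commute)

lemma at_chart [simp]: "at_chart p \<in> A" "p \<in> fst (at_chart p)"
proof -
  have "p \<in> (\<Union>c\<in>A. fst c)" using atlas by (simp add: smooth_atlas_def)
  then have "\<exists>c. c \<in> A \<and> p \<in> fst c" by blast
  then have "at_chart p \<in> A \<and> p \<in> fst (at_chart p)" unfolding chart_at_def by (rule someI_ex)
  then show "at_chart p \<in> A" "p \<in> fst (at_chart p)" by auto
qed

lemma transition_smooth:
  "c \<in> A \<Longrightarrow> d \<in> A \<Longrightarrow> smooth_on (snd c ` (fst c \<inter> fst d)) (snd d \<circ> chart_inv c)"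
  using atlas by (auto simp: smooth_atlas_def)

lemma transition_differentiable:
  assumes "c \<in> A" "d \<in> A" "p \<in> fst c" "p \<in> fst d"
  shows "(snd d \<circ> chart_inv c) differentiable (at (snd c p))"
  using assms by (intro smooth_on_differentiable[OF transition_smooth]) auto

abbreviation trans :: "('m, 'e) chart \<Rightarrow> ('m, 'e) chart \<Rightarrow> 'm \<Rightarrow> 'e \<Rightarrow> 'e" where
  "trans c d p \<equiv> fd (snd d \<circ> chart_inv c) (snd c p)"

text \<open>The factorisation through the transition map holds only over the overlap of the two
  charts; this is open, which is enough for a derivative.\<close>

lemma change_chart:
  assumes "c \<in> A" "d \<in> A" "p \<in> fst c" "p \<in> fst d"
    and f: "(f \<circ> chart_inv d) differentiable (at (snd d p))"
  shows "((f \<circ> chart_inv c) has_derivative (\<lambda>v. fd (f \<circ> chart_inv d) (snd d p) (trans c d p v)))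
    (at (snd c p))"
proof -
  have "((\<lambda>x. (f \<circ> chart_inv d) ((snd d \<circ> chart_inv c) x)) has_derivative
      (\<lambda>v. fd (f \<circ> chart_inv d) (snd d p) (trans c d p v))) (at (snd c p))"
    by (rule has_derivative_compose[OF fd_has[OF transition_differentiable[OF assms(1-4)]]])
      (use assms fd_has[OF f] in \<open>simp del: comp_apply add: comp_apply[of "snd d"]\<close>)
  then show ?thesis
    by (rule has_derivative_transform_within_open[of _ _ _ _ "snd c ` (fst c \<inter> fst d)"])
      (use assms chart_image_open' chart_open in auto)
qed

text \<open>The cocycle rule for components: \<open>change_chart\<close> applied to the coordinate
  map of \<open>e\<close>.\<close>

lemma trans_trans:
  assumes "c \<in> A" "d \<in> A" "e \<in> A" "p \<in> fst c" "p \<in> fst d" "p \<in> fst e"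
  shows "trans d e p (trans c d p v) = trans c e p v"
  using fd_eqI[OF change_chart[of c d p "snd e"]] transition_differentiable assms by simp

lemma trans_self:
  assumes "c \<in> A" "p \<in> fst c"
  shows "trans c c p v = v"
proof -
  have "trans c c p = fd (\<lambda>x. x) (snd c p)"
    by (rule fd_cong[of "snd c ` (UNIV \<inter> fst c)"]) (use assms chart_image_open[of c UNIV] in auto)
  then show ?thesis by simp
qed

lemma comps_trans: "comps A c p = trans (at_chart p) c p"
  by (simp add: comps_def)

lemma trans_comps:
  "c \<in> A \<Longrightarrow> d \<in> A \<Longrightarrow> p \<in> fst c \<Longrightarrow> p \<in> fst d \<Longrightarrow> trans c d p (comps A c p v) = comps A d p v"
  by (simp add: comps_trans trans_trans)

lemma comps_at_chart [simp]: "comps A (at_chart p) p v = v"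
  by (simp add: comps_trans trans_self)

lemma comps_linear:
  assumes "c \<in> A" "p \<in> fst c"
  shows "comps A c p (u + v) = comps A c p u + comps A c p v" "comps A c p (r *\<^sub>R u) = r *\<^sub>R comps A c p u"
  unfolding comps_trans by (rule fd_linear_simps; use transition_differentiable assms in simp)+

section \<open>Smooth functions and smooth vector fields\<close>

lemma in_chart_apply:
  "c \<in> A \<Longrightarrow> p \<in> fst c \<Longrightarrow> in_chart A c X (snd c p) = comps A c p (X p)"
  by (simp add: in_chart_def)

text \<open>\<open>smooth_fun\<close> asks for smoothness in all charts; since the transition maps
  are smooth, one chart around each point suffices.\<close>

lemma smooth_fun_chartI:
  assumes "\<And>p. p \<in> U \<Longrightarrow> \<exists>c\<in>A. \<exists>V. open V \<and> p \<in> V \<and> p \<in> fst c \<and> smooth_on (snd c ` (V \<inter> fst c)) (f \<circ> chart_inv c)"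
  shows "smooth_fun A U f"
  unfolding smooth_fun_def
proof (intro ballI smooth_on_local)
  fix d x assume d: "d \<in> A" and x: "x \<in> snd d ` (U \<inter> fst d)"
  then obtain p where p: "p \<in> U" "p \<in> fst d" "x = snd d p" by auto
  obtain c V where c: "c \<in> A" "open V" "p \<in> V" "p \<in> fst c" "smooth_on (snd c ` (V \<inter> fst c)) (f \<circ> chart_inv c)"
    using assms[OF p(1)] by blast
  let ?W = "V \<inter> fst c \<inter> fst d"
  have W: "open (snd d ` ?W)" "open (snd c ` (V \<inter> fst c))"
    using c d chart_image_open[of d "V \<inter> fst c"] chart_image_open[of c V] chart_open[of c]
    by (simp_all add: open_Int)
  have t: "smooth_on (snd d ` ?W) (snd c \<circ> chart_inv d)"
    by (rule smooth_on_subset[OF transition_smooth[OF d c(1)]]) auto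
  have "(snd c \<circ> chart_inv d) x \<in> snd c ` (V \<inter> fst c)" if "x \<in> snd d ` ?W" for x
    using that c d by auto
  from smooth_on_compose[OF W this c(5) t] have "smooth_on (snd d ` ?W) (f \<circ> chart_inv d)"
    by (rule smooth_on_cong[OF W(1), rotated]) (use c d in auto)
  then show "\<exists>T. open T \<and> x \<in> T \<and> smooth_on T (f \<circ> chart_inv d)"
    using W p c by (intro exI[of _ "snd d ` ?W"]) auto
qed

text \<open>As for functions, except that the components are also transformed by the derivative of
  the transition map, which is smooth by \<open>smooth_on_fd_apply\<close>.\<close>

lemma smooth_vf_chartI:
  assumes "\<And>p. p \<in> U \<Longrightarrow> \<exists>c\<in>A. \<exists>V. open V \<and> p \<in> V \<and> p \<in> fst c \<and> smooth_on (snd c ` (V \<inter> fst c)) (in_chart A c X)"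
  shows "smooth_vf A U X"
  unfolding smooth_vf_def
proof (intro ballI smooth_on_local)
  fix d x assume d: "d \<in> A" and x: "x \<in> snd d ` (U \<inter> fst d)"
  then obtain p where p: "p \<in> U" "p \<in> fst d" "x = snd d p" by auto
  obtain c V where c: "c \<in> A" "open V" "p \<in> V" "p \<in> fst c" "smooth_on (snd c ` (V \<inter> fst c)) (in_chart A c X)"
    using assms[OF p(1)] by blast
  let ?W = "V \<inter> fst c \<inter> fst d"
  have W: "open (snd d ` ?W)" "open (snd c ` ?W)"
    using c d chart_image_open[of d "V \<inter> fst c"] chart_image_open[of c "V \<inter> fst d"]
      chart_open[of c] chart_open[of d] by (simp_all add: Int_ac open_Int)
  have "smooth_on (snd c ` ?W) (\<lambda>y. fd (snd d \<circ> chart_inv c) y (in_chart A c X y))"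
    using c d
    by (intro smooth_on_fd_apply[OF W(2)] smooth_on_subset[OF transition_smooth] smooth_on_subset[OF c(5)]) auto
  moreover have "smooth_on (snd d ` ?W) (snd c \<circ> chart_inv d)"
    by (rule smooth_on_subset[OF transition_smooth[OF d c(1)]]) auto
  moreover have "(snd c \<circ> chart_inv d) x \<in> snd c ` ?W" if "x \<in> snd d ` ?W" for x
    using that c d by auto
  ultimately have "smooth_on (snd d ` ?W)
      (\<lambda>x. fd (snd d \<circ> chart_inv c) ((snd c \<circ> chart_inv d) x) (in_chart A c X ((snd c \<circ> chart_inv d) x)))"
    using smooth_on_compose[OF W, of "snd c \<circ> chart_inv d" "\<lambda>y. fd (snd d \<circ> chart_inv c) y (in_chart A c X y)"]
    by blast
  then have "smooth_on (snd d ` ?W) (in_chart A d X)"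
    by (rule smooth_on_cong[OF W(1), rotated]) (use c d in \<open>auto simp: in_chart_apply trans_comps\<close>)
  then show "\<exists>T. open T \<and> x \<in> T \<and> smooth_on T (in_chart A d X)"
    using W p c by (intro exI[of _ "snd d ` ?W"]) auto
qed

lemma smooth_vf_local:
  assumes "\<And>p. p \<in> U \<Longrightarrow> \<exists>V. open V \<and> p \<in> V \<and> smooth_vf A V X"
  shows "smooth_vf A U X"
proof (rule smooth_vf_chartI)
  fix p assume "p \<in> U"
  then obtain V where V: "open V" "p \<in> V" "smooth_vf A V X" using assms by blast
  then show "\<exists>c\<in>A. \<exists>V. open V \<and> p \<in> V \<and> p \<in> fst c \<and> smooth_on (snd c ` (V \<inter> fst c)) (in_chart A c X)"
    by (intro bexI[of _ "at_chart p"] exI[of _ V]) (auto simp: smooth_vf_def)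
qed

lemma smooth_fun_subset: "smooth_fun A U f \<Longrightarrow> V \<subseteq> U \<Longrightarrow> smooth_fun A V f"
  unfolding smooth_fun_def by (meson smooth_on_subset image_mono Int_mono subset_refl)

lemma smooth_vf_subset: "smooth_vf A U X \<Longrightarrow> V \<subseteq> U \<Longrightarrow> smooth_vf A V X"
  unfolding smooth_vf_def by (meson smooth_on_subset image_mono Int_mono subset_refl)

lemma smooth_fun_cong:
  assumes "open U" "\<And>p. p \<in> U \<Longrightarrow> f p = f' p" "smooth_fun A U f"
  shows "smooth_fun A U f'"
  unfolding smooth_fun_def
proof
  fix c assume c: "c \<in> A"
  then have "smooth_on (snd c ` (U \<inter> fst c)) (f \<circ> chart_inv c)" using assms by (auto simp: smooth_fun_def)
  then show "smooth_on (snd c ` (U \<inter> fst c)) (f' \<circ> chart_inv c)"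
    by (rule smooth_on_cong[OF chart_image_open[OF c assms(1)], rotated]) (use c assms(2) in auto)
qed

lemma smooth_vf_cong:
  assumes "open U" "\<And>p. p \<in> U \<Longrightarrow> X p = X' p" "smooth_vf A U X"
  shows "smooth_vf A U X'"
  unfolding smooth_vf_def
proof
  fix c assume c: "c \<in> A"
  then have "smooth_on (snd c ` (U \<inter> fst c)) (in_chart A c X)" using assms by (auto simp: smooth_vf_def)
  then show "smooth_on (snd c ` (U \<inter> fst c)) (in_chart A c X')"
    by (rule smooth_on_cong[OF chart_image_open[OF c assms(1)], rotated])
      (use c assms(2) in \<open>auto simp: in_chart_apply\<close>)
qed

lemma smooth_fun_const: "smooth_fun A U (\<lambda>p. r)"
  by (simp add: smooth_fun_def comp_def smooth_on_const)

lemma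
  assumes U: "open U" and f: "smooth_fun A U f"
  shows smooth_fun_add: "smooth_fun A U f' \<Longrightarrow> smooth_fun A U (\<lambda>p. f p + f' p)"
    and smooth_fun_mult: "smooth_fun A U f' \<Longrightarrow> smooth_fun A U (\<lambda>p. f p * f' p)"
    and smooth_fun_inverse: "(\<And>p. p \<in> U \<Longrightarrow> f p \<noteq> 0) \<Longrightarrow> smooth_fun A U (\<lambda>p. inverse (f p))"
    and smooth_fun_sqrt: "(\<And>p. p \<in> U \<Longrightarrow> f p > 0) \<Longrightarrow> smooth_fun A U (\<lambda>p. sqrt (f p))"
  using f unfolding smooth_fun_def comp_def
  by (auto intro!: smooth_on_add smooth_on_mult smooth_on_inverse smooth_on_sqrt chart_image_open U
      dest: less_imp_neq)

lemma smooth_fun_minus: "open U \<Longrightarrow> smooth_fun A U f \<Longrightarrow> smooth_fun A U (\<lambda>p. - f p)"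
  using smooth_fun_mult[of U "\<lambda>p. -1" f] by (simp add: smooth_fun_const)

lemma smooth_fun_sum:
  assumes "open U" "\<And>i. i \<in> I \<Longrightarrow> smooth_fun A U (F i)"
  shows "smooth_fun A U (\<lambda>p. \<Sum>i\<in>I. F i p)"
  using assms(2)
  by (induction I rule: infinite_finite_induct) (auto intro!: smooth_fun_const smooth_fun_add assms(1))

lemma smooth_vf_add:
  assumes "open U" "smooth_vf A U X" "smooth_vf A U Y"
  shows "smooth_vf A U (\<lambda>p. X p + Y p)"
  unfolding smooth_vf_def
proof
  fix c assume c: "c \<in> A"
  have "smooth_on (snd c ` (U \<inter> fst c)) (\<lambda>x. in_chart A c X x + in_chart A c Y x)"
    using assms c by (intro smooth_on_add chart_image_open) (auto simp: smooth_vf_def)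
  then show "smooth_on (snd c ` (U \<inter> fst c)) (in_chart A c (\<lambda>p. X p + Y p))"
    by (rule smooth_on_cong[OF chart_image_open[OF c assms(1)], rotated])
      (use c in \<open>auto simp: in_chart_apply comps_linear\<close>)
qed

lemma smooth_vf_scaleR:
  assumes "open U" "smooth_fun A U f" "smooth_vf A U X"
  shows "smooth_vf A U (\<lambda>p. f p *\<^sub>R X p)"
  unfolding smooth_vf_def
proof
  fix c assume c: "c \<in> A"
  have "smooth_on (snd c ` (U \<inter> fst c)) (\<lambda>x. (f \<circ> chart_inv c) x *\<^sub>R in_chart A c X x)"
    using assms c by (intro smooth_on_scaleR chart_image_open) (auto simp: smooth_vf_def smooth_fun_def comp_def)
  then show "smooth_on (snd c ` (U \<inter> fst c)) (in_chart A c (\<lambda>p. f p *\<^sub>R X p))"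
    by (rule smooth_on_cong[OF chart_image_open[OF c assms(1)], rotated])
      (use c in \<open>auto simp: in_chart_apply comps_linear\<close>)
qed

lemma smooth_vf_zero: "open U \<Longrightarrow> smooth_vf A U (\<lambda>p. 0)"
proof -
  assume U: "open U"
  have z: "comps A c p 0 = 0" if "c \<in> A" "p \<in> fst c" for c p
    using comps_linear(2)[OF that, of 0 0] by simp
  have "smooth_on (snd c ` (U \<inter> fst c)) (in_chart A c (\<lambda>p. 0))" if "c \<in> A" for c
    using that by (intro smooth_on_cong[OF chart_image_open[OF that U] _ smooth_on_const[of _ 0]])
      (auto simp: in_chart_apply z)
  then show ?thesis by (simp add: smooth_vf_def)
qed

lemma smooth_vf_minus: "open U \<Longrightarrow> smooth_vf A U X \<Longrightarrow> smooth_vf A U (\<lambda>p. - X p)"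
  using smooth_vf_scaleR[of U "\<lambda>p. -1" X] by (simp add: smooth_fun_const)

lemma smooth_vf_diff:
  "open U \<Longrightarrow> smooth_vf A U X \<Longrightarrow> smooth_vf A U Y \<Longrightarrow> smooth_vf A U (\<lambda>p. X p - Y p)"
  using smooth_vf_add[of U X "\<lambda>p. - Y p"] by (simp add: smooth_vf_minus)

lemma smooth_vf_sum:
  assumes "open U" "\<And>i. i \<in> I \<Longrightarrow> smooth_vf A U (F i)"
  shows "smooth_vf A U (\<lambda>p. \<Sum>i\<in>I. F i p)"
  using assms(2)
  by (induction I rule: infinite_finite_induct) (auto intro!: smooth_vf_zero smooth_vf_add assms(1))

section \<open>Directional derivatives and Lie brackets\<close>

lemma smooth_fun_differentiable:
  assumes "smooth_fun A U f" "p \<in> U" "c \<in> A" "p \<in> fst c"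
  shows "(f \<circ> chart_inv c) differentiable (at (snd c p))"
  using assms by (intro smooth_on_differentiable[of "snd c ` (U \<inter> fst c)"]) (auto simp: smooth_fun_def)

text \<open>\<open>dir_deriv\<close> uses the chart chosen at each point, and these choices are
  unrelated; a single chart is required before the result can be differentiated again.\<close>

lemma dir_deriv_chart:
  assumes "smooth_fun A U f" "p \<in> U" "c \<in> A" "p \<in> fst c"
  shows "dir_deriv A X f p = fd (f \<circ> chart_inv c) (snd c p) (comps A c p (X p))"
  unfolding dir_deriv_def comps_trans
  using fd_eqI[OF change_chart[OF _ assms(3) _ assms(4) smooth_fun_differentiable[OF assms], of "at_chart p"]]
  by simp

lemma smooth_dir_deriv:
  assumes U: "open U" and f: "smooth_fun A U f" and X: "smooth_vf A U X"
  shows "smooth_fun A U (dir_deriv A X f)"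
  unfolding smooth_fun_def
proof
  fix c assume c: "c \<in> A"
  have "smooth_on (snd c ` (U \<inter> fst c)) (\<lambda>x. fd (f \<circ> chart_inv c) x (in_chart A c X x))"
    using f X c by (intro smooth_on_fd_apply chart_image_open U) (auto simp: smooth_fun_def smooth_vf_def)
  then show "smooth_on (snd c ` (U \<inter> fst c)) (dir_deriv A X f \<circ> chart_inv c)"
    by (rule smooth_on_cong[OF chart_image_open[OF c U], rotated])
      (use c f in \<open>auto simp: dir_deriv_chart in_chart_apply\<close>)
qed

lemma dir_deriv_cong:
  assumes "open U" "p \<in> U" "\<And>q. q \<in> U \<Longrightarrow> f q = f' q" "X p = X' p"
  shows "dir_deriv A X f p = dir_deriv A X' f' p"
proof -
  have "fd (f \<circ> chart_inv (at_chart p)) (snd (at_chart p) p) = fd (f' \<circ> chart_inv (at_chart p)) (snd (at_chart p) p)"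
    by (rule fd_cong[of "snd (at_chart p) ` (U \<inter> fst (at_chart p))"])
      (use assms chart_image_open[of "at_chart p" U] in auto)
  then show ?thesis using assms by (simp add: dir_deriv_def)
qed

lemma dir_deriv_const [simp]: "dir_deriv A X (\<lambda>p. r) p = 0"
  by (simp add: dir_deriv_def comp_def)

lemma dir_deriv_zero_on:
  assumes "open U" "p \<in> U" "\<And>q. q \<in> U \<Longrightarrow> f q = r"
  shows "dir_deriv A X f p = 0"
  using dir_deriv_cong[OF assms(1,2), of f "\<lambda>q. r" X X] assms(3) by simp

context
  fixes U f p
  assumes f: "smooth_fun A U f" and p: "p \<in> U"
begin

lemma dir_deriv_add:
  assumes "smooth_fun A U f'"
  shows "dir_deriv A X (\<lambda>q. f q + f' q) p = dir_deriv A X f p + dir_deriv A X f' p"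
proof -
  let ?c = "at_chart p"
  have "((\<lambda>x. (f \<circ> chart_inv ?c) x + (f' \<circ> chart_inv ?c) x) has_derivative
     (\<lambda>v. fd (f \<circ> chart_inv ?c) (snd ?c p) v + fd (f' \<circ> chart_inv ?c) (snd ?c p) v)) (at (snd ?c p))"
    by (intro has_derivative_add fd_has smooth_fun_differentiable[of U]) (use f p assms in auto)
  then have "fd (\<lambda>x. (f \<circ> chart_inv ?c) x + (f' \<circ> chart_inv ?c) x) (snd ?c p) =
     (\<lambda>v. fd (f \<circ> chart_inv ?c) (snd ?c p) v + fd (f' \<circ> chart_inv ?c) (snd ?c p) v)"
    by (rule fd_eqI)
  then show ?thesis by (simp add: dir_deriv_def comp_def)
qed

lemma dir_deriv_mult:
  assumes "smooth_fun A U f'"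
  shows "dir_deriv A X (\<lambda>q. f q * f' q) p = f p * dir_deriv A X f' p + dir_deriv A X f p * f' p"
proof -
  let ?c = "at_chart p"
  have "((\<lambda>x. (f \<circ> chart_inv ?c) x * (f' \<circ> chart_inv ?c) x) has_derivative
     (\<lambda>v. (f \<circ> chart_inv ?c) (snd ?c p) * fd (f' \<circ> chart_inv ?c) (snd ?c p) v +
       fd (f \<circ> chart_inv ?c) (snd ?c p) v * (f' \<circ> chart_inv ?c) (snd ?c p))) (at (snd ?c p))"
    by (intro has_derivative_mult fd_has smooth_fun_differentiable[of U]) (use f p assms in auto)
  then have "fd (\<lambda>x. (f \<circ> chart_inv ?c) x * (f' \<circ> chart_inv ?c) x) (snd ?c p) =
     (\<lambda>v. (f \<circ> chart_inv ?c) (snd ?c p) * fd (f' \<circ> chart_inv ?c) (snd ?c p) v +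
       fd (f \<circ> chart_inv ?c) (snd ?c p) v * (f' \<circ> chart_inv ?c) (snd ?c p))"
    by (rule fd_eqI)
  then show ?thesis by (simp add: dir_deriv_def comp_def)
qed

lemma dir_deriv_linear:
  "dir_deriv A (\<lambda>q. X q + Y q) f p = dir_deriv A X f p + dir_deriv A Y f p"
  "dir_deriv A (\<lambda>q. X q - Y q) f p = dir_deriv A X f p - dir_deriv A Y f p"
  "dir_deriv A (\<lambda>q. - X q) f p = - dir_deriv A X f p"
  "dir_deriv A (\<lambda>q. r q *\<^sub>R X q) f p = r p * dir_deriv A X f p"
  using fd_linear_simps[OF smooth_fun_differentiable[OF f p, of "at_chart p"]]
  by (auto simp: dir_deriv_def)

end

lemma dir_deriv_diff:
  assumes "open U" "smooth_fun A U f" "p \<in> U" "smooth_fun A U f'"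
  shows "dir_deriv A X (\<lambda>q. f q - f' q) p = dir_deriv A X f p - dir_deriv A X f' p"
proof -
  have m: "smooth_fun A U (\<lambda>p. -1 * f' p)" using assms by (simp add: smooth_fun_minus)
  show ?thesis
    using dir_deriv_add[OF assms(2,3) m] dir_deriv_mult[OF smooth_fun_const[of U "-1"] assms(3,4)] by simp
qed

lemma dir_deriv_minus:
  assumes "open U" "smooth_fun A U f" "p \<in> U"
  shows "dir_deriv A X (\<lambda>q. - f q) p = - dir_deriv A X f p"
  using dir_deriv_diff[OF assms(1) smooth_fun_const assms(3,2), of X 0] by simp

text \<open>Splits the iterated derivative into the Hessian of \<open>f\<close> in the chart,
  symmetric in the two fields, and a first order term. Only the latter survives in a
  commutator.\<close>

lemma dir_deriv_dir_deriv:
  assumes U: "open U" and f: "smooth_fun A U f" and Y: "smooth_vf A U Y" and p: "p \<in> U"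
  defines "c \<equiv> at_chart p"
  shows "dir_deriv A X (dir_deriv A Y f) p =
    fd (\<lambda>z. fd (f \<circ> chart_inv c) z (Y p)) (snd c p) (X p) +
    fd (f \<circ> chart_inv c) (snd c p) (fd (in_chart A c Y) (snd c p) (X p))"
proof -
  let ?x = "snd c p" and ?F = "f \<circ> chart_inv c" and ?Y = "in_chart A c Y"
  let ?S = "snd c ` (U \<inter> fst c)"
  have c: "c \<in> A" "p \<in> fst c" by (auto simp: c_def)
  have S: "open ?S" "?x \<in> ?S" using chart_image_open[OF c(1) U] p c by auto
  have F: "smooth_on ?S ?F" and Ys: "smooth_on ?S ?Y"
    using f Y c by (auto simp: smooth_fun_def smooth_vf_def)
  have Yp: "?Y ?x = Y p" using c by (simp add: in_chart_apply) (simp add: c_def)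
  have eq: "dir_deriv A Y f (chart_inv c x) = (\<Sum>b\<in>Basis. (?Y x \<bullet> b) *\<^sub>R fd ?F x b)" if x: "x \<in> ?S" for x
  proof -
    have "dir_deriv A Y f (chart_inv c x) = fd ?F x (?Y x)"
    proof -
      from x obtain q where q': "x = snd c q" "q \<in> U \<inter> fst c" by (rule imageE)
      then have q: "q \<in> U" "q \<in> fst c" "x = snd c q" by simp_all
      show ?thesis
        unfolding q(3) chart_inv_left[OF c(1) q(2)] in_chart_apply[OF c(1) q(2)]
        by (rule dir_deriv_chart[OF f q(1) c(1) q(2)])
    qed
    also have "\<dots> = (\<Sum>b\<in>Basis. (?Y x \<bullet> b) *\<^sub>R fd ?F x b)"
      by (rule fd_euclidean[OF smooth_on_differentiable[OF F x]])
    finally show ?thesis .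
  qed
  have "((\<lambda>x. \<Sum>b\<in>Basis. (?Y x \<bullet> b) *\<^sub>R fd ?F x b) has_derivative
     (\<lambda>v. \<Sum>b\<in>Basis. (?Y ?x \<bullet> b) *\<^sub>R fd (\<lambda>x. fd ?F x b) ?x v + (fd ?Y ?x v \<bullet> b) *\<^sub>R fd ?F ?x b)) (at ?x)"
    by (intro has_derivative_sum has_derivative_scaleR has_derivative_inner_left fd_has
        smooth_on_differentiable[OF _ S(2)] smooth_on_fd F Ys)
  then have "((dir_deriv A Y f \<circ> chart_inv c) has_derivative
     (\<lambda>v. \<Sum>b\<in>Basis. (?Y ?x \<bullet> b) *\<^sub>R fd (\<lambda>x. fd ?F x b) ?x v + (fd ?Y ?x v \<bullet> b) *\<^sub>R fd ?F ?x b)) (at ?x)"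
    by (rule has_derivative_transform_within_open[OF _ S]) (simp add: eq)
  then have "dir_deriv A X (dir_deriv A Y f) p =
      (\<Sum>b\<in>Basis. (Y p \<bullet> b) *\<^sub>R fd (\<lambda>x. fd ?F x b) ?x (X p)) +
      (\<Sum>b\<in>Basis. (fd ?Y ?x (X p) \<bullet> b) *\<^sub>R fd ?F ?x b)"
    unfolding dir_deriv_def c_def[symmetric] by (simp add: fd_eqI Yp sum.distrib)
  \<comment> \<open>Linearity in the inner direction is not immediate. The swap makes
    \<open>b\<close> the outer direction, where \<open>fd_euclidean\<close> applies; a second swap
    restores the order.\<close>
  also have "(\<Sum>b\<in>Basis. (Y p \<bullet> b) *\<^sub>R fd (\<lambda>x. fd ?F x b) ?x (X p)) =
      (\<Sum>b\<in>Basis. (Y p \<bullet> b) *\<^sub>R fd (\<lambda>x. fd ?F x (X p)) ?x b)"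
    by (simp add: smooth_on_second_fd_symmetric[OF S F, of _ "X p"])
  also have "\<dots> = fd (\<lambda>x. fd ?F x (X p)) ?x (Y p)"
    by (rule fd_euclidean[symmetric], rule smooth_on_differentiable[OF smooth_on_fd[OF F] S(2)])
  also have "\<dots> = fd (\<lambda>x. fd ?F x (Y p)) ?x (X p)"
    by (rule smooth_on_second_fd_symmetric[OF S F])
  also have "(\<Sum>b\<in>Basis. (fd ?Y ?x (X p) \<bullet> b) *\<^sub>R fd ?F ?x b) = fd ?F ?x (fd ?Y ?x (X p))"
    by (rule fd_euclidean[symmetric], rule smooth_on_differentiable[OF F S(2)])
  finally show ?thesis .
qed

text \<open>The Hessian terms of the two iterated derivatives cancel, and the first order terms are
  those in the coordinate definition of \<open>lie_bracket\<close>. From here on brackets are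
  handled through their action on functions.\<close>

lemma dir_deriv_lie_bracket:
  assumes U: "open U" and f: "smooth_fun A U f" and X: "smooth_vf A U X" and Y: "smooth_vf A U Y"
    and p: "p \<in> U"
  shows "dir_deriv A (lie_bracket A X Y) f p =
    dir_deriv A X (dir_deriv A Y f) p - dir_deriv A Y (dir_deriv A X f) p"
proof -
  let ?c = "at_chart p" let ?x = "snd ?c p" and ?F = "f \<circ> chart_inv ?c"
  let ?S = "snd ?c ` (U \<inter> fst ?c)"
  have S: "open ?S" "?x \<in> ?S" using chart_image_open[of ?c, OF _ U] p by auto
  have F: "smooth_on ?S ?F" using f by (auto simp: smooth_fun_def)
  have "fd ?F ?x (lie_bracket A X Y p) =
      fd ?F ?x (fd (in_chart A ?c Y) ?x (X p)) - fd ?F ?x (fd (in_chart A ?c X) ?x (Y p))"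
    unfolding lie_bracket_def Let_def
    by (rule fd_linear_simps, rule smooth_on_differentiable[OF F S(2)])
  moreover have "fd (\<lambda>z. fd ?F z (X p)) ?x (Y p) = fd (\<lambda>z. fd ?F z (Y p)) ?x (X p)"
    by (rule smooth_on_second_fd_symmetric[OF S F])
  ultimately show ?thesis
    using dir_deriv_dir_deriv[OF U f Y p, of X] dir_deriv_dir_deriv[OF U f X p, of Y]
    by (simp add: dir_deriv_def[of A "lie_bracket A X Y" f])
qed

lemma smooth_coordinate: "c \<in> A \<Longrightarrow> smooth_fun A (fst c) (\<lambda>p. snd c p \<bullet> b)"
proof (rule smooth_fun_chartI)
  fix p assume c: "c \<in> A" and p: "p \<in> fst c"
  have "smooth_on (snd c ` (UNIV \<inter> fst c)) (\<lambda>x. x \<bullet> b)"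
    by (rule smooth_on_bounded_linear[OF bounded_linear_inner_left chart_image_open[OF c open_UNIV] smooth_on_ident])
  then have "smooth_on (snd c ` (UNIV \<inter> fst c)) ((\<lambda>p. snd c p \<bullet> b) \<circ> chart_inv c)"
    by (rule smooth_on_cong[OF chart_image_open[OF c open_UNIV], rotated]) (use c in auto)
  then show "\<exists>c'\<in>A. \<exists>V. open V \<and> p \<in> V \<and> p \<in> fst c' \<and>
      smooth_on (snd c' ` (V \<inter> fst c')) ((\<lambda>p. snd c p \<bullet> b) \<circ> chart_inv c')"
    using c p by (intro bexI[of _ c] exI[of _ UNIV]) auto
qed

lemma dir_deriv_coordinate:
  assumes c: "c \<in> A" "p \<in> fst c"
  shows "dir_deriv A X (\<lambda>q. snd c q \<bullet> b) p = comps A c p (X p) \<bullet> b"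
proof -
  have "fd ((\<lambda>q. snd c q \<bullet> b) \<circ> chart_inv c) (snd c p) = fd (\<lambda>x. x \<bullet> b) (snd c p)"
    by (rule fd_cong[of "snd c ` (UNIV \<inter> fst c)"]) (use c chart_image_open[of c UNIV] in auto)
  also have "\<dots> = (\<lambda>v. v \<bullet> b)"
    by (rule fd_eqI, rule bounded_linear_imp_has_derivative, rule bounded_linear_inner_left)
  finally show ?thesis
    using dir_deriv_chart[OF smooth_coordinate[OF c(1)] c(2) c, of X b] by simp
qed

text \<open>Coordinate functions separate tangent vectors. The test functions live on smaller sets
  \<open>V\<close> because coordinates exist only on the domain of a chart.\<close>

lemma tangent_eqI:
  assumes "open U" "p \<in> U"
    "\<And>V f. open V \<Longrightarrow> p \<in> V \<Longrightarrow> V \<subseteq> U \<Longrightarrow> smooth_fun A V f \<Longrightarrow> dir_deriv A X f p = dir_deriv A Y f p"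
  shows "X p = Y p"
proof (rule euclidean_eqI)
  fix b :: 'e
  have "smooth_fun A (U \<inter> fst (at_chart p)) (\<lambda>q. snd (at_chart p) q \<bullet> b)"
    using smooth_coordinate[of "at_chart p" b] by (auto intro: smooth_fun_subset)
  from assms(3)[OF _ _ _ this] show "X p \<bullet> b = Y p \<bullet> b"
    using assms chart_open[of "at_chart p"] by (auto simp: dir_deriv_coordinate)
qed

text \<open>Each double bracket acts on a function as a combination of four triple derivatives, and
  the twelve cancel. Smoothness of the brackets is a hypothesis here;
  \<open>smooth_lie_bracket\<close> supplies it once a Levi-Civita connection is available.\<close>

lemma jacobi_identity:
  assumes U: "open U" and X: "smooth_vf A U X" and Y: "smooth_vf A U Y" and Z: "smooth_vf A U Z"
    and XY: "smooth_vf A U (lie_bracket A X Y)" and YZ: "smooth_vf A U (lie_bracket A Y Z)"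
    and ZX: "smooth_vf A U (lie_bracket A Z X)" and p: "p \<in> U"
  shows "lie_bracket A (lie_bracket A X Y) Z p + lie_bracket A (lie_bracket A Y Z) X p
    + lie_bracket A (lie_bracket A Z X) Y p = 0"
proof -
  let ?B = "lie_bracket A" and ?D = "dir_deriv A"
  let ?J = "\<lambda>p. ?B (?B X Y) Z p + ?B (?B Y Z) X p + ?B (?B Z X) Y p"
  have "?J p = (\<lambda>p. 0) p"
  proof (rule tangent_eqI[OF U p])
    fix V f assume V: "open V" "p \<in> V" "V \<subseteq> U" and f: "smooth_fun A V f"
    note sub = smooth_vf_subset[OF _ V(3)]
    note X = sub[OF X] and Y = sub[OF Y] and Z = sub[OF Z]
      and XY = sub[OF XY] and YZ = sub[OF YZ] and ZX = sub[OF ZX]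
    have b: "?D (?B (?B P Q) R) f p = ?D P (?D Q (?D R f)) p - ?D Q (?D P (?D R f)) p
        - (?D R (?D P (?D Q f)) p - ?D R (?D Q (?D P f)) p)"
      if P: "smooth_vf A V P" and Q: "smooth_vf A V Q" and R: "smooth_vf A V R"
        and PQ: "smooth_vf A V (?B P Q)" for P Q R
    proof -
      have "?D R (?D (?B P Q) f) p = ?D R (\<lambda>q. ?D P (?D Q f) q - ?D Q (?D P f) q) p"
        by (rule dir_deriv_cong[OF V(1,2)]) (auto simp: dir_deriv_lie_bracket[OF V(1) f P Q])
      also have "\<dots> = ?D R (?D P (?D Q f)) p - ?D R (?D Q (?D P f)) p"
        by (intro dir_deriv_diff[OF V(1) _ V(2)] smooth_dir_deriv V(1) f P Q)
      finally show ?thesis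
        using dir_deriv_lie_bracket[OF V(1) f PQ R V(2)]
          dir_deriv_lie_bracket[OF V(1) smooth_dir_deriv[OF V(1) f R] P Q V(2)] by simp
    qed
    show "?D ?J f p = ?D (\<lambda>p. 0) f p"
      using b[OF X Y Z XY] b[OF Y Z X YZ] b[OF Z X Y ZX] dir_deriv_linear(4)[OF f V(2), of "\<lambda>_. 0" X]
      by (simp add: dir_deriv_linear[OF f V(2)])
  qed
  then show ?thesis by simp
qed

text \<open>The components are the constant \<open>v\<close> in the chart \<open>c\<close>,
  converted to the chart chosen at each point. For the chart chosen at \<open>p\<close> this is a
  smooth extension of the tangent vector \<open>v\<close> at \<open>p\<close>.\<close>

definition coord_field :: "('m, 'e) chart \<Rightarrow> 'e \<Rightarrow> 'm \<Rightarrow> 'e" where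
  "coord_field c v p = trans c (at_chart p) p v"

lemma comps_coord_field: "c \<in> A \<Longrightarrow> p \<in> fst c \<Longrightarrow> comps A c p (coord_field c v p) = v"
  by (simp add: coord_field_def comps_trans trans_trans trans_self)

lemma coord_field_comps: "c \<in> A \<Longrightarrow> p \<in> fst c \<Longrightarrow> coord_field c (comps A c p v) p = v"
  by (simp add: coord_field_def trans_comps)

lemma coord_field_at [simp]: "coord_field (at_chart p) v p = v"
  using coord_field_comps[of "at_chart p" p v] by simp

lemma coord_field_linear:
  assumes "c \<in> A" "p \<in> fst c"
  shows "coord_field c (sum h I) p = (\<Sum>i\<in>I. coord_field c (h i) p)"
    "coord_field c (r *\<^sub>R v) p = r *\<^sub>R coord_field c v p"
  unfolding coord_field_def by (rule fd_linear_simps; use transition_differentiable assms in simp)+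

lemma smooth_coord_field:
  assumes c: "c \<in> A"
  shows "smooth_vf A (fst c) (coord_field c v)"
proof (rule smooth_vf_chartI)
  fix p assume p: "p \<in> fst c"
  have "smooth_on (snd c ` (UNIV \<inter> fst c)) (in_chart A c (coord_field c v))"
    by (rule smooth_on_cong[OF chart_image_open[OF c open_UNIV] _ smooth_on_const[of _ v]])
      (use c in \<open>auto simp: in_chart_apply comps_coord_field\<close>)
  then show "\<exists>c'\<in>A. \<exists>V. open V \<and> p \<in> V \<and> p \<in> fst c' \<and>
      smooth_on (snd c' ` (V \<inter> fst c')) (in_chart A c' (coord_field c v))"
    using c p by (intro bexI[of _ c] exI[of _ UNIV]) auto
qed

end

section \<open>Tensorial operators and connections\<close>

context manifold
begin

lemma smooth_fun_continuous:
  assumes U: "open U" and f: "smooth_fun A U f"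
  shows "continuous_on U f"
proof -
  have "continuous_on (U \<inter> fst (at_chart p)) f" for p
  proof -
    let ?c = "at_chart p" let ?V = "U \<inter> fst ?c"
    have "continuous_on (snd ?c ` ?V) (f \<circ> chart_inv ?c)"
      using f by (intro smooth_on_continuous) (simp add: smooth_fun_def)
    moreover have "continuous_on ?V (snd ?c)"
      using chart[of ?c] by (auto simp: is_chart_def homeomorphism_def intro: continuous_on_subset)
    ultimately have "continuous_on ?V ((f \<circ> chart_inv ?c) \<circ> snd ?c)"
      by (rule continuous_on_compose[rotated])
    then show ?thesis by (rule continuous_on_eq) auto
  qed
  moreover have "open (U \<inter> fst (at_chart p))" for p
    using U chart_open[of "at_chart p"] by (simp add: open_Int)
  ultimately have "continuous_on (\<Union>p\<in>U. U \<inter> fst (at_chart p)) f"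
    by (intro continuous_on_open_UN) auto
  moreover have "(\<Union>p\<in>U. U \<inter> fst (at_chart p)) = U" by auto
  ultimately show ?thesis by simp
qed

text \<open>\<open>M\<close> plays the role of the sections over \<open>U\<close> of a subbundle of the tangent bundle.\<close>

definition module_on :: "'m set \<Rightarrow> (('m \<Rightarrow> 'e) \<Rightarrow> bool) \<Rightarrow> bool" where
  "module_on U M \<longleftrightarrow> (\<forall>X Y. M X \<and> M Y \<longrightarrow> M (\<lambda>p. X p + Y p)) \<and>
     (\<forall>f X. smooth_fun A U f \<and> M X \<longrightarrow> M (\<lambda>p. f p *\<^sub>R X p))"

definition tensorial :: "'m set \<Rightarrow> (('m \<Rightarrow> 'e) \<Rightarrow> bool) \<Rightarrow> (('m \<Rightarrow> 'e) \<Rightarrow> 'm \<Rightarrow> 'v::real_vector) \<Rightarrow> bool" where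
  "tensorial U M L \<longleftrightarrow> (\<forall>X Y. M X \<and> M Y \<longrightarrow> (\<forall>p\<in>U. L (\<lambda>p. X p + Y p) p = L X p + L Y p)) \<and>
     (\<forall>f X. smooth_fun A U f \<and> M X \<longrightarrow> (\<forall>p\<in>U. L (\<lambda>p. f p *\<^sub>R X p) p = f p *\<^sub>R L X p))"

lemma tensorialI:
  assumes "\<And>X Y p. M X \<Longrightarrow> M Y \<Longrightarrow> p \<in> U \<Longrightarrow> L (\<lambda>p. X p + Y p) p = L X p + L Y p"
    "\<And>f X p. smooth_fun A U f \<Longrightarrow> M X \<Longrightarrow> p \<in> U \<Longrightarrow> L (\<lambda>p. f p *\<^sub>R X p) p = f p *\<^sub>R L X p"
  shows "tensorial U M L"
  using assms unfolding tensorial_def by blast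

lemma tensorial_add: "tensorial U M L \<Longrightarrow> M X \<Longrightarrow> M Y \<Longrightarrow> p \<in> U \<Longrightarrow> L (\<lambda>p. X p + Y p) p = L X p + L Y p"
  and tensorial_scale: "tensorial U M L \<Longrightarrow> smooth_fun A U f \<Longrightarrow> M X \<Longrightarrow> p \<in> U \<Longrightarrow>
    L (\<lambda>p. f p *\<^sub>R X p) p = f p *\<^sub>R L X p"
  unfolding tensorial_def by blast+

lemma tensorial_zero_on:
  assumes U: "open U" and L: "tensorial U M L" and Z: "M Z" "\<And>p. p \<in> U \<Longrightarrow> Z p = 0" and p: "p \<in> U"
  shows "L Z p = 0"
proof -
  define f :: "'m \<Rightarrow> real" where "f q = (if q \<in> U then 0 else 1)" for q
  have f: "smooth_fun A U f"
    by (rule smooth_fun_cong[OF U _ smooth_fun_const[of U 0]]) (simp add: f_def)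
  \<comment> \<open>On \<open>U\<close> both sides vanish and elsewhere \<open>f\<close> is 1, so
    the two total functions are equal.\<close>
  have "Z = (\<lambda>p. f p *\<^sub>R Z p)" using Z by (auto simp: f_def)
  then have "L Z p = L (\<lambda>p. f p *\<^sub>R Z p) p" by simp
  also have "\<dots> = f p *\<^sub>R L Z p" by (rule tensorial_scale[OF L f Z(1) p])
  finally show ?thesis using p by (simp add: f_def)
qed

text \<open>
  The fields are total functions, so that operators may a priori depend on their values outside
  \<open>U\<close>. Linearity over the functions on \<open>U\<close> (\<open>f = 0\<close> on \<open>U\<close> and \<open>f = 1\<close> elsewhere) excludes this.
\<close>

lemma tensorial_cong:
  assumes U: "open U" and M: "module_on U M" and L: "tensorial U M L"
    and X: "M X" and Y: "M Y" and eq: "\<And>p. p \<in> U \<Longrightarrow> X p = Y p" and p: "p \<in> U"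
  shows "L X p = L Y p"
proof -
  have mY: "M (\<lambda>p. (-1) *\<^sub>R Y p)"
    using M Y smooth_fun_const[of U "-1"] unfolding module_on_def by blast
  then have "M (\<lambda>p. X p + (-1) *\<^sub>R Y p)" using M X unfolding module_on_def by blast
  then have "L (\<lambda>p. X p + (-1) *\<^sub>R Y p) p = 0"
    by (rule tensorial_zero_on[OF U L]) (use eq p in auto)
  then show ?thesis
    using tensorial_add[OF L X mY p] tensorial_scale[OF L smooth_fun_const[of U "-1"] Y p] by simp
qed

text \<open>The index set is nonempty because \<open>module_on\<close> does not provide a zero
  section; the induction starts with a single summand.\<close>

lemma module_on_sum:
  assumes M: "module_on U M" and "finite I" "I \<noteq> {}"
    and "\<And>i. i \<in> I \<Longrightarrow> smooth_fun A U (f i)" "\<And>i. i \<in> I \<Longrightarrow> M (X i)"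
  shows "M (\<lambda>p. \<Sum>i\<in>I. f i p *\<^sub>R X i p)"
  using assms(2-)
proof (induction I rule: finite_ne_induct)
  case (singleton i)
  then show ?case using M by (simp add: module_on_def)
next
  case (insert i I)
  then have "M (\<lambda>p. f i p *\<^sub>R X i p)" "M (\<lambda>p. \<Sum>i\<in>I. f i p *\<^sub>R X i p)"
    using M by (simp_all add: module_on_def)
  then show ?case using M insert by (simp add: module_on_def)
qed

lemma tensorial_sum:
  assumes L: "tensorial U M L" and M: "module_on U M" and "finite I" "I \<noteq> {}"
    and "\<And>i. i \<in> I \<Longrightarrow> smooth_fun A U (f i)" "\<And>i. i \<in> I \<Longrightarrow> M (X i)" and p: "p \<in> U"
  shows "L (\<lambda>p. \<Sum>i\<in>I. f i p *\<^sub>R X i p) p = (\<Sum>i\<in>I. f i p *\<^sub>R L (X i) p)"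
  using assms(3-6)
proof (induction I rule: finite_ne_induct)
  case (singleton i)
  then show ?case using tensorial_scale[OF L _ _ p] by simp
next
  case (insert i I)
  have "M (\<lambda>p. f i p *\<^sub>R X i p)" "M (\<lambda>p. \<Sum>i\<in>I. f i p *\<^sub>R X i p)"
    using M insert module_on_sum[OF M, of I f X] by (simp_all add: module_on_def)
  from tensorial_add[OF L this p] show ?case
    using insert tensorial_scale[OF L _ _ p, of "f i" "X i"] by simp
qed

lemma module_on_smooth_vf: "open U \<Longrightarrow> module_on U (smooth_vf A U)"
  by (simp add: module_on_def smooth_vf_add smooth_vf_scaleR)

end

text \<open>
  A connection \<open>D\<close> in a subbundle of the tangent bundle; \<open>S U\<close> are the sections of the subbundle
  over \<open>U\<close>.
\<close>

locale bundle_connection = manifold A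
  for A :: "('m::topological_space, 'e::euclidean_space) chart set" +
  fixes S :: "'m set \<Rightarrow> ('m \<Rightarrow> 'e) \<Rightarrow> bool" and D :: "('m, 'e) connection"
  assumes S_module: "open U \<Longrightarrow> module_on U (S U)"
    and S_subset: "S U Z \<Longrightarrow> V \<subseteq> U \<Longrightarrow> S V Z"
    and D_section: "open U \<Longrightarrow> smooth_vf A U X \<Longrightarrow> S U Z \<Longrightarrow> S U (D X Z)"
    and D_tensorial: "open U \<Longrightarrow> S U Z \<Longrightarrow> tensorial U (smooth_vf A U) (\<lambda>X. D X Z)"
    and D_add: "open U \<Longrightarrow> smooth_vf A U X \<Longrightarrow> S U Y \<Longrightarrow> S U Z \<Longrightarrow> p \<in> U \<Longrightarrow>
      D X (\<lambda>q. Y q + Z q) p = D X Y p + D X Z p"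
    and D_leibniz: "open U \<Longrightarrow> smooth_vf A U X \<Longrightarrow> S U Z \<Longrightarrow> smooth_fun A U f \<Longrightarrow> p \<in> U \<Longrightarrow>
      D X (\<lambda>q. f q *\<^sub>R Z q) p = dir_deriv A X f p *\<^sub>R Z p + f p *\<^sub>R D X Z p"
begin

lemma S_add: "open U \<Longrightarrow> S U Y \<Longrightarrow> S U Z \<Longrightarrow> S U (\<lambda>p. Y p + Z p)"
  and S_scale: "open U \<Longrightarrow> smooth_fun A U f \<Longrightarrow> S U Z \<Longrightarrow> S U (\<lambda>p. f p *\<^sub>R Z p)"
  using S_module unfolding module_on_def by blast+

lemma S_diff: "open U \<Longrightarrow> S U Y \<Longrightarrow> S U Z \<Longrightarrow> S U (\<lambda>p. Y p - Z p)"
  using S_add[of U Y "\<lambda>p. (-1) *\<^sub>R Z p"] S_scale[of U "\<lambda>p. -1" Z] smooth_fun_const by simp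

text \<open>\<open>D X\<close> is not tensorial in the section, but the derivative of
  \<open>f\<close> in the Leibniz rule multiplies \<open>Z p\<close>, which is zero.\<close>

lemma D_zero_on:
  assumes U: "open U" and X: "smooth_vf A U X" and Z: "S U Z" "\<And>p. p \<in> U \<Longrightarrow> Z p = 0" and p: "p \<in> U"
  shows "D X Z p = 0"
proof -
  define f :: "'m \<Rightarrow> real" where "f q = (if q \<in> U then 0 else 1)" for q
  have f: "smooth_fun A U f"
    by (rule smooth_fun_cong[OF U _ smooth_fun_const[of U 0]]) (simp add: f_def)
  have "Z = (\<lambda>p. f p *\<^sub>R Z p)" using Z by (auto simp: f_def)
  then have "D X Z p = D X (\<lambda>p. f p *\<^sub>R Z p) p" by simp
  also have "\<dots> = dir_deriv A X f p *\<^sub>R Z p + f p *\<^sub>R D X Z p" by (rule D_leibniz[OF U X Z(1) f p])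
  finally show ?thesis using p Z by (simp add: f_def)
qed

lemma D_cong:
  assumes U: "open U" and X: "smooth_vf A U X" "smooth_vf A U X'" and Z: "S U Z" "S U Z'"
    and eq: "\<And>p. p \<in> U \<Longrightarrow> X p = X' p" "\<And>p. p \<in> U \<Longrightarrow> Z p = Z' p" and p: "p \<in> U"
  shows "D X Z p = D X' Z' p"
proof -
  have 1: "D X Z p = D X' Z p"
    by (rule tensorial_cong[OF U module_on_smooth_vf[OF U] D_tensorial[OF U Z(1)] X]) (use eq p in auto)
  have m: "S U (\<lambda>q. Z q - Z' q)" by (rule S_diff[OF U Z])
  have "D X' (\<lambda>q. (Z q - Z' q) + Z' q) p = D X' (\<lambda>q. Z q - Z' q) p + D X' Z' p"
    by (rule D_add[OF U X(2) m Z(2) p])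
  moreover have "D X' (\<lambda>q. Z q - Z' q) p = 0"
    by (rule D_zero_on[OF U X(2) m]) (use eq p in auto)
  ultimately show ?thesis using 1 by simp
qed

lemma D_X_zero:
  assumes "open U" "smooth_vf A U X" "S U Z" "\<And>p. p \<in> U \<Longrightarrow> X p = 0" "p \<in> U"
  shows "D X Z p = 0"
  using tensorial_zero_on[OF assms(1) D_tensorial[OF assms(1,3)] assms(2,4,5)] .

lemma D_uminus:
  assumes "open U" "smooth_vf A U X" "S U Z" "p \<in> U"
  shows "D X (\<lambda>q. - Z q) p = - D X Z p"
  using D_leibniz[OF assms(1-3) smooth_fun_const[of U "-1"] assms(4)] by simp

text \<open>Demanded on every open subset, so that the operator can be restricted: tensoriality over
  \<open>U\<close> says nothing about sections that are smooth over a smaller set only.\<close>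

definition endo_on :: "'m set \<Rightarrow> (('m \<Rightarrow> 'e) \<Rightarrow> 'm \<Rightarrow> 'e) \<Rightarrow> bool" where
  "endo_on U F \<longleftrightarrow> (\<forall>V. open V \<and> V \<subseteq> U \<longrightarrow> (\<forall>Z. S V Z \<longrightarrow> S V (F Z)) \<and> tensorial V (S V) F)"

lemma endo_on_section: "endo_on U F \<Longrightarrow> open U \<Longrightarrow> S U Z \<Longrightarrow> S U (F Z)"
  and endo_on_tensorial: "endo_on U F \<Longrightarrow> open U \<Longrightarrow> tensorial U (S U) F"
  and endo_on_subset: "endo_on U F \<Longrightarrow> V \<subseteq> U \<Longrightarrow> endo_on V F"
  unfolding endo_on_def by blast+

lemma endo_on_cong:
  assumes "endo_on U F" "open U" "S U Z" "S U Z'" "\<And>p. p \<in> U \<Longrightarrow> Z p = Z' p" "p \<in> U"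
  shows "F Z p = F Z' p"
  using tensorial_cong[OF assms(2) S_module[OF assms(2)] endo_on_tensorial[OF assms(1,2)] assms(3-6)] .

lemma endo_on_zero:
  assumes "endo_on U F" "open U" "S U Z" "\<And>p. p \<in> U \<Longrightarrow> Z p = 0" "p \<in> U"
  shows "F Z p = 0"
  using tensorial_zero_on[OF assms(2) endo_on_tensorial[OF assms(1,2)] assms(3-5)] .

text \<open>The term with the derivative of \<open>f\<close> arises from both summands of
  \<open>cov_end\<close> and cancels.\<close>

lemma endo_on_cov_end:
  assumes U: "open U" and X: "smooth_vf A U X" and F: "endo_on U F"
  shows "endo_on U (cov_end D X F)"
  unfolding endo_on_def
proof (intro allI impI conjI)
  fix V assume "open V \<and> V \<subseteq> U"
  then have V: "open V" "V \<subseteq> U" by auto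
  note X = smooth_vf_subset[OF X V(2)] and F = endo_on_subset[OF F V(2)]
  have FS: "S V (F Z)" if "S V Z" for Z by (rule endo_on_section[OF F V(1) that])
  have DS: "S V (D X Z)" if "S V Z" for Z by (rule D_section[OF V(1) X that])
  note T = endo_on_tensorial[OF F V(1)] and c = endo_on_cong[OF F V(1)]
  show "S V (cov_end D X F Z)" if "S V Z" for Z
    using S_diff[OF V(1) DS[OF FS[OF that]] FS[OF DS[OF that]]] by (simp add: cov_end_def[abs_def])
  show "tensorial V (S V) (cov_end D X F)"
  proof (rule tensorialI)
    fix Y Z p assume Y: "S V Y" and Z: "S V Z" and p: "p \<in> V"
    note YZ = S_add[OF V(1) Y Z]
    have "D X (F (\<lambda>p. Y p + Z p)) p = D X (\<lambda>q. F Y q + F Z q) p"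
      by (rule D_cong[OF V(1) X X FS[OF YZ] S_add[OF V(1) FS[OF Y] FS[OF Z]] refl _ p])
        (rule tensorial_add[OF T Y Z])
    moreover have "F (D X (\<lambda>p. Y p + Z p)) p = F (\<lambda>q. D X Y q + D X Z q) p"
      by (rule c[OF DS[OF YZ] S_add[OF V(1) DS[OF Y] DS[OF Z]] _ p]) (rule D_add[OF V(1) X Y Z])
    ultimately show "cov_end D X F (\<lambda>p. Y p + Z p) p = cov_end D X F Y p + cov_end D X F Z p"
      by (simp add: cov_end_def D_add[OF V(1) X FS[OF Y] FS[OF Z] p] tensorial_add[OF T DS[OF Y] DS[OF Z] p])
  next
    fix f Z p assume f: "smooth_fun A V f" and Z: "S V Z" and p: "p \<in> V"
    note fZ = S_scale[OF V(1) f Z]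
    have df: "smooth_fun A V (dir_deriv A X f)" by (rule smooth_dir_deriv[OF V(1) f X])
    have "D X (F (\<lambda>p. f p *\<^sub>R Z p)) p = D X (\<lambda>q. f q *\<^sub>R F Z q) p"
      by (rule D_cong[OF V(1) X X FS[OF fZ] S_scale[OF V(1) f FS[OF Z]] refl _ p])
        (rule tensorial_scale[OF T f Z])
    moreover have "F (D X (\<lambda>p. f p *\<^sub>R Z p)) p = F (\<lambda>q. dir_deriv A X f q *\<^sub>R Z q + f q *\<^sub>R D X Z q) p"
      by (rule c[OF DS[OF fZ] S_add[OF V(1) S_scale[OF V(1) df Z] S_scale[OF V(1) f DS[OF Z]]] _ p])
        (rule D_leibniz[OF V(1) X Z f])
    ultimately show "cov_end D X F (\<lambda>p. f p *\<^sub>R Z p) p = f p *\<^sub>R cov_end D X F Z p"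
      by (simp add: cov_end_def D_leibniz[OF V(1) X FS[OF Z] f p] tensorial_scale[OF T df Z p]
          tensorial_scale[OF T f DS[OF Z] p] tensorial_add[OF T S_scale[OF V(1) df Z] S_scale[OF V(1) f DS[OF Z]] p]
          scaleR_diff_right)
  qed
qed

lemma cov_end_tensorial:
  assumes U: "open U" and F: "endo_on U F" and Z: "S U Z"
  shows "tensorial U (smooth_vf A U) (\<lambda>X. cov_end D X F Z)"
proof -
  note FZ = endo_on_section[OF F U Z] and T = endo_on_tensorial[OF F U] and c = endo_on_cong[OF F U]
  note DT = D_tensorial[OF U Z] and DS = D_section[OF U _ Z] and DT' = D_tensorial[OF U FZ]
  show ?thesis
  proof (rule tensorialI)
    fix X Y p assume X: "smooth_vf A U X" and Y: "smooth_vf A U Y" and p: "p \<in> U"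
    have "F (D (\<lambda>p. X p + Y p) Z) p = F (\<lambda>q. D X Z q + D Y Z q) p"
      by (rule c[OF DS[OF smooth_vf_add[OF U X Y]] S_add[OF U DS[OF X] DS[OF Y]] _ p])
        (rule tensorial_add[OF DT X Y])
    then show "cov_end D (\<lambda>p. X p + Y p) F Z p = cov_end D X F Z p + cov_end D Y F Z p"
      by (simp add: cov_end_def tensorial_add[OF DT' X Y p] tensorial_add[OF T DS[OF X] DS[OF Y] p])
  next
    fix f X p assume f: "smooth_fun A U f" and X: "smooth_vf A U X" and p: "p \<in> U"
    have "F (D (\<lambda>p. f p *\<^sub>R X p) Z) p = F (\<lambda>q. f q *\<^sub>R D X Z q) p"
      by (rule c[OF DS[OF smooth_vf_scaleR[OF U f X]] S_scale[OF U f DS[OF X]] _ p])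
        (rule tensorial_scale[OF DT f X])
    then show "cov_end D (\<lambda>p. f p *\<^sub>R X p) F Z p = f p *\<^sub>R cov_end D X F Z p"
      by (simp add: cov_end_def tensorial_scale[OF DT' f X p] tensorial_scale[OF T f DS[OF X] p]
          scaleR_diff_right)
  qed
qed

lemmas cov_end_cong = tensorial_cong[OF _ module_on_smooth_vf cov_end_tensorial]

end

section \<open>Second covariant derivatives are tensorial\<close>

locale affine_manifold = manifold A
  for A :: "('m::topological_space, 'e::euclidean_space) chart set" +
  fixes nab :: "('m, 'e) connection"
  assumes nab: "affine_connection A nab"
begin

lemma nab_smooth: "open U \<Longrightarrow> smooth_vf A U X \<Longrightarrow> smooth_vf A U Y \<Longrightarrow> smooth_vf A U (nab X Y)"
  using nab unfolding affine_connection_def by blast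

sublocale TM: bundle_connection A "smooth_vf A" nab
proof
  fix U :: "'m set" assume U: "open U"
  note ax = nab[unfolded affine_connection_def, rule_format, OF conjI, OF U conjI]
  show "module_on U (smooth_vf A U)" by (rule module_on_smooth_vf[OF U])
  fix X Y Z :: "'m \<Rightarrow> 'e" and f :: "'m \<Rightarrow> real" and p assume Z: "smooth_vf A U Z"
  show "tensorial U (smooth_vf A U) (\<lambda>X. nab X Z)"
  proof (rule tensorialI)
    fix X Y p assume X: "smooth_vf A U X" and Y: "smooth_vf A U Y" and p: "p \<in> U"
    show "nab (\<lambda>p. X p + Y p) Z p = nab X Z p + nab Y Z p" using ax[OF X Z] Y p by blast
  next
    fix f X p assume f: "smooth_fun A U f" and X: "smooth_vf A U X" and p: "p \<in> U"
    show "nab (\<lambda>p. f p *\<^sub>R X p) Z p = f p *\<^sub>R nab X Z p" using ax[OF X Z] f p by blast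
  qed
  assume X: "smooth_vf A U X"
  show "smooth_vf A U (nab X Z)" by (rule nab_smooth[OF U X Z])
  assume p: "p \<in> U"
  show "nab X (\<lambda>q. f q *\<^sub>R Z q) p = dir_deriv A X f p *\<^sub>R Z p + f p *\<^sub>R nab X Z p" if "smooth_fun A U f"
    using ax[OF X Z] that p by blast
  assume Y: "smooth_vf A U Y"
  show "nab X (\<lambda>q. Y q + Z q) p = nab X Y p + nab X Z p" using ax[OF X Y] Z p by blast
qed (rule smooth_vf_subset)

context
  fixes U X Z
  assumes U: "open U" and X: "smooth_vf A U X" and Z: "smooth_vf A U Z"
begin

lemma cov2_vf_tensorial_left: "tensorial U (smooth_vf A U) (\<lambda>X. cov2_vf nab X Y Z)"
  if Y: "smooth_vf A U Y"
proof -
  note YZ = nab_smooth[OF U Y Z] and XY = nab_smooth[OF U _ Y]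
  note T = TM.D_tensorial[OF U Y] TM.D_tensorial[OF U Z] TM.D_tensorial[OF U YZ]
  show ?thesis
  proof (rule tensorialI)
    fix X X' p assume X: "smooth_vf A U X" "smooth_vf A U X'" and p: "p \<in> U"
    have "nab (nab (\<lambda>p. X p + X' p) Y) Z p = nab (\<lambda>q. nab X Y q + nab X' Y q) Z p"
      using TM.D_cong[OF U XY[OF smooth_vf_add[OF U X]] smooth_vf_add[OF U XY[OF X(1)] XY[OF X(2)]] Z Z _ refl p]
        tensorial_add[OF T(1) X] by simp
    then show "cov2_vf nab (\<lambda>p. X p + X' p) Y Z p = cov2_vf nab X Y Z p + cov2_vf nab X' Y Z p"
      by (simp add: cov2_vf_def tensorial_add[OF T(3) X p] tensorial_add[OF T(2) XY[OF X(1)] XY[OF X(2)] p])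
  next
    fix f X p assume f: "smooth_fun A U f" and X: "smooth_vf A U X" and p: "p \<in> U"
    have "nab (nab (\<lambda>p. f p *\<^sub>R X p) Y) Z p = nab (\<lambda>q. f q *\<^sub>R nab X Y q) Z p"
      using TM.D_cong[OF U XY[OF smooth_vf_scaleR[OF U f X]] smooth_vf_scaleR[OF U f XY[OF X]] Z Z _ refl p]
        tensorial_scale[OF T(1) f X] by simp
    then show "cov2_vf nab (\<lambda>p. f p *\<^sub>R X p) Y Z p = f p *\<^sub>R cov2_vf nab X Y Z p"
      by (simp add: cov2_vf_def tensorial_scale[OF T(3) f X p] tensorial_scale[OF T(2) f XY[OF X] p]
          scaleR_diff_right)
  qed
qed

text \<open>This is the purpose of the correction term in \<open>cov2_vf\<close>: it absorbs the
  derivative of \<open>f\<close> that the Leibniz rule produces. Together with the left slot it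
  makes the trace over a frame well defined.\<close>

lemma cov2_vf_tensorial_right: "tensorial U (smooth_vf A U) (\<lambda>Y. cov2_vf nab X Y Z)"
proof -
  note YZ = nab_smooth[OF U _ Z] and XY = nab_smooth[OF U X]
  note T = TM.D_tensorial[OF U Z]
  show ?thesis
  proof (rule tensorialI)
    fix Y Y' p assume Y: "smooth_vf A U Y" "smooth_vf A U Y'" and p: "p \<in> U"
    have "nab (nab X (\<lambda>p. Y p + Y' p)) Z p = nab (\<lambda>q. nab X Y q + nab X Y' q) Z p"
      using TM.D_cong[OF U XY[OF smooth_vf_add[OF U Y]] smooth_vf_add[OF U XY[OF Y(1)] XY[OF Y(2)]] Z Z _ refl p]
        TM.D_add[OF U X Y] by simp
    moreover have "nab X (nab (\<lambda>p. Y p + Y' p) Z) p = nab X (\<lambda>q. nab Y Z q + nab Y' Z q) p"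
      using TM.D_cong[OF U X X YZ[OF smooth_vf_add[OF U Y]] smooth_vf_add[OF U YZ[OF Y(1)] YZ[OF Y(2)]] refl _ p]
        tensorial_add[OF T Y] by simp
    ultimately show "cov2_vf nab X (\<lambda>p. Y p + Y' p) Z p = cov2_vf nab X Y Z p + cov2_vf nab X Y' Z p"
      by (simp add: cov2_vf_def tensorial_add[OF T XY[OF Y(1)] XY[OF Y(2)] p]
          TM.D_add[OF U X YZ[OF Y(1)] YZ[OF Y(2)] p])
  next
    fix f Y p assume f: "smooth_fun A U f" and Y: "smooth_vf A U Y" and p: "p \<in> U"
    have df: "smooth_fun A U (dir_deriv A X f)" by (rule smooth_dir_deriv[OF U f X])
    note s = smooth_vf_scaleR[OF U df Y] smooth_vf_scaleR[OF U f XY[OF Y]]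
    have "nab (nab X (\<lambda>p. f p *\<^sub>R Y p)) Z p = nab (\<lambda>q. dir_deriv A X f q *\<^sub>R Y q + f q *\<^sub>R nab X Y q) Z p"
      using TM.D_cong[OF U XY[OF smooth_vf_scaleR[OF U f Y]] smooth_vf_add[OF U s] Z Z _ refl p]
        TM.D_leibniz[OF U X Y f] by simp
    moreover have "nab X (nab (\<lambda>p. f p *\<^sub>R Y p) Z) p = nab X (\<lambda>q. f q *\<^sub>R nab Y Z q) p"
      using TM.D_cong[OF U X X YZ[OF smooth_vf_scaleR[OF U f Y]] smooth_vf_scaleR[OF U f YZ[OF Y]] refl _ p]
        tensorial_scale[OF T f Y] by simp
    ultimately show "cov2_vf nab X (\<lambda>p. f p *\<^sub>R Y p) Z p = f p *\<^sub>R cov2_vf nab X Y Z p"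
      by (simp add: cov2_vf_def tensorial_add[OF T s p] tensorial_scale[OF T df Y p]
          tensorial_scale[OF T f XY[OF Y] p] TM.D_leibniz[OF U X YZ[OF Y] f p] scaleR_diff_right)
  qed
qed

end

end

text \<open>Second derivatives of an endomorphism of a bundle involve two connections:
  \<open>nab\<close> differentiates the direction field and \<open>D\<close> the sections.\<close>

locale affine_manifold_bundle = affine_manifold A nab + B: bundle_connection A S D
  for A :: "('m::topological_space, 'e::euclidean_space) chart set" and nab S D
begin

context
  fixes U F
  assumes U: "open U" and F: "B.endo_on U F"
begin

lemma cov2_end_tensorial_section:
  assumes X: "smooth_vf A U X" and Y: "smooth_vf A U Y"
  shows "tensorial U (S U) (cov2_end nab D X Y F)"
proof -
  note T = B.endo_on_tensorial[OF B.endo_on_cov_end[OF U X B.endo_on_cov_end[OF U Y F]] U]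
    B.endo_on_tensorial[OF B.endo_on_cov_end[OF U nab_smooth[OF U X Y] F] U]
  show ?thesis
    by (rule tensorialI)
      (simp_all add: cov2_end_def tensorial_add[OF T(1)] tensorial_add[OF T(2)] tensorial_scale[OF T(1)]
        tensorial_scale[OF T(2)] scaleR_diff_right)
qed

lemma cov2_end_tensorial_left:
  assumes Z: "S U Z" and Y: "smooth_vf A U Y"
  shows "tensorial U (smooth_vf A U) (\<lambda>X. cov2_end nab D X Y F Z)"
proof -
  note XY = nab_smooth[OF U _ Y]
  note T = TM.D_tensorial[OF U Y] B.cov_end_tensorial[OF U B.endo_on_cov_end[OF U Y F] Z]
    B.cov_end_tensorial[OF U F Z]
  note c = B.cov_end_cong[OF U U U F Z]
  show ?thesis
  proof (rule tensorialI)
    fix X X' p assume X: "smooth_vf A U X" "smooth_vf A U X'" and p: "p \<in> U"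
    have "cov_end D (nab (\<lambda>p. X p + X' p) Y) F Z p = cov_end D (\<lambda>q. nab X Y q + nab X' Y q) F Z p"
      using c[OF XY[OF smooth_vf_add[OF U X]] smooth_vf_add[OF U XY[OF X(1)] XY[OF X(2)]] _ p]
        tensorial_add[OF T(1) X] by simp
    then show "cov2_end nab D (\<lambda>p. X p + X' p) Y F Z p = cov2_end nab D X Y F Z p + cov2_end nab D X' Y F Z p"
      by (simp add: cov2_end_def tensorial_add[OF T(2) X p] tensorial_add[OF T(3) XY[OF X(1)] XY[OF X(2)] p])
  next
    fix f X p assume f: "smooth_fun A U f" and X: "smooth_vf A U X" and p: "p \<in> U"
    have "cov_end D (nab (\<lambda>p. f p *\<^sub>R X p) Y) F Z p = cov_end D (\<lambda>q. f q *\<^sub>R nab X Y q) F Z p"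
      using c[OF XY[OF smooth_vf_scaleR[OF U f X]] smooth_vf_scaleR[OF U f XY[OF X]] _ p]
        tensorial_scale[OF T(1) f X] by simp
    then show "cov2_end nab D (\<lambda>p. f p *\<^sub>R X p) Y F Z p = f p *\<^sub>R cov2_end nab D X Y F Z p"
      by (simp add: cov2_end_def tensorial_scale[OF T(2) f X p] tensorial_scale[OF T(3) f XY[OF X] p]
          scaleR_diff_right)
  qed
qed

lemma cov2_end_tensorial_right:
  assumes Z: "S U Z" and X: "smooth_vf A U X"
  shows "tensorial U (smooth_vf A U) (\<lambda>Y. cov2_end nab D X Y F Z)"
proof -
  note XY = nab_smooth[OF U X] and XZ = B.D_section[OF U X Z]
  note T = B.cov_end_tensorial[OF U F Z] B.cov_end_tensorial[OF U F XZ]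
  note c = B.cov_end_cong[OF U U U F Z]
  have YZ: "S U (cov_end D Y F Z)" if "smooth_vf A U Y" for Y
    by (rule B.endo_on_section[OF B.endo_on_cov_end[OF U that F] U Z])
  show ?thesis
  proof (rule tensorialI)
    fix Y Y' p assume Y: "smooth_vf A U Y" "smooth_vf A U Y'" and p: "p \<in> U"
    have "cov_end D (nab X (\<lambda>p. Y p + Y' p)) F Z p = cov_end D (\<lambda>q. nab X Y q + nab X Y' q) F Z p"
      using c[OF XY[OF smooth_vf_add[OF U Y]] smooth_vf_add[OF U XY[OF Y(1)] XY[OF Y(2)]] _ p]
        TM.D_add[OF U X Y] by simp
    moreover have "D X (cov_end D (\<lambda>p. Y p + Y' p) F Z) p = D X (\<lambda>q. cov_end D Y F Z q + cov_end D Y' F Z q) p"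
      using B.D_cong[OF U X X YZ[OF smooth_vf_add[OF U Y]] B.S_add[OF U YZ[OF Y(1)] YZ[OF Y(2)]] refl _ p]
        tensorial_add[OF T(1) Y] by simp
    ultimately show "cov2_end nab D X (\<lambda>p. Y p + Y' p) F Z p = cov2_end nab D X Y F Z p + cov2_end nab D X Y' F Z p"
      by (simp add: cov2_end_def cov_end_def[of D X] tensorial_add[OF T(1) XY[OF Y(1)] XY[OF Y(2)] p]
          tensorial_add[OF T(2) Y p] B.D_add[OF U X YZ[OF Y(1)] YZ[OF Y(2)] p])
  next
    fix f Y p assume f: "smooth_fun A U f" and Y: "smooth_vf A U Y" and p: "p \<in> U"
    have df: "smooth_fun A U (dir_deriv A X f)" by (rule smooth_dir_deriv[OF U f X])
    note s = smooth_vf_scaleR[OF U df Y] smooth_vf_scaleR[OF U f XY[OF Y]]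
    have "cov_end D (nab X (\<lambda>p. f p *\<^sub>R Y p)) F Z p
        = cov_end D (\<lambda>q. dir_deriv A X f q *\<^sub>R Y q + f q *\<^sub>R nab X Y q) F Z p"
      using c[OF XY[OF smooth_vf_scaleR[OF U f Y]] smooth_vf_add[OF U s] _ p]
        TM.D_leibniz[OF U X Y f] by simp
    moreover have "D X (cov_end D (\<lambda>p. f p *\<^sub>R Y p) F Z) p = D X (\<lambda>q. f q *\<^sub>R cov_end D Y F Z q) p"
      using B.D_cong[OF U X X YZ[OF smooth_vf_scaleR[OF U f Y]] B.S_scale[OF U f YZ[OF Y]] refl _ p]
        tensorial_scale[OF T(1) f Y] by simp
    ultimately show "cov2_end nab D X (\<lambda>p. f p *\<^sub>R Y p) F Z p = f p *\<^sub>R cov2_end nab D X Y F Z p"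
      by (simp add: cov2_end_def cov_end_def[of D X] tensorial_add[OF T(1) s p] tensorial_scale[OF T(1) df Y p]
          tensorial_scale[OF T(1) f XY[OF Y] p] tensorial_scale[OF T(2) f Y p]
          B.D_leibniz[OF U X YZ[OF Y] f p] scaleR_diff_right)
  qed
qed

end

end

section \<open>Riemannian metrics, orthonormal frames and the Levi-Civita connection\<close>

text \<open>Orthonormal vectors are independent, hence span when there are \<open>DIM('e)\<close> of
  them; the remainder \<open>w\<close> is orthogonal to all of them and so to itself. The form
  \<open>b\<close> is arbitrary because the metric at a point is unrelated to the inner product of
  the type.\<close>

lemma orthonormal_expansion:
  fixes b :: "'e::euclidean_space \<Rightarrow> 'e \<Rightarrow> real"
  assumes b: "bilinear b" "\<And>u v. b u v = b v u" "\<And>v. v \<noteq> 0 \<Longrightarrow> b v v > 0"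
    and e: "\<And>i j. i < DIM('e) \<Longrightarrow> j < DIM('e) \<Longrightarrow> b (e i) (e j) = (if i = j then 1 else 0)"
  shows "v = (\<Sum>i<DIM('e). b v (e i) *\<^sub>R e i)"
proof -
  let ?n = "DIM('e)"
  note bl = bilinear_ladd[OF b(1)] bilinear_radd[OF b(1)] bilinear_lmul[OF b(1)] bilinear_rmul[OF b(1)]
    bilinear_lsub[OF b(1)] bilinear_rsub[OF b(1)] bilinear_lzero[OF b(1)] bilinear_rzero[OF b(1)]
  have ls: "b (sum h I) w = (\<Sum>i\<in>I. b (h i) w)" for h w and I :: "nat set"
    using b(1) linear_sum[of "\<lambda>x. b x w"] by (auto simp: bilinear_def)
  have comb: "b (\<Sum>i<?n. c i *\<^sub>R e i) (e j) = c j" if "j < ?n" for c j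
    using that by (simp add: ls bl e if_distrib[of "\<lambda>x. _ * x"] sum.delta cong: if_cong)
  have inj: "inj_on e {..<?n}"
    by (rule inj_onI) (metis e lessThan_iff zero_neq_one)
  have ind: "independent (e ` {..<?n})"
  proof (rule independent_if_scalars_zero)
    fix f x assume s: "(\<Sum>x\<in>e ` {..<?n}. f x *\<^sub>R x) = 0" and x: "x \<in> e ` {..<?n}"
    then obtain j where j: "j < ?n" "x = e j" by auto
    have "(\<Sum>i<?n. f (e i) *\<^sub>R e i) = 0" using s by (simp add: sum.reindex[OF inj])
    then show "f x = 0" using comb[OF j(1), of "\<lambda>i. f (e i)"] j by (simp add: bl)
  qed simp
  have sp: "span (e ` {..<?n}) = UNIV"
    using card_eq_dim[of "e ` {..<?n}" UNIV] ind by (auto simp: card_image[OF inj])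
  define w where "w = v - (\<Sum>i<?n. b v (e i) *\<^sub>R e i)"
  have we: "b w (e j) = 0" if "j < ?n" for j
    using comb[OF that, of "\<lambda>i. b v (e i)"] by (simp add: w_def bl)
  have "b w u = 0" for u
  proof -
    have "u \<in> span (e ` {..<?n})" by (simp add: sp)
    then show ?thesis
      by (induction rule: span_induct_alt) (auto simp: bl we)
  qed
  then have "w = 0" using b(3)[of w] by force
  then show ?thesis by (simp add: w_def)
qed

locale riemannian = manifold A
  for A :: "('m::topological_space, 'e::euclidean_space) chart set" +
  fixes g :: "'m \<Rightarrow> 'e \<Rightarrow> 'e \<Rightarrow> real"
  assumes metric: "riemannian_metric A g"
begin

lemma g_bilinear: "bilinear (g p)" and g_sym: "g p u v = g p v u" and g_pos: "v \<noteq> 0 \<Longrightarrow> g p v v > 0"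
  using metric by (auto simp: riemannian_metric_def)

lemma g_smooth: "open U \<Longrightarrow> smooth_vf A U X \<Longrightarrow> smooth_vf A U Y \<Longrightarrow> smooth_fun A U (\<lambda>p. g p (X p) (Y p))"
  using metric by (auto simp: riemannian_metric_def)

lemma g_simps [simp]:
  "g p (u + v) w = g p u w + g p v w" "g p w (u + v) = g p w u + g p w v"
  "g p (u - v) w = g p u w - g p v w" "g p w (u - v) = g p w u - g p w v"
  "g p (r *\<^sub>R u) w = r * g p u w" "g p w (r *\<^sub>R u) = r * g p w u"
  "g p (- u) w = - g p u w" "g p w (- u) = - g p w u" "g p 0 w = 0" "g p w 0 = 0"
  using g_bilinear[of p]
  by (simp_all add: bilinear_ladd bilinear_radd bilinear_lsub bilinear_rsub bilinear_lmul bilinear_rmul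
      bilinear_lneg bilinear_rneg bilinear_lzero bilinear_rzero)

lemma g_sum: "g p (sum h I) w = (\<Sum>i\<in>I. g p (h i) w)" "g p w (sum h I) = (\<Sum>i\<in>I. g p w (h i))"
  using g_bilinear[of p] linear_sum[of "\<lambda>x. g p x w" h I] linear_sum[of "g p w" h I]
  by (auto simp: bilinear_def)

lemma g_eq_zero: "(\<And>w. g p v w = 0) \<Longrightarrow> v = 0"
  using g_pos[of v p] by force

lemma g_eqI: "(\<And>w. g p u w = g p v w) \<Longrightarrow> u = v"
  using g_eq_zero[of p "u - v"] by simp

lemma frame_smooth: "orthonormal_frame A g U E \<Longrightarrow> i < DIM('e) \<Longrightarrow> smooth_vf A U (E i)"
  and frame_orthonormal: "orthonormal_frame A g U E \<Longrightarrow> p \<in> U \<Longrightarrow> i < DIM('e) \<Longrightarrow> j < DIM('e) \<Longrightarrow>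
    g p (E i p) (E j p) = (if i = j then 1 else 0)"
  by (auto simp: orthonormal_frame_def)

lemma frame_subset: "orthonormal_frame A g U E \<Longrightarrow> V \<subseteq> U \<Longrightarrow> orthonormal_frame A g V E"
  by (auto simp: orthonormal_frame_def intro: smooth_vf_subset)

lemma frame_expansion:
  assumes "orthonormal_frame A g U E" "p \<in> U"
  shows "v = (\<Sum>i<DIM('e). g p v (E i p) *\<^sub>R E i p)"
  by (rule orthonormal_expansion[OF g_bilinear g_sym g_pos frame_orthonormal[OF assms]])

lemma frame_parseval:
  assumes "orthonormal_frame A g U E" "p \<in> U"
  shows "g p u v = (\<Sum>i<DIM('e). g p u (E i p) * g p v (E i p))"
  by (subst frame_expansion[OF assms, of u]) (simp add: g_sum g_sym[of p v])

text \<open>The frames differ by a matrix \<open>a\<close> of smooth functions. Tensoriality in both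
  slots pulls its entries out, and Parseval in the frame \<open>E\<close> shows that the matrix is
  orthogonal.\<close>

lemma trace_frame_independent:
  fixes B :: "('m \<Rightarrow> 'e) \<Rightarrow> ('m \<Rightarrow> 'e) \<Rightarrow> 'm \<Rightarrow> 'v::real_vector"
  assumes U: "open U" and p: "p \<in> U"
    and E: "orthonormal_frame A g U E" and E': "orthonormal_frame A g U E'"
    and left: "\<And>Y. smooth_vf A U Y \<Longrightarrow> tensorial U (smooth_vf A U) (\<lambda>X. B X Y)"
    and right: "\<And>X. smooth_vf A U X \<Longrightarrow> tensorial U (smooth_vf A U) (\<lambda>Y. B X Y)"
  shows "(\<Sum>i<DIM('e). B (E i) (E i) p) = (\<Sum>i<DIM('e). B (E' i) (E' i) p)"
proof -
  let ?n = "DIM('e)"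
  note M = module_on_smooth_vf[OF U]
  have ne: "finite {..<?n}" "{..<?n} \<noteq> {}" using DIM_positive[where 'a='e] by (auto simp del: DIM_positive)
  define a where "a i j q = g q (E i q) (E' j q)" for i j q
  have a: "smooth_fun A U (a i j)" if "i < ?n" "j < ?n" for i j
    unfolding a_def by (intro g_smooth U frame_smooth[OF E] frame_smooth[OF E'] that)
  have L: "L (E i) p = (\<Sum>j<?n. a i j p *\<^sub>R L (E' j) p)"
    if i: "i < ?n" and T: "tensorial U (smooth_vf A U) L" for i and L :: "('m \<Rightarrow> 'e) \<Rightarrow> 'm \<Rightarrow> 'v"
  proof -
    have s: "smooth_vf A U (\<lambda>q. \<Sum>j<?n. a i j q *\<^sub>R E' j q)"
      by (rule module_on_sum[OF M ne]) (use a[OF i] frame_smooth[OF E'] in auto)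
    have "L (E i) p = L (\<lambda>q. \<Sum>j<?n. a i j q *\<^sub>R E' j q) p"
      by (rule tensorial_cong[OF U M T frame_smooth[OF E i] s _ p])
        (use frame_expansion[OF E'] in \<open>auto simp: a_def\<close>)
    also have "\<dots> = (\<Sum>j<?n. a i j p *\<^sub>R L (E' j) p)"
      by (rule tensorial_sum[OF T M ne _ _ p]) (use a[OF i] frame_smooth[OF E'] in auto)
    finally show ?thesis .
  qed
  have "(\<Sum>i<?n. B (E i) (E i) p) = (\<Sum>i<?n. \<Sum>j<?n. a i j p *\<^sub>R B (E' j) (E i) p)"
    using L[OF _ left[OF frame_smooth[OF E]]] by (intro sum.cong) auto
  also have "\<dots> = (\<Sum>i<?n. \<Sum>j<?n. a i j p *\<^sub>R (\<Sum>k<?n. a i k p *\<^sub>R B (E' j) (E' k) p))"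
    using L[OF _ right[OF frame_smooth[OF E']]] by (intro sum.cong refl arg_cong2[where f=scaleR]) auto
  also have "\<dots> = (\<Sum>i<?n. \<Sum>j<?n. \<Sum>k<?n. (a i j p * a i k p) *\<^sub>R B (E' j) (E' k) p)"
    by (simp add: scaleR_sum_right)
  also have "\<dots> = (\<Sum>j<?n. \<Sum>i<?n. \<Sum>k<?n. (a i j p * a i k p) *\<^sub>R B (E' j) (E' k) p)"
    by (rule sum.swap)
  also have "\<dots> = (\<Sum>j<?n. \<Sum>k<?n. \<Sum>i<?n. (a i j p * a i k p) *\<^sub>R B (E' j) (E' k) p)"
    by (rule sum.cong[OF refl], rule sum.swap)
  also have "\<dots> = (\<Sum>j<?n. \<Sum>k<?n. (\<Sum>i<?n. a i j p * a i k p) *\<^sub>R B (E' j) (E' k) p)"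
    by (simp add: scaleR_sum_left)
  also have "\<dots> = (\<Sum>j<?n. \<Sum>k<?n. (if j = k then 1 else 0) *\<^sub>R B (E' j) (E' k) p)"
  proof (intro sum.cong refl)
    fix j k assume "j \<in> {..<?n}" "k \<in> {..<?n}"
    then show "(\<Sum>i<?n. a i j p * a i k p) *\<^sub>R B (E' j) (E' k) p = (if j = k then 1 else 0) *\<^sub>R B (E' j) (E' k) p"
      using frame_parseval[OF E p, of "E' j p" "E' k p"] frame_orthonormal[OF E' p, of j k]
      by (simp add: a_def g_sym[of p "E _ p"])
  qed
  also have "\<dots> = (\<Sum>j<?n. B (E' j) (E' j) p)"
    by (simp add: if_distrib[of "\<lambda>x. x *\<^sub>R _"] sum.delta cong: if_cong)
  finally show ?thesis .
qed

text \<open>A vector outside the span at \<open>p\<close> is extended with constant components, made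
  orthogonal to the given fields and normalised. Its orthogonal part is nonzero at \<open>p\<close>
  and hence on a neighbourhood, to which the domain shrinks.\<close>

lemma gram_schmidt_step:
  assumes U: "open U" "p \<in> U" and k: "k < DIM('e)"
    and E: "\<And>i. i < k \<Longrightarrow> smooth_vf A U (E i)"
      "\<And>q i j. q \<in> U \<Longrightarrow> i < k \<Longrightarrow> j < k \<Longrightarrow> g q (E i q) (E j q) = (if i = j then 1 else 0)"
  shows "\<exists>V N. open V \<and> p \<in> V \<and> V \<subseteq> U \<and> smooth_vf A V N \<and>
    (\<forall>q\<in>V. g q (N q) (N q) = 1 \<and> (\<forall>i<k. g q (N q) (E i q) = 0))"
proof -
  have "dim ((\<lambda>i. E i p) ` {..<k}) \<le> card ((\<lambda>i. E i p) ` {..<k})"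
    by (simp add: dim_le_card')
  also have "\<dots> \<le> k" using card_image_le[of "{..<k}" "\<lambda>i. E i p"] by simp
  finally have "span ((\<lambda>i. E i p) ` {..<k}) \<noteq> UNIV" using k by (metis dim_span dim_UNIV not_le)
  then obtain v where v: "v \<notin> span ((\<lambda>i. E i p) ` {..<k})" by auto
  let ?c = "at_chart p"
  define W where "W = U \<inter> fst ?c"
  have W: "open W" "p \<in> W" "W \<subseteq> U" using U chart_open[of ?c] by (auto simp: W_def)
  define X where "X = coord_field ?c v"
  have X: "smooth_vf A W X"
    unfolding X_def W_def by (rule smooth_vf_subset[OF smooth_coord_field]) auto
  have EW: "smooth_vf A W (E i)" if "i < k" for i
    using smooth_vf_subset[OF E(1)[OF that] W(3)] .
  define R where "R q = X q - (\<Sum>i<k. g q (X q) (E i q) *\<^sub>R E i q)" for q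
  have R: "smooth_vf A W R"
    unfolding R_def using EW by (intro smooth_vf_diff smooth_vf_sum smooth_vf_scaleR g_smooth W(1) X) auto
  have RE: "g q (R q) (E j q) = 0" if "q \<in> W" "j < k" for q j
  proof -
    have "q \<in> U" using that W by auto
    then have "(\<Sum>i<k. g q (X q) (E i q) * g q (E i q) (E j q)) = (\<Sum>i<k. if i = j then g q (X q) (E i q) else 0)"
      using that(2) E(2) by (intro sum.cong) auto
    then show ?thesis using that by (simp add: R_def g_sum)
  qed
  have Rp: "R p \<noteq> 0"
  proof
    assume "R p = 0"
    then have "v = (\<Sum>i<k. g p (X p) (E i p) *\<^sub>R E i p)" by (simp add: R_def X_def)
    also have "\<dots> \<in> span ((\<lambda>i. E i p) ` {..<k})" by (intro span_sum span_scale span_base) auto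
    finally show False using v by simp
  qed
  define G where "G q = g q (R q) (R q)" for q
  have G: "smooth_fun A W G" unfolding G_def by (intro g_smooth W R)
  define V where "V = {q \<in> W. G q > 0}"
  have "V = G -` {0<..} \<inter> W" by (auto simp: V_def)
  moreover have "open (G -` {0<..} \<inter> W)"
    using continuous_on_open_vimage[OF W(1)] smooth_fun_continuous[OF W(1) G] open_greaterThan by blast
  moreover have "G p > 0" unfolding G_def by (rule g_pos[OF Rp])
  ultimately have V: "open V" "p \<in> V" "V \<subseteq> W" using W(2) by (simp, auto simp: V_def)
  define N where "N q = inverse (sqrt (G q)) *\<^sub>R R q" for q
  have "smooth_vf A V N"
    unfolding N_def
    by (intro smooth_vf_scaleR smooth_fun_inverse smooth_fun_sqrt V(1) smooth_fun_subset[OF G V(3)]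
        smooth_vf_subset[OF R V(3)]) (auto simp: V_def)
  moreover have "g q (N q) (N q) = 1 \<and> (\<forall>i<k. g q (N q) (E i q) = 0)" if "q \<in> V" for q
  proof -
    have "q \<in> W" "G q > 0" using that by (auto simp: V_def)
    moreover have "inverse (sqrt (G q)) * (inverse (sqrt (G q)) * G q) = 1"
      using \<open>G q > 0\<close> by (simp add: field_simps)
    ultimately show ?thesis using RE[of q] by (simp add: N_def G_def)
  qed
  ultimately show ?thesis using V W by blast
qed

lemma local_orthonormal_frame:
  "\<exists>U E. open U \<and> p \<in> U \<and> orthonormal_frame A g U E"
proof -
  have "\<exists>U E. open U \<and> p \<in> U \<and> (\<forall>i<k. smooth_vf A U (E i)) \<and>
      (\<forall>q\<in>U. \<forall>i<k. \<forall>j<k. g q (E i q) (E j q) = (if i = j then 1 else 0))" if "k \<le> DIM('e)" for k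
    using that
  proof (induction k)
    case 0
    then show ?case by (intro exI[of _ UNIV]) auto
  next
    case (Suc k)
    then have "k \<le> DIM('e)" by simp
    from Suc.IH[OF this] obtain U E where UE: "open U \<and> p \<in> U \<and> (\<forall>i<k. smooth_vf A U (E i)) \<and>
      (\<forall>q\<in>U. \<forall>i<k. \<forall>j<k. g q (E i q) (E j q) = (if i = j then 1 else 0))"
      by (elim exE)
    then have U: "open U" "p \<in> U" by simp_all
    from UE have E: "\<And>i. i < k \<Longrightarrow> smooth_vf A U (E i)"
      "\<And>q i j. q \<in> U \<Longrightarrow> i < k \<Longrightarrow> j < k \<Longrightarrow> g q (E i q) (E j q) = (if i = j then 1 else 0)"
      by blast+
    have k: "k < DIM('e)" using Suc.prems by simp
    obtain V N where V: "open V" "p \<in> V" "V \<subseteq> U" and N': "smooth_vf A V N"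
      "\<forall>q\<in>V. g q (N q) (N q) = 1 \<and> (\<forall>i<k. g q (N q) (E i q) = 0)"
      using gram_schmidt_step[of U p k E, OF U k E] by blast
    then have N: "smooth_vf A V N" "\<And>q. q \<in> V \<Longrightarrow> g q (N q) (N q) = 1"
      "\<And>q i. q \<in> V \<Longrightarrow> i < k \<Longrightarrow> g q (N q) (E i q) = 0"
      by blast+
    show ?case
    proof (intro exI[of _ V] exI[of _ "E(k := N)"] conjI V ballI allI impI)
      fix i assume "i < Suc k"
      then show "smooth_vf A V ((E(k := N)) i)"
        using N(1) smooth_vf_subset[OF E(1) V(3)] by (cases "i = k") auto
    next
      fix q i j assume "q \<in> V" "i < Suc k" "j < Suc k"
      then show "g q ((E(k := N)) i q) ((E(k := N)) j q) = (if i = j then 1 else 0)"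
        using N(2,3) E(2) V(3) g_sym[of q "E i q" "N q"] by (cases "i = k"; cases "j = k") auto
    qed
  qed
  from this[OF order_refl] show ?thesis by (auto simp: orthonormal_frame_def)
qed

end

locale levi_civita_manifold = riemannian A g
  for A :: "('m::topological_space, 'e::euclidean_space) chart set" and g +
  fixes nab :: "('m, 'e) connection"
  assumes lc: "levi_civita A g nab"
begin

sublocale affine_manifold A nab
  using lc by unfold_locales (simp add: levi_civita_def)

lemma torsion_free:
  "open U \<Longrightarrow> smooth_vf A U X \<Longrightarrow> smooth_vf A U Y \<Longrightarrow> p \<in> U \<Longrightarrow> nab X Y p - nab Y X p = lie_bracket A X Y p"
  using lc by (simp add: levi_civita_def)

lemma metric_compatible:
  "open U \<Longrightarrow> smooth_vf A U X \<Longrightarrow> smooth_vf A U Y \<Longrightarrow> smooth_vf A U Z \<Longrightarrow> p \<in> U \<Longrightarrow>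
    dir_deriv A X (\<lambda>q. g q (Y q) (Z q)) p = g p (nab X Y p) (Z p) + g p (Y p) (nab X Z p)"
  using lc by (simp add: levi_civita_def)

text \<open>Read off from torsion freeness, without returning to coordinates.\<close>

lemma smooth_lie_bracket:
  assumes "open U" "smooth_vf A U X" "smooth_vf A U Y"
  shows "smooth_vf A U (lie_bracket A X Y)"
  by (rule smooth_vf_cong[OF assms(1) torsion_free[OF assms]])
    (auto intro: smooth_vf_diff nab_smooth assms)

text \<open>Expresses the connection through directional derivatives and brackets, both of which are
  compatible with a smooth map; this makes the connections of the total space and of the base
  comparable.\<close>

lemma koszul:
  assumes U: "open U" and X: "smooth_vf A U X" and Y: "smooth_vf A U Y" and Z: "smooth_vf A U Z" and p: "p \<in> U"
  shows "2 * g p (nab X Y p) (Z p) =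
    dir_deriv A X (\<lambda>q. g q (Y q) (Z q)) p + dir_deriv A Y (\<lambda>q. g q (X q) (Z q)) p
    - dir_deriv A Z (\<lambda>q. g q (X q) (Y q)) p + g p (lie_bracket A X Y p) (Z p)
    - g p (lie_bracket A X Z p) (Y p) - g p (lie_bracket A Y Z p) (X p)"
  by (simp add: metric_compatible[OF U X Y Z p] metric_compatible[OF U Y X Z p]
      metric_compatible[OF U Z X Y p] torsion_free[OF U X Y p, symmetric]
      torsion_free[OF U X Z p, symmetric] torsion_free[OF U Y Z p, symmetric]
      g_sym[of p "X p"] g_sym[of p "Y p"])

end

section \<open>Pullback along smooth maps\<close>

lemma (in manifold) coord_field_expansion:
  assumes c: "c \<in> A" "p \<in> fst c"
  shows "v = (\<Sum>b\<in>Basis. (comps A c p v \<bullet> b) *\<^sub>R coord_field c b p)"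
proof -
  have "v = coord_field c (\<Sum>b\<in>Basis. (comps A c p v \<bullet> b) *\<^sub>R b) p"
    by (simp add: euclidean_representation coord_field_comps c)
  then show ?thesis by (simp only: coord_field_linear[OF c])
qed

locale manifold_map = manifold A + N: manifold B
  for A :: "('m::topological_space, 'e::euclidean_space) chart set"
    and B :: "('b::topological_space, 'f::euclidean_space) chart set" +
  fixes \<pi> :: "'m \<Rightarrow> 'b"
  assumes smooth: "smooth_map A B \<pi>"
begin

lemma preimage_open: "open V \<Longrightarrow> open (\<pi> -` V)"
  using smooth continuous_on_open_vimage[OF open_UNIV, of \<pi>] by (simp add: smooth_map_def)

lemma local_smooth:
  "c \<in> A \<Longrightarrow> d \<in> B \<Longrightarrow> smooth_on (snd c ` (fst c \<inter> \<pi> -` fst d)) (snd d \<circ> \<pi> \<circ> chart_inv c)"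
  using smooth by (simp add: smooth_map_def)

lemma tangent_map_has_derivative:
  "((snd (N.at_chart (\<pi> p)) \<circ> \<pi> \<circ> chart_inv (at_chart p)) has_derivative tangent_map A B \<pi> p)
    (at (snd (at_chart p) p))"
  unfolding tangent_map_def
  by (rule fd_has, rule smooth_on_differentiable[OF local_smooth]) auto

lemma tangent_map_linear: "linear (tangent_map A B \<pi> p)"
  using tangent_map_has_derivative by (rule has_derivative_linear)

lemma smooth_fun_pullback:
  assumes V: "open V" and f: "smooth_fun B V f"
  shows "smooth_fun A (\<pi> -` V) (\<lambda>p. f (\<pi> p))"
proof (rule smooth_fun_chartI)
  fix p assume p: "p \<in> \<pi> -` V"
  let ?c = "at_chart p" and ?d = "N.at_chart (\<pi> p)"
  let ?W = "\<pi> -` (V \<inter> fst ?d)"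
  have W: "open ?W" by (intro preimage_open open_Int V N.chart_open) simp
  have S: "open (snd ?c ` (?W \<inter> fst ?c))" by (intro chart_image_open W) simp
  have T: "open (snd ?d ` (V \<inter> fst ?d))" by (intro N.chart_image_open V) simp
  have m: "(snd ?d \<circ> \<pi> \<circ> chart_inv ?c) x \<in> snd ?d ` (V \<inter> fst ?d)" if "x \<in> snd ?c ` (?W \<inter> fst ?c)" for x
    using that by auto
  have 1: "smooth_on (snd ?d ` (V \<inter> fst ?d)) (f \<circ> chart_inv ?d)"
    using f by (simp add: smooth_fun_def)
  have 2: "smooth_on (snd ?c ` (?W \<inter> fst ?c)) (snd ?d \<circ> \<pi> \<circ> chart_inv ?c)"
    by (rule smooth_on_subset[OF local_smooth]) auto
  from smooth_on_compose[OF S T m 1 2]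
  have "smooth_on (snd ?c ` (?W \<inter> fst ?c)) ((\<lambda>p. f (\<pi> p)) \<circ> chart_inv ?c)"
    by (rule smooth_on_cong[OF S, rotated]) auto
  then show "\<exists>c\<in>A. \<exists>W. open W \<and> p \<in> W \<and> p \<in> fst c \<and>
      smooth_on (snd c ` (W \<inter> fst c)) ((\<lambda>p. f (\<pi> p)) \<circ> chart_inv c)"
    using W p by (intro bexI[of _ ?c] exI[of _ ?W]) auto
qed

text \<open>The chain rule. Relatedness is asked at the single point \<open>p\<close>, so that
  \<open>W\<close> may be a constant placeholder for one tangent vector.\<close>

lemma dir_deriv_pullback:
  assumes V: "open V" and f: "smooth_fun B V f" and p: "\<pi> p \<in> V"
    and X: "tangent_map A B \<pi> p (X p) = W (\<pi> p)"
  shows "dir_deriv A X (\<lambda>p. f (\<pi> p)) p = dir_deriv B W f (\<pi> p)"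
proof -
  let ?c = "at_chart p" and ?d = "N.at_chart (\<pi> p)"
  let ?O = "\<pi> -` fst ?d"
  have S: "open (snd ?c ` (?O \<inter> fst ?c))" by (intro chart_image_open preimage_open N.chart_open) simp_all
  have "((f \<circ> chart_inv ?d) has_derivative fd (f \<circ> chart_inv ?d) (snd ?d (\<pi> p))) (at (snd ?d (\<pi> p)))"
    by (rule fd_has, rule N.smooth_fun_differentiable[OF f p]) simp_all
  moreover have e: "(snd ?d \<circ> \<pi> \<circ> chart_inv ?c) (snd ?c p) = snd ?d (\<pi> p)" by simp
  ultimately have "((\<lambda>x. (f \<circ> chart_inv ?d) ((snd ?d \<circ> \<pi> \<circ> chart_inv ?c) x)) has_derivative
      (\<lambda>v. fd (f \<circ> chart_inv ?d) (snd ?d (\<pi> p)) (tangent_map A B \<pi> p v))) (at (snd ?c p))"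
    by (intro has_derivative_compose[OF tangent_map_has_derivative]) (simp only: e)
  then have "(((\<lambda>p. f (\<pi> p)) \<circ> chart_inv ?c) has_derivative
      (\<lambda>v. fd (f \<circ> chart_inv ?d) (snd ?d (\<pi> p)) (tangent_map A B \<pi> p v))) (at (snd ?c p))"
    by (rule has_derivative_transform_within_open[OF _ S]) auto
  then show ?thesis by (simp add: dir_deriv_def fd_eqI X)
qed

text \<open>Tested on functions \<open>f\<close> of the base: on the pullback of \<open>f\<close>,
  the iterated derivatives along related fields are pullbacks of those on the base.\<close>

lemma lie_bracket_related:
  assumes V: "open V" and W: "smooth_vf B V W" "smooth_vf B V W'"
    and U: "open U" "U \<subseteq> \<pi> -` V" and X: "smooth_vf A U X" "smooth_vf A U X'"
    and rel: "\<And>q. q \<in> U \<Longrightarrow> tangent_map A B \<pi> q (X q) = W (\<pi> q)"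
      "\<And>q. q \<in> U \<Longrightarrow> tangent_map A B \<pi> q (X' q) = W' (\<pi> q)"
    and p: "p \<in> U"
  shows "tangent_map A B \<pi> p (lie_bracket A X X' p) = lie_bracket B W W' (\<pi> p)"
proof -
  \<comment> \<open>A constant function, because \<open>N.tangent_eqI\<close> compares fields
    although only the value at \<open>\<pi> p\<close> matters.\<close>
  let ?w = "\<lambda>_::'b. tangent_map A B \<pi> p (lie_bracket A X X' p)"
  have "?w (\<pi> p) = lie_bracket B W W' (\<pi> p)"
  proof (rule N.tangent_eqI[OF V])
    show "\<pi> p \<in> V" using p U by auto
    fix V' f assume V': "open V'" "\<pi> p \<in> V'" "V' \<subseteq> V" and f: "smooth_fun B V' f"
    let ?U = "U \<inter> \<pi> -` V'"
    have U': "open ?U" "p \<in> ?U" "?U \<subseteq> U" using U p V' preimage_open[OF V'(1)] by (auto intro: open_Int)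
    note Ws = N.smooth_vf_subset[OF W(1) V'(3)] N.smooth_vf_subset[OF W(2) V'(3)]
    note Xs = smooth_vf_subset[OF X(1) U'(3)] smooth_vf_subset[OF X(2) U'(3)]
    have F: "smooth_fun A ?U (\<lambda>p. f (\<pi> p))"
      by (rule smooth_fun_subset[OF smooth_fun_pullback[OF V'(1) f]]) auto
    have two: "dir_deriv A Y (dir_deriv A Y' (\<lambda>p. f (\<pi> p))) p = dir_deriv B Q (dir_deriv B Q' f) (\<pi> p)"
      if "\<And>q. q \<in> U \<Longrightarrow> tangent_map A B \<pi> q (Y q) = Q (\<pi> q)"
        "\<And>q. q \<in> U \<Longrightarrow> tangent_map A B \<pi> q (Y' q) = Q' (\<pi> q)" "smooth_vf B V' Q'" for Y Y' Q Q'
    proof -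
      have "dir_deriv A Y (dir_deriv A Y' (\<lambda>p. f (\<pi> p))) p = dir_deriv A Y (\<lambda>q. dir_deriv B Q' f (\<pi> q)) p"
        by (rule dir_deriv_cong[OF U'(1,2) _ refl], rule dir_deriv_pullback[OF V'(1) f]) (use that in auto)
      also have "\<dots> = dir_deriv B Q (dir_deriv B Q' f) (\<pi> p)"
        by (rule dir_deriv_pullback[OF V'(1) N.smooth_dir_deriv[OF V'(1) f]]) (use that p V' in auto)
      finally show ?thesis .
    qed
    have "dir_deriv B ?w f (\<pi> p) = dir_deriv A (lie_bracket A X X') (\<lambda>p. f (\<pi> p)) p"
      by (rule dir_deriv_pullback[OF V'(1) f V'(2), symmetric]) simp
    also have "\<dots> = dir_deriv A X (dir_deriv A X' (\<lambda>p. f (\<pi> p))) p - dir_deriv A X' (dir_deriv A X (\<lambda>p. f (\<pi> p))) p"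
      by (rule dir_deriv_lie_bracket[OF U'(1) F Xs U'(2)])
    also have "\<dots> = dir_deriv B W (dir_deriv B W' f) (\<pi> p) - dir_deriv B W' (dir_deriv B W f) (\<pi> p)"
      using two[OF rel Ws(2)] two[OF rel(2,1) Ws(1)] by simp
    also have "\<dots> = dir_deriv B (lie_bracket B W W') f (\<pi> p)"
      by (rule N.dir_deriv_lie_bracket[OF V'(1) f Ws V'(2), symmetric])
    finally show "dir_deriv B ?w f (\<pi> p) = dir_deriv B (lie_bracket B W W') f (\<pi> p)" .
  qed
  then show ?thesis by simp
qed

end

section \<open>Submersive contact metric structures\<close>

locale submersive_contact = levi_civita_manifold A g nab + N: levi_civita_manifold B h nab'
  for A :: "('m::topological_space, 'e::euclidean_space) chart set" and g nab
    and B :: "('b::topological_space, 'f::euclidean_space) chart set" and h nab' +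
  fixes \<phi> :: "'m \<Rightarrow> 'e \<Rightarrow> 'e" and \<xi> :: "'m \<Rightarrow> 'e" and \<eta> :: "'m \<Rightarrow> 'e \<Rightarrow> real"
    and J' :: "'b \<Rightarrow> 'f \<Rightarrow> 'f" and \<pi> :: "'m \<Rightarrow> 'b"
  assumes contact: "contact_metric A \<phi> \<xi> \<eta> g"
    and submersive: "submersive_onto A \<phi> \<xi> \<eta> g B h J' \<pi>"
    and dims: "DIM('e) = Suc DIM('f)"
begin

section \<open>Pointwise algebra of the structure and of the submersion\<close>

lemma acm: "almost_contact_metric A \<phi> \<xi> \<eta> g"
  using contact by (simp add: contact_metric_def)

lemma eta_eq: "\<eta> p v = g p (\<xi> p) v"
  using acm by (simp add: almost_contact_metric_def)

lemma xi_smooth: "smooth_vf A U \<xi>"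
  using acm smooth_vf_subset[of UNIV \<xi> U] by (simp add: almost_contact_metric_def)

lemma xi_unit [simp]: "g p (\<xi> p) (\<xi> p) = 1"
  using acm by (simp add: almost_contact_metric_def)

lemma eta_xi [simp]: "\<eta> p (\<xi> p) = 1"
  by (simp add: eta_eq)

lemma eta_simps [simp]:
  "\<eta> p (u + v) = \<eta> p u + \<eta> p v" "\<eta> p (u - v) = \<eta> p u - \<eta> p v" "\<eta> p (r *\<^sub>R u) = r * \<eta> p u"
  "\<eta> p (- u) = - \<eta> p u" "\<eta> p 0 = 0" "\<eta> p (sum f I) = (\<Sum>i\<in>I. \<eta> p (f i))"
  by (simp_all add: eta_eq g_sum)

lemma phi_linear: "linear (\<phi> p)"
  and phi_smooth: "open U \<Longrightarrow> smooth_vf A U X \<Longrightarrow> smooth_vf A U (act \<phi> X)"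
  using acm by (auto simp: almost_contact_metric_def smooth_endo_def act_def[abs_def])

lemma phi_simps [simp]:
  "\<phi> p (u + v) = \<phi> p u + \<phi> p v" "\<phi> p (u - v) = \<phi> p u - \<phi> p v" "\<phi> p (r *\<^sub>R u) = r *\<^sub>R \<phi> p u"
  "\<phi> p (- u) = - \<phi> p u" "\<phi> p 0 = 0" "\<phi> p (sum f I) = (\<Sum>i\<in>I. \<phi> p (f i))"
  using phi_linear[of p]
  by (simp_all add: linear_add linear_diff linear_scale linear_neg linear_0 linear_sum)

lemma phi_phi: "\<phi> p (\<phi> p v) = - v + \<eta> p v *\<^sub>R \<xi> p"
  and g_phi_phi: "g p (\<phi> p u) (\<phi> p v) = g p u v - \<eta> p u * \<eta> p v"
  using acm by (auto simp: almost_contact_metric_def)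

lemma phi_xi [simp]: "\<phi> p (\<xi> p) = 0"
  using g_phi_phi[of p "\<xi> p" "\<xi> p"] g_pos[of "\<phi> p (\<xi> p)" p] by force

text \<open>The cube of \<phi> computed in two ways, as \<phi> of the square and as the square of
  \<phi>, differs by the term \<eta>(\<phi> v) \<xi>, since \<phi> \<xi> = 0.\<close>

lemma eta_phi [simp]: "\<eta> p (\<phi> p v) = 0"
proof -
  have "\<phi> p (\<phi> p (\<phi> p v)) = - \<phi> p v"
    by (subst phi_phi[of p v]) simp
  then have "\<eta> p (\<phi> p v) *\<^sub>R \<xi> p = 0"
    using phi_phi[of p "\<phi> p v"] by simp
  moreover have "\<xi> p \<noteq> 0" using xi_unit[of p] by force
  ultimately show ?thesis by simp
qed

lemma phi_skew: "g p (\<phi> p u) v = - g p u (\<phi> p v)"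
  using g_phi_phi[of p "\<phi> p u" v] by (simp add: phi_phi eta_eq[symmetric])

lemma ext_deriv_eta:
  "open U \<Longrightarrow> smooth_vf A U X \<Longrightarrow> smooth_vf A U Y \<Longrightarrow> p \<in> U \<Longrightarrow> ext_deriv A \<eta> X Y p = g p (X p) (\<phi> p (Y p))"
  using contact by (simp add: contact_metric_def)

lemma pi_smooth: "smooth_map A B \<pi>" and pi_surj: "surj \<pi>"
  using submersive by (auto simp: submersive_onto_def riemannian_submersion_def)

sublocale manifold_map A B \<pi>
  by unfold_locales (rule pi_smooth)

abbreviation d\<pi> :: "'m \<Rightarrow> 'e \<Rightarrow> 'f" where "d\<pi> \<equiv> tangent_map A B \<pi>"

lemma dpi_simps [simp]:
  "d\<pi> p (u + v) = d\<pi> p u + d\<pi> p v" "d\<pi> p (u - v) = d\<pi> p u - d\<pi> p v" "d\<pi> p (r *\<^sub>R u) = r *\<^sub>R d\<pi> p u"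
  "d\<pi> p (- u) = - d\<pi> p u" "d\<pi> p 0 = 0" "d\<pi> p (sum f I) = (\<Sum>i\<in>I. d\<pi> p (f i))"
  using tangent_map_linear[of p]
  by (simp_all add: linear_add linear_diff linear_scale linear_neg linear_0 linear_sum)

lemma dpi_xi [simp]: "d\<pi> p (\<xi> p) = 0"
  using submersive by (simp add: submersive_onto_def vertical_def)

lemma horizontal_eq: "horizontal A g B \<pi> p = {v. \<eta> p v = 0}"
  using submersive by (simp add: submersive_onto_def)

text \<open>Removing the components along \<xi> makes both vectors horizontal without changing their
  images; the correction is the product of these components.\<close>

lemma h_dpi: "h (\<pi> p) (d\<pi> p u) (d\<pi> p v) = g p u v - \<eta> p u * \<eta> p v"
proof -
  have "h (\<pi> p) (d\<pi> p u) (d\<pi> p v) = g p u v" if "\<eta> p u = 0" "\<eta> p v = 0" for u v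
    using submersive that horizontal_eq[of p]
    by (simp add: submersive_onto_def riemannian_submersion_def)
  from this[of "u - \<eta> p u *\<^sub>R \<xi> p" "v - \<eta> p v *\<^sub>R \<xi> p"] show ?thesis
    by (simp add: eta_eq[symmetric] g_sym[of p _ "\<xi> p"])
qed

lemma dpi_phi: "d\<pi> p (\<phi> p v) = J' (\<pi> p) (d\<pi> p v)"
proof -
  have "d\<pi> p (\<phi> p v) = J' (\<pi> p) (d\<pi> p v)" if "\<eta> p v = 0" for v
    using submersive that by (simp add: submersive_onto_def)
  from this[of "v - \<eta> p v *\<^sub>R \<xi> p"] show ?thesis by simp
qed

lemma J'_linear: "linear (J' q)"
  and J'_smooth: "open V \<Longrightarrow> smooth_vf B V W \<Longrightarrow> smooth_vf B V (act J' W)"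
  and h_J'_J': "h q (J' q u) (J' q w) = h q u w"
  using submersive
  by (auto simp: submersive_onto_def almost_hermitian_def smooth_endo_def act_def[abs_def])

text \<open>By \<open>h_dpi\<close> the difference has length zero: a vector is determined by its
  image together with its component along \<xi>.\<close>

lemma horizontal_eqI: "\<eta> p u = \<eta> p v \<Longrightarrow> d\<pi> p u = d\<pi> p v \<Longrightarrow> u = v"
proof -
  assume "\<eta> p u = \<eta> p v" "d\<pi> p u = d\<pi> p v"
  then have "g p (u - v) (u - v) = 0" using h_dpi[of p "u - v" "u - v"] by simp
  then show "u = v" using g_pos[of "u - v" p] by force
qed

section \<open>Horizontal lifts and adapted frames\<close>

lemma horizontal_lift_exists: "\<exists>v. \<eta> p v = 0 \<and> d\<pi> p v = w"
proof -
  have "surj (d\<pi> p)" using submersive by (simp add: submersive_onto_def riemannian_submersion_def)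
  then obtain v where "d\<pi> p v = w" by (metis surjD)
  then show ?thesis by (intro exI[of _ "v - \<eta> p v *\<^sub>R \<xi> p"]) simp
qed

text \<open>The chosen vector is unique by \<open>horizontal_eqI\<close>, and it depends on
  \<open>W\<close> only through the value at \<open>\<pi> p\<close>.\<close>

definition lift :: "('b \<Rightarrow> 'f) \<Rightarrow> 'm \<Rightarrow> 'e" where
  "lift W p = (SOME v. \<eta> p v = 0 \<and> d\<pi> p v = W (\<pi> p))"

lemma eta_lift [simp]: "\<eta> p (lift W p) = 0" and dpi_lift [simp]: "d\<pi> p (lift W p) = W (\<pi> p)"
  unfolding lift_def using someI_ex[OF horizontal_lift_exists[of p "W (\<pi> p)"]] by auto

lemma g_xi_lift [simp]: "g p (\<xi> p) (lift W p) = 0" "g p (lift W p) (\<xi> p) = 0"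
  using eta_lift[of p W] by (simp_all add: eta_eq g_sym[of p "lift W p"])

lemma lift_eqI: "\<eta> p v = 0 \<Longrightarrow> d\<pi> p v = W (\<pi> p) \<Longrightarrow> v = lift W p"
  by (rule horizontal_eqI[of p]) simp_all

lemma lift_eq_zero: "W (\<pi> p) = 0 \<Longrightarrow> lift W p = 0"
  by (rule lift_eqI[symmetric]) simp_all

lemma phi_lift: "act \<phi> (lift W) = lift (act J' W)"
  by (rule ext, rule lift_eqI) (simp_all add: act_def dpi_phi)

lemma g_lift: "g p (lift W p) (lift W' p) = h (\<pi> p) (W (\<pi> p)) (W' (\<pi> p))"
  using h_dpi[of p "lift W p" "lift W' p"] by simp

lemma g_lift_left: "g p u (lift W p) = h (\<pi> p) (d\<pi> p u) (W (\<pi> p))"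
  using h_dpi[of p u "lift W p"] by simp

text \<open>The lift is chosen pointwise, so smoothness has to be proved. In a local orthonormal
  frame its coefficients are the products of \<open>W\<close> with the images of the
  \<open>E i\<close>, and the components of these images are derivatives along \<open>E i\<close> of
  the pulled back coordinates.\<close>

lemma lift_smooth:
  assumes V: "open V" and W: "smooth_vf B V W"
  shows "smooth_vf A (\<pi> -` V) (lift W)"
proof (rule smooth_vf_local)
  fix p assume p: "p \<in> \<pi> -` V"
  obtain U E where U: "open U" "p \<in> U" and E: "orthonormal_frame A g U E"
    using local_orthonormal_frame by blast
  let ?d = "N.at_chart (\<pi> p)"
  let ?V = "V \<inter> fst ?d" let ?O = "U \<inter> \<pi> -` ?V"
  have V': "open ?V" by (intro open_Int V N.chart_open) simp
  have O: "open ?O" by (intro open_Int U preimage_open V')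
  have Es: "smooth_vf A ?O (E i)" if "i < DIM('e)" for i
    by (rule smooth_vf_subset[OF frame_smooth[OF E that]]) auto
  define k where "k i q = (\<Sum>b\<in>Basis. dir_deriv A (E i) (\<lambda>q. snd ?d (\<pi> q) \<bullet> b) q *
    h (\<pi> q) (W (\<pi> q)) (N.coord_field ?d b (\<pi> q)))" for i q
  have "smooth_fun A ?O (k i)" if i: "i < DIM('e)" for i
  proof -
    have y: "smooth_fun A ?O (\<lambda>q. snd ?d (\<pi> q) \<bullet> b)" for b
      by (rule smooth_fun_subset[OF smooth_fun_pullback[OF _ N.smooth_coordinate]])
        (auto intro: N.chart_open)
    have "smooth_fun B ?V (\<lambda>q. h q (W q) (N.coord_field ?d b q))" for b
      by (intro N.g_smooth V' N.smooth_vf_subset[OF W] N.smooth_vf_subset[OF N.smooth_coord_field]) auto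
    from smooth_fun_pullback[OF V' this]
    have "smooth_fun A ?O (\<lambda>q. h (\<pi> q) (W (\<pi> q)) (N.coord_field ?d b (\<pi> q)))" for b
      by (rule smooth_fun_subset) auto
    then show ?thesis unfolding k_def
      by (intro smooth_fun_sum smooth_fun_mult O smooth_dir_deriv y Es i)
  qed
  then have s: "smooth_vf A ?O (\<lambda>q. \<Sum>i<DIM('e). k i q *\<^sub>R E i q)"
    by (intro smooth_vf_sum smooth_vf_scaleR O Es) auto
  have "(\<Sum>i<DIM('e). k i q *\<^sub>R E i q) = lift W q" if q: "q \<in> ?O" for q
  proof -
    have "k i q = g q (lift W q) (E i q)" for i
    proof -
      have d: "?d \<in> B" "\<pi> q \<in> fst ?d" using q by auto
      have "comps B ?d (\<pi> q) (d\<pi> q (E i q)) \<bullet> b = dir_deriv A (E i) (\<lambda>q. snd ?d (\<pi> q) \<bullet> b) q" for b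
        using dir_deriv_pullback[OF N.chart_open[OF d(1)] N.smooth_coordinate[OF d(1)] d(2),
            of "E i" "\<lambda>_. d\<pi> q (E i q)" b] N.dir_deriv_coordinate[OF d, of "\<lambda>_. d\<pi> q (E i q)" b] by simp
      then have "d\<pi> q (E i q) = (\<Sum>b\<in>Basis. dir_deriv A (E i) (\<lambda>q. snd ?d (\<pi> q) \<bullet> b) q *\<^sub>R N.coord_field ?d b (\<pi> q))"
        using N.coord_field_expansion[OF d, of "d\<pi> q (E i q)"] by simp
      then have "h (\<pi> q) (W (\<pi> q)) (d\<pi> q (E i q)) = k i q"
        by (simp add: N.g_sum k_def)
      then show ?thesis using h_dpi[of q "lift W q" "E i q"] by simp
    qed
    then show ?thesis using frame_expansion[OF E, of q "lift W q"] q by simp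
  qed
  then have "smooth_vf A ?O (lift W)" by (rule smooth_vf_cong[OF O _ s])
  then show "\<exists>V. open V \<and> p \<in> V \<and> smooth_vf A V (lift W)"
    using O U p by (intro exI[of _ ?O]) auto
qed

text \<open>Every horizontal vector is the value of a smooth lift, so identities at a point may be
  tested on lifts, whose brackets and products are known.\<close>

lemma lift_through:
  assumes "\<eta> p v = 0"
  shows "\<exists>V W. open V \<and> \<pi> p \<in> V \<and> smooth_vf B V W \<and> lift W p = v"
proof (intro exI conjI)
  let ?d = "N.at_chart (\<pi> p)"
  show "open (fst ?d)" "\<pi> p \<in> fst ?d" "smooth_vf B (fst ?d) (N.coord_field ?d (d\<pi> p v))"
    by (simp_all add: N.chart_open N.smooth_coord_field)
  show "lift (N.coord_field ?d (d\<pi> p v)) p = v"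
    by (rule lift_eqI[symmetric]) (use assms in simp_all)
qed

text \<open>Among the \<open>DIM('e) = Suc DIM('f)\<close> indices of a frame, the last one carries
  \<xi>.\<close>

definition adapted_frame :: "(nat \<Rightarrow> 'b \<Rightarrow> 'f) \<Rightarrow> nat \<Rightarrow> 'm \<Rightarrow> 'e" where
  "adapted_frame F i = (if i < DIM('f) then lift (F i) else \<xi>)"

lemma adapted_frame_orthonormal:
  assumes "open V" "orthonormal_frame B h V F"
  shows "orthonormal_frame A g (\<pi> -` V) (adapted_frame F)"
  unfolding orthonormal_frame_def
proof (intro conjI allI impI ballI)
  show "smooth_vf A (\<pi> -` V) (adapted_frame F i)" for i
    using assms by (auto simp: adapted_frame_def xi_smooth intro: lift_smooth N.frame_smooth)
  fix p i j assume "p \<in> \<pi> -` V" "i < DIM('e)" "j < DIM('e)"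
  then show "g p (adapted_frame F i p) (adapted_frame F j p) = (if i = j then 1 else 0)"
    using assms N.frame_orthonormal[OF assms(2), of "\<pi> p" i j]
    by (auto simp: adapted_frame_def dims g_lift less_Suc_eq)
qed

lemma sum_adapted:
  "(\<Sum>i<DIM('e). T (adapted_frame F i)) = (\<Sum>i<DIM('f). T (lift (F i))) + T \<xi>"
  by (simp add: dims adapted_frame_def)

section \<open>Brackets with \<xi> and the covariant derivative of \<xi>\<close>

lemma lie_bracket_lift:
  assumes V: "open V" "smooth_vf B V W" "smooth_vf B V W'" and p: "\<pi> p \<in> V"
  shows "d\<pi> p (lie_bracket A (lift W) (lift W') p) = lie_bracket B W W' (\<pi> p)"
  by (rule lie_bracket_related[OF V preimage_open[OF V(1)] subset_refl]) (use p lift_smooth V in auto)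

text \<open>For constant components along \<xi> only the bracket term of \<open>ext_deriv\<close> is
  left; the 2 undoes its factor 1/2. The constants 0 and 1 serve lifts and \<xi>.\<close>

lemma eta_lie_bracket:
  assumes U: "open U" and X: "smooth_vf A U X" and Y: "smooth_vf A U Y" and p: "p \<in> U"
    and c: "\<And>q. q \<in> U \<Longrightarrow> \<eta> q (X q) = r" "\<And>q. q \<in> U \<Longrightarrow> \<eta> q (Y q) = s"
  shows "\<eta> p (lie_bracket A X Y p) = - 2 * g p (X p) (\<phi> p (Y p))"
  using ext_deriv_eta[OF U X Y p] dir_deriv_zero_on[OF U p, of "\<lambda>q. \<eta> q (X q)" r]
    dir_deriv_zero_on[OF U p, of "\<lambda>q. \<eta> q (Y q)" s] c
  by (simp add: ext_deriv_def)

lemma lie_bracket_xi_lift: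
  assumes V: "open V" "smooth_vf B V W" and p: "\<pi> p \<in> V"
  shows "lie_bracket A \<xi> (lift W) p = 0"
proof (rule horizontal_eqI[of p])
  note U = preimage_open[OF V(1)] and l = lift_smooth[OF V]
  show "\<eta> p (lie_bracket A \<xi> (lift W) p) = \<eta> p 0"
    using eta_lie_bracket[OF U xi_smooth l, of p 1 0] p by (simp add: eta_eq[symmetric])
  \<comment> \<open>The field \<xi> is related by \<pi> to the zero field of the base, whose
    brackets vanish.\<close>
  have z: "smooth_vf B V (\<lambda>_. 0)" by (rule N.smooth_vf_zero[OF V(1)])
  have "d\<pi> p (lie_bracket A \<xi> (lift W) p) = lie_bracket B (\<lambda>_. 0) W (\<pi> p)"
    by (rule lie_bracket_related[OF V(1) z V(2) U subset_refl xi_smooth l]) (use p in auto)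
  also have "\<dots> = 0"
    using N.torsion_free[OF V(1) z V(2) p] N.TM.D_X_zero[OF V(1) z V(2) _ p] N.TM.D_zero_on[OF V z _ p] by simp
  finally show "d\<pi> p (lie_bracket A \<xi> (lift W) p) = d\<pi> p 0" by simp
qed

text \<open>A vector orthogonal to \<xi> is itself the value of a lift, hence orthogonal to
  itself.\<close>

lemma g_eq_zero_lift:
  assumes "g p v (\<xi> p) = 0" "\<And>V W. open V \<Longrightarrow> \<pi> p \<in> V \<Longrightarrow> smooth_vf B V W \<Longrightarrow> g p v (lift W p) = 0"
  shows "v = 0"
proof -
  have "\<eta> p v = 0" using assms(1) by (simp add: eta_eq g_sym[of p v])
  then obtain V W where "open V" "\<pi> p \<in> V" "smooth_vf B V W" "lift W p = v"
    using lift_through by blast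
  then have "g p v v = 0" using assms(2) by metis
  then show ?thesis using g_pos[of v p] by force
qed

lemma g_nab_xi_xi:
  assumes "open U" "smooth_vf A U X" "p \<in> U"
  shows "g p (nab X \<xi> p) (\<xi> p) = 0"
  using metric_compatible[OF assms(1,2) xi_smooth xi_smooth assms(3)] by (simp add: g_sym[of p "\<xi> p"])

lemma nab_xi_lift_commute:
  assumes "open V" "smooth_vf B V W" "\<pi> p \<in> V"
  shows "nab \<xi> (lift W) p = nab (lift W) \<xi> p"
  using torsion_free[OF preimage_open[OF assms(1)] xi_smooth lift_smooth[OF assms(1,2)], of p]
    lie_bracket_xi_lift[OF assms] assms(3) by simp

text \<open>For a lift W, g(\<nabla>_\<xi> \<xi>, W) = -g(\<xi>, \<nabla>_\<xi> W) = -g(\<xi>,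
  \<nabla>_W \<xi>) = 0: the middle step because \<xi> and W commute, the last because \<xi> has
  unit length.\<close>

lemma nab_xi_xi: "nab \<xi> \<xi> p = 0"
proof (rule g_eq_zero_lift)
  show "g p (nab \<xi> \<xi> p) (\<xi> p) = 0" by (rule g_nab_xi_xi[OF open_UNIV xi_smooth UNIV_I])
  fix V W assume V: "open V" "\<pi> p \<in> V" "smooth_vf B V W"
  note U = preimage_open[OF V(1)] and l = lift_smooth[OF V(1,3)]
  have p: "p \<in> \<pi> -` V" using V by simp
  show "g p (nab \<xi> \<xi> p) (lift W p) = 0"
    using metric_compatible[OF U xi_smooth xi_smooth l p] nab_xi_lift_commute[OF V(1,3,2)]
      g_nab_xi_xi[OF U l p] by (simp add: g_sym[of p "\<xi> p"])
qed

text \<open>Let b(W, W') = g(\<nabla>_W \<xi>, W'). It is skew on lifts, because their products are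
  constant along \<xi> and \<xi> commutes with them. Hence \<eta>([W, W']) = b(W', W) - b(W, W') =
  -2 b(W, W'), while the contact condition gives -2 g(W, \<phi> W').\<close>

lemma nab_lift_xi:
  assumes V: "open V" "smooth_vf B V W" and pV: "\<pi> p \<in> V"
  shows "nab (lift W) \<xi> p = - \<phi> p (lift W p)"
proof -
  have "nab (lift W) \<xi> p + \<phi> p (lift W p) = 0"
  proof (rule g_eq_zero_lift)
    note U = preimage_open[OF V(1)] and l = lift_smooth[OF V]
    show "g p (nab (lift W) \<xi> p + \<phi> p (lift W p)) (\<xi> p) = 0"
      using g_nab_xi_xi[OF U l, of p] pV eta_phi[of p "lift W p"] by (simp add: eta_eq g_sym[of p "\<xi> p"])
    fix V' W' assume V': "open V'" "\<pi> p \<in> V'" "smooth_vf B V' W'"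
    let ?V = "V \<inter> V'"
    have O: "open ?V" "\<pi> p \<in> ?V" using V V' pV by auto
    have W: "smooth_vf B ?V W" "smooth_vf B ?V W'"
      using N.smooth_vf_subset[OF V(2)] N.smooth_vf_subset[OF V'(3)] by auto
    note U = preimage_open[OF O(1)] and l = lift_smooth[OF O(1) W(1)] and l' = lift_smooth[OF O(1) W(2)]
    have p: "p \<in> \<pi> -` ?V" using O by simp
    have "dir_deriv A \<xi> (\<lambda>q. g q (lift W q) (lift W' q)) p = dir_deriv B (\<lambda>_. 0) (\<lambda>q. h q (W q) (W' q)) (\<pi> p)"
      unfolding g_lift by (rule dir_deriv_pullback[OF O(1) N.g_smooth[OF O(1) W] O(2)]) simp
    also have "\<dots> = 0"
      using N.dir_deriv_linear(4)[OF N.g_smooth[OF O(1) W] O(2), of "\<lambda>_. 0" "\<lambda>_. 0"] by simp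
    finally have "g p (nab (lift W) \<xi> p) (lift W' p) + g p (nab (lift W') \<xi> p) (lift W p) = 0"
      using metric_compatible[OF U xi_smooth l l' p] nab_xi_lift_commute[OF O(1) W(1) O(2)]
        nab_xi_lift_commute[OF O(1) W(2) O(2)] by (simp add: g_sym[of p "lift W p"])
    moreover have "g p (\<xi> p) (nab (lift W) (lift W') p) = - g p (nab (lift W) \<xi> p) (lift W' p)"
      using metric_compatible[OF U l xi_smooth l' p] by simp
    moreover have "g p (\<xi> p) (nab (lift W') (lift W) p) = - g p (nab (lift W') \<xi> p) (lift W p)"
      using metric_compatible[OF U l' xi_smooth l p] by simp
    moreover have "g p (\<xi> p) (nab (lift W) (lift W') p - nab (lift W') (lift W) p)
        = - 2 * g p (lift W p) (\<phi> p (lift W' p))"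
      using eta_lie_bracket[OF U l l' p, of 0 0] torsion_free[OF U l l' p] by (simp add: eta_eq)
    ultimately show "g p (nab (lift W) \<xi> p + \<phi> p (lift W p)) (lift W' p) = 0"
      by (simp add: phi_skew)
  qed
  then show ?thesis by (simp add: eq_neg_iff_add_eq_0)
qed

text \<open>Both sides are tensorial in \<open>X\<close> and agree on the members of an adapted
  frame.\<close>

lemma nab_xi:
  assumes U: "open U" and X: "smooth_vf A U X" and p: "p \<in> U"
  shows "nab X \<xi> p = - \<phi> p (X p)"
proof -
  obtain V F where V: "open V" "\<pi> p \<in> V" and F: "orthonormal_frame B h V F"
    using N.local_orthonormal_frame by blast
  let ?O = "U \<inter> \<pi> -` V" let ?E = "adapted_frame F" let ?n = "DIM('e)"
  have O: "open ?O" "p \<in> ?O" using U p V preimage_open by auto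
  have E: "orthonormal_frame A g ?O ?E"
    by (rule frame_subset[OF adapted_frame_orthonormal[OF V(1) F]]) auto
  have X': "smooth_vf A ?O X" by (rule smooth_vf_subset[OF X]) auto
  note M = module_on_smooth_vf[OF O(1)] and T = TM.D_tensorial[OF O(1) xi_smooth]
  have a: "smooth_fun A ?O (\<lambda>q. g q (X q) (?E i q))" if "i < ?n" for i
    by (intro g_smooth O X' frame_smooth[OF E] that)
  have ne: "finite {..<?n}" "{..<?n} \<noteq> {}" by (auto simp: dims)
  have s: "smooth_vf A ?O (\<lambda>q. \<Sum>i<?n. g q (X q) (?E i q) *\<^sub>R ?E i q)"
    by (rule module_on_sum[OF M ne]) (use a frame_smooth[OF E] in auto)
  have "nab X \<xi> p = nab (\<lambda>q. \<Sum>i<?n. g q (X q) (?E i q) *\<^sub>R ?E i q) \<xi> p"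
    by (rule tensorial_cong[OF O(1) M T X' s _ O(2)]) (rule frame_expansion[OF E])
  also have "\<dots> = (\<Sum>i<?n. g p (X p) (?E i p) *\<^sub>R nab (?E i) \<xi> p)"
    by (rule tensorial_sum[OF T M ne _ _ O(2)]) (use a frame_smooth[OF E] in auto)
  also have "\<dots> = (\<Sum>i<?n. g p (X p) (?E i p) *\<^sub>R (- \<phi> p (?E i p)))"
    using nab_lift_xi[OF V(1) N.frame_smooth[OF F] V(2)] nab_xi_xi
    by (intro sum.cong) (auto simp: adapted_frame_def)
  also have "\<dots> = - \<phi> p (\<Sum>i<?n. g p (X p) (?E i p) *\<^sub>R ?E i p)"
    by (simp add: sum_negf)
  also have "\<dots> = - \<phi> p (X p)"
    using frame_expansion[OF E O(2), of "X p"] by simp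
  finally show ?thesis .
qed

section \<open>The projected connection on horizontal fields\<close>

definition hor :: "'m set \<Rightarrow> ('m \<Rightarrow> 'e) \<Rightarrow> bool" where
  "hor U Z \<longleftrightarrow> smooth_vf A U Z \<and> (\<forall>p\<in>U. \<eta> p (Z p) = 0)"

abbreviation bnab :: "('m, 'e) connection" where "bnab \<equiv> bar_nabla nab \<xi> \<eta>"

lemma hor_smooth: "hor U Z \<Longrightarrow> smooth_vf A U Z" and hor_eta: "hor U Z \<Longrightarrow> p \<in> U \<Longrightarrow> \<eta> p (Z p) = 0"
  by (auto simp: hor_def)

lemma eta_bnab [simp]: "\<eta> p (bnab X Y p) = 0"
  by (simp add: bar_nabla_def)

lemma bnab_smooth: "open U \<Longrightarrow> smooth_vf A U X \<Longrightarrow> smooth_vf A U Y \<Longrightarrow> smooth_vf A U (bnab X Y)"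
  unfolding bar_nabla_def[abs_def] eta_eq
  by (intro smooth_vf_diff smooth_vf_scaleR g_smooth nab_smooth xi_smooth)

lemma module_on_hor: "open U \<Longrightarrow> module_on U (hor U)"
  using module_on_smooth_vf[of U] by (auto simp: module_on_def hor_def)

lemma bnab_tensorial:
  assumes "open U" "smooth_vf A U Z"
  shows "tensorial U (smooth_vf A U) (\<lambda>X. bnab X Z)"
  using tensorial_add[OF TM.D_tensorial[OF assms]] tensorial_scale[OF TM.D_tensorial[OF assms]]
  by (intro tensorialI) (simp_all add: bar_nabla_def scaleR_diff_right scaleR_add_left)

sublocale affine_manifold_bundle A nab hor bnab
proof unfold_locales
  fix U :: "'m set" assume U: "open U"
  fix X Y Z :: "'m \<Rightarrow> 'e" and f :: "'m \<Rightarrow> real" and p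
  assume X: "smooth_vf A U X" and Z: "hor U Z"
  show "hor U (bnab X Z)"
    using bnab_smooth[OF U X hor_smooth[OF Z]] by (simp add: hor_def)
  assume p: "p \<in> U"
  \<comment> \<open>The projection leaves the derivative term unchanged, because \<open>Z\<close> is
    horizontal.\<close>
  show "bnab X (\<lambda>q. f q *\<^sub>R Z q) p = dir_deriv A X f p *\<^sub>R Z p + f p *\<^sub>R bnab X Z p" if "smooth_fun A U f"
    using TM.D_leibniz[OF U X hor_smooth[OF Z] that p] hor_eta[OF Z p]
    by (simp add: bar_nabla_def scaleR_diff_right)
  assume Y: "hor U Y"
  show "bnab X (\<lambda>q. Y q + Z q) p = bnab X Y p + bnab X Z p"
    using TM.D_add[OF U X hor_smooth[OF Y] hor_smooth[OF Z] p]
    by (simp add: bar_nabla_def scaleR_add_left)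
qed (auto simp: module_on_hor hor_def intro: smooth_vf_subset bnab_tensorial)

section \<open>Horizontal lifts of the derivatives of the complex structure\<close>

lemma hor_lift: "open V \<Longrightarrow> smooth_vf B V W \<Longrightarrow> hor (\<pi> -` V) (lift W)"
  by (simp add: hor_def lift_smooth)

text \<open>For three lifts every term of the Koszul formula is the pullback of the corresponding
  term on the base. The vertical part of a bracket does not enter, being paired with a lift.\<close>

lemma bnab_lift:
  assumes V: "open V" and W: "smooth_vf B V W" "smooth_vf B V W'" and pV: "\<pi> p \<in> V"
  shows "bnab (lift W) (lift W') p = lift (nab' W W') p"
proof (rule lift_eqI)
  have "d\<pi> p (nab (lift W) (lift W') p) = nab' W W' (\<pi> p)"
  proof (rule N.g_eqI)
    fix w
    let ?d = "N.at_chart (\<pi> p)" let ?V = "V \<inter> fst ?d"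
    \<comment> \<open>The vector \<open>w\<close> is extended to a field, as the Koszul formula
      requires one in its last slot.\<close>
    define Q where "Q = N.coord_field ?d w"
    have O: "open ?V" "\<pi> p \<in> ?V" using V pV N.chart_open[of ?d] by auto
    have W: "smooth_vf B ?V W" "smooth_vf B ?V W'" "smooth_vf B ?V Q"
      using W N.smooth_coord_field[of ?d w] by (auto simp: Q_def intro: N.smooth_vf_subset)
    have Qp: "Q (\<pi> p) = w" by (simp add: Q_def)
    note U = preimage_open[OF O(1)] and l = lift_smooth[OF O(1) W(1)] lift_smooth[OF O(1) W(2)] lift_smooth[OF O(1) W(3)]
    have p: "p \<in> \<pi> -` ?V" using O by simp
    have 1: "dir_deriv A (lift X) (\<lambda>q. g q (lift Y q) (lift Z q)) p = dir_deriv B X (\<lambda>q. h q (Y q) (Z q)) (\<pi> p)"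
      if "smooth_vf B ?V Y" "smooth_vf B ?V Z" for X Y Z
      unfolding g_lift by (rule dir_deriv_pullback[OF O(1) N.g_smooth[OF O(1) that] O(2)]) simp
    have 2: "g p (lie_bracket A (lift X) (lift Y) p) (lift Z p) = h (\<pi> p) (lie_bracket B X Y (\<pi> p)) (Z (\<pi> p))"
      if "smooth_vf B ?V X" "smooth_vf B ?V Y" for X Y Z
      by (simp add: g_lift_left lie_bracket_lift[OF O(1) that O(2)])
    have "2 * g p (nab (lift W) (lift W') p) (lift Q p) = 2 * h (\<pi> p) (nab' W W' (\<pi> p)) (Q (\<pi> p))"
      by (simp only: koszul[OF U l p] N.koszul[OF O(1) W O(2)] 1 2 W)
    then show "h (\<pi> p) (d\<pi> p (nab (lift W) (lift W') p)) w = h (\<pi> p) (nab' W W' (\<pi> p)) w"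
      by (simp add: g_lift_left Qp)
  qed
  then show "d\<pi> p (bnab (lift W) (lift W') p) = nab' W W' (\<pi> p)"
    by (simp add: bar_nabla_def)
qed simp

lemma hor_phi: "open U \<Longrightarrow> smooth_vf A U X \<Longrightarrow> hor U (act \<phi> X)"
  by (simp add: hor_def phi_smooth) (simp add: act_def)

lemma phi_endo: "B.endo_on U (act \<phi>)"
  unfolding B.endo_on_def
  by (auto intro!: hor_phi hor_smooth tensorialI simp: act_def)

lemma J'_endo: "N.TM.endo_on V (act J')"
  unfolding N.TM.endo_on_def using J'_linear
  by (auto intro!: J'_smooth N.tensorialI simp: act_def linear_add linear_scale)

abbreviation covJ :: "('m, 'e) connection" where "covJ X \<equiv> cov_end bnab X (act \<phi>)"
abbreviation covJ' :: "('b, 'f) connection" where "covJ' X \<equiv> cov_end nab' X (act J')"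

lemma covJ_endo: "open U \<Longrightarrow> smooth_vf A U X \<Longrightarrow> B.endo_on U (covJ X)"
  by (rule B.endo_on_cov_end[OF _ _ phi_endo])

lemma covJ_hor: "open U \<Longrightarrow> smooth_vf A U X \<Longrightarrow> hor U Y \<Longrightarrow> hor U (covJ X Y)"
  using B.endo_on_section[OF covJ_endo] by blast

lemma eta_covJ [simp]: "\<eta> p (covJ X Y p) = 0"
  by (simp add: cov_end_def) (simp add: act_def)

lemma covJ'_smooth:
  "open V \<Longrightarrow> smooth_vf B V W \<Longrightarrow> smooth_vf B V W' \<Longrightarrow> smooth_vf B V (covJ' W W')"
  using N.TM.endo_on_section[OF N.TM.endo_on_cov_end[OF _ _ J'_endo]] by blast

lemma covJ_lift:
  assumes V: "open V" and W: "smooth_vf B V W" "smooth_vf B V W'" and p: "\<pi> p \<in> V"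
  shows "covJ (lift W) (lift W') p = lift (covJ' W W') p"
proof (rule lift_eqI)
  show "d\<pi> p (covJ (lift W) (lift W') p) = covJ' W W' (\<pi> p)"
    using bnab_lift[OF V W(1) J'_smooth[OF V W(2)] p] bnab_lift[OF V W p]
    by (simp add: cov_end_def phi_lift) (simp add: act_def dpi_phi)
qed simp

text \<open>The vertical part of the derivative of a lift along a lift is O'Neill's tensor of the
  submersion. It is alternating by \<open>phi_alternating\<close>.\<close>

lemma eta_nab_lift:
  assumes V: "open V" and W: "smooth_vf B V W" "smooth_vf B V W'" and p: "\<pi> p \<in> V"
  shows "\<eta> p (nab (lift W) (lift W') p) = g p (\<phi> p (lift W p)) (lift W' p)"
  using metric_compatible[OF preimage_open[OF V] lift_smooth[OF V W(1)] xi_smooth lift_smooth[OF V W(2)], of p]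
    nab_lift_xi[OF V W(1) p] p by (simp add: eta_eq)

lemma phi_alternating: "g p (\<phi> p v) v = 0"
  using phi_skew[of p v v] g_sym[of p v "\<phi> p v"] by simp

text \<open>Both directions are the same lift. Then its derivative along itself has no component
  along \<xi>, so that the correction term is a lift too; the horizontal part of a trace consists of
  such terms.\<close>

lemma cov2_lift:
  assumes V: "open V" and W: "smooth_vf B V W" "smooth_vf B V W'" and pV: "\<pi> p \<in> V"
  shows "cov2_end nab bnab (lift W) (lift W) (act \<phi>) (lift W') p
    = lift (cov2_end nab' nab' W W (act J') W') p"
proof -
  let ?U = "\<pi> -` V"
  note U = preimage_open[OF V]
  have p: "p \<in> ?U" using pV by simp
  note l = lift_smooth[OF V W(1)] and h1 = hor_lift[OF V W(1)] and h2 = hor_lift[OF V W(2)]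
  note cW = covJ'_smooth[OF V W] and nW = N.nab_smooth[OF V W] and nWW = N.nab_smooth[OF V W(1) W(1)]
  have 1: "bnab (lift W) (covJ (lift W) (lift W')) p = lift (nab' W (covJ' W W')) p"
  proof -
    have "bnab (lift W) (covJ (lift W) (lift W')) p = bnab (lift W) (lift (covJ' W W')) p"
      by (rule B.D_cong[OF U l l covJ_hor[OF U l h2] hor_lift[OF V cW] refl _ p]) (simp add: covJ_lift[OF V W])
    then show ?thesis using bnab_lift[OF V W(1) cW pV] by simp
  qed
  have 2: "covJ (lift W) (bnab (lift W) (lift W')) p = lift (covJ' W (nab' W W')) p"
  proof -
    have "covJ (lift W) (bnab (lift W) (lift W')) p = covJ (lift W) (lift (nab' W W')) p"
      by (rule B.endo_on_cong[OF covJ_endo[OF U l] U B.D_section[OF U l h2] hor_lift[OF V nW] _ p])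
        (simp add: bnab_lift[OF V W])
    then show ?thesis using covJ_lift[OF V W(1) nW pV] by simp
  qed
  have 3: "covJ (nab (lift W) (lift W)) (lift W') p = lift (covJ' (nab' W W) W') p"
  proof -
    have "nab (lift W) (lift W) q = lift (nab' W W) q" if "\<pi> q \<in> V" for q
      using bnab_lift[OF V W(1) W(1) that] eta_nab_lift[OF V W(1) W(1) that]
      by (simp add: bar_nabla_def phi_alternating)
    then have "covJ (nab (lift W) (lift W)) (lift W') p = covJ (lift (nab' W W)) (lift W') p"
      by (intro B.cov_end_cong[OF U U U phi_endo h2 nab_smooth[OF U l l] lift_smooth[OF V nWW] _ p]) simp
    then show ?thesis using covJ_lift[OF V nWW W(2) pV] by simp
  qed
  show ?thesis
  proof (rule lift_eqI)
    show "\<eta> p (cov2_end nab bnab (lift W) (lift W) (act \<phi>) (lift W') p) = 0"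
      by (simp add: cov2_end_def cov_end_def[of bnab _ "cov_end bnab _ _"] 1 2 3)
    show "d\<pi> p (cov2_end nab bnab (lift W) (lift W) (act \<phi>) (lift W') p) = cov2_end nab' nab' W W (act J') W' (\<pi> p)"
      by (simp add: cov2_end_def cov_end_def[of bnab _ "cov_end bnab _ _"] cov_end_def[of nab' _ "cov_end nab' _ _"] 1 2 3)
  qed
qed

lemma bnab_xi_lift:
  assumes "open V" "smooth_vf B V W" "\<pi> p \<in> V"
  shows "bnab \<xi> (lift W) p = - act \<phi> (lift W) p"
  using nab_xi_lift_commute[OF assms] nab_lift_xi[OF assms]
  by (simp add: bar_nabla_def act_def)

text \<open>By \<open>bnab_xi_lift\<close> the derivative along \<xi> acts on lifts as -J, which
  commutes with J.\<close>

lemma covJ_xi_lift: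
  assumes V: "open V" and W: "smooth_vf B V W" and p: "\<pi> p \<in> V"
  shows "covJ \<xi> (lift W) p = 0"
  using bnab_xi_lift[OF V W p] bnab_xi_lift[OF V J'_smooth[OF V W] p]
  by (simp add: cov_end_def phi_lift) (simp add: act_def phi_lift[symmetric])

text \<open>J is parallel along \<xi> on all lifts near \<open>p\<close>, the derivative of a lift
  along \<xi> is minus another lift, and \<nabla>_\<xi> \<xi> = 0; so all three terms
  vanish.\<close>

lemma cov2_xi_lift:
  assumes V: "open V" and W: "smooth_vf B V W" and pV: "\<pi> p \<in> V"
  shows "cov2_end nab bnab \<xi> \<xi> (act \<phi>) (lift W) p = 0"
proof -
  note U = preimage_open[OF V]
  have p: "p \<in> \<pi> -` V" using pV by simp
  note h = hor_lift[OF V W] and h' = hor_lift[OF V J'_smooth[OF V W]]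
  have 1: "bnab \<xi> (covJ \<xi> (lift W)) p = 0"
    by (rule B.D_zero_on[OF U xi_smooth covJ_hor[OF U xi_smooth h] _ p]) (simp add: covJ_xi_lift[OF V W])
  have h'': "hor (\<pi> -` V) (\<lambda>q. (-1) *\<^sub>R lift (act J' W) q)"
    by (rule B.S_scale[OF U smooth_fun_const h'])
  have "covJ \<xi> (bnab \<xi> (lift W)) p = covJ \<xi> (\<lambda>q. (-1) *\<^sub>R lift (act J' W) q) p"
    by (rule B.endo_on_cong[OF covJ_endo[OF U xi_smooth] U B.D_section[OF U xi_smooth h] h'' _ p])
      (simp add: bnab_xi_lift[OF V W] phi_lift)
  also have "\<dots> = (-1) *\<^sub>R covJ \<xi> (lift (act J' W)) p"
    by (rule tensorial_scale[OF B.endo_on_tensorial[OF covJ_endo[OF U xi_smooth] U] smooth_fun_const h' p])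
  also have "\<dots> = 0" using covJ_xi_lift[OF V J'_smooth[OF V W] pV] by simp
  finally have 2: "covJ \<xi> (bnab \<xi> (lift W)) p = 0" .
  have 3: "covJ (nab \<xi> \<xi>) (lift W) p = 0"
    by (rule tensorial_zero_on[OF U B.cov_end_tensorial[OF U phi_endo h] nab_smooth[OF U xi_smooth xi_smooth] _ p])
      (simp add: nab_xi_xi)
  show ?thesis
    by (simp add: cov2_end_def cov_end_def[of bnab _ "cov_end bnab _ _"] 1 2 3)
qed

section \<open>The tension field of J on lifts and on arbitrary horizontal fields\<close>

context
  fixes V F p
  assumes V: "open V" and F: "orthonormal_frame B h V F" and pV: "\<pi> p \<in> V"
begin

lemma rough_laplacian_lift:
  assumes W: "smooth_vf B V W"
  shows "rough_laplacian_end nab bnab (adapted_frame F) (act \<phi>) (lift W) p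
    = lift (rough_laplacian_end nab' nab' F (act J') W) p"
proof (rule lift_eqI)
  have eq: "rough_laplacian_end nab bnab (adapted_frame F) (act \<phi>) (lift W) p
      = - (\<Sum>i<DIM('f). lift (cov2_end nab' nab' (F i) (F i) (act J') W) p)"
    unfolding rough_laplacian_end_def
    by (subst sum_adapted[of "\<lambda>X. cov2_end nab bnab X X (act \<phi>) (lift W) p"])
      (simp add: cov2_lift[OF V N.frame_smooth[OF F] W pV] cov2_xi_lift[OF V W pV])
  show "\<eta> p (rough_laplacian_end nab bnab (adapted_frame F) (act \<phi>) (lift W) p) = 0"
    by (simp add: eq)
  show "d\<pi> p (rough_laplacian_end nab bnab (adapted_frame F) (act \<phi>) (lift W) p)
      = rough_laplacian_end nab' nab' F (act J') W (\<pi> p)"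
    unfolding eq by (simp add: rough_laplacian_end_def)
qed

lemma tau_lift:
  assumes W: "smooth_vf B V W"
  shows "tau_end nab bnab (adapted_frame F) (act \<phi>) (lift W) p = lift (tau_end nab' nab' F (act J') W) p"
  by (rule lift_eqI)
    (simp_all add: tau_end_def phi_lift rough_laplacian_lift W J'_smooth[OF V W] act_def[of \<phi>] act_def[of J' "rough_laplacian_end _ _ _ _ _"] dpi_phi)

end

lemma rough_laplacian_frame_independent:
  assumes U: "open U" and p: "p \<in> U" and E: "orthonormal_frame A g U E" "orthonormal_frame A g U E'"
    and Z: "hor U Z"
  shows "rough_laplacian_end nab bnab E (act \<phi>) Z p = rough_laplacian_end nab bnab E' (act \<phi>) Z p"
  unfolding rough_laplacian_end_def
  using trace_frame_independent[OF U p E, of "\<lambda>X Y. cov2_end nab bnab X Y (act \<phi>) Z"]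
    cov2_end_tensorial_left[OF U phi_endo Z] cov2_end_tensorial_right[OF U phi_endo Z] by simp

lemma tau_frame_independent:
  assumes U: "open U" and p: "p \<in> U" and E: "orthonormal_frame A g U E" "orthonormal_frame A g U E'"
    and Z: "hor U Z"
  shows "tau_end nab bnab E (act \<phi>) Z p = tau_end nab bnab E' (act \<phi>) Z p"
  using rough_laplacian_frame_independent[OF U p E Z]
    rough_laplacian_frame_independent[OF U p E hor_phi[OF U hor_smooth[OF Z]]]
  by (simp add: tau_end_def act_def[of \<phi> "rough_laplacian_end _ _ _ _ _"])

lemma rough_laplacian_tensorial:
  assumes U: "open U" and E: "orthonormal_frame A g U E"
  shows "tensorial U (hor U) (rough_laplacian_end nab bnab E (act \<phi>))"
proof -
  have T: "tensorial U (hor U) (cov2_end nab bnab (E i) (E i) (act \<phi>))" if "i < DIM('e)" for i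
    by (rule cov2_end_tensorial_section[OF U phi_endo frame_smooth[OF E that] frame_smooth[OF E that]])
  show ?thesis
    by (rule tensorialI)
      (simp_all add: rough_laplacian_end_def tensorial_add[OF T] tensorial_scale[OF T] sum.distrib scaleR_sum_right)
qed

lemma tau_tensorial:
  assumes U: "open U" and E: "orthonormal_frame A g U E"
  shows "tensorial U (hor U) (tau_end nab bnab E (act \<phi>))"
proof -
  note T = rough_laplacian_tensorial[OF assms]
  have s: "act \<phi> (\<lambda>p. Y p + Z p) = (\<lambda>p. act \<phi> Y p + act \<phi> Z p)"
    "act \<phi> (\<lambda>p. f p *\<^sub>R Z p) = (\<lambda>p. f p *\<^sub>R act \<phi> Z p)" for Y Z f
    by (simp_all add: act_def fun_eq_iff)
  note h = hor_phi[OF U hor_smooth]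
  show ?thesis
    by (rule tensorialI)
      (simp_all add: tau_end_def s tensorial_add[OF T h h] tensorial_scale[OF T _ h]
        act_def[of \<phi> "rough_laplacian_end _ _ _ _ _"] tensorial_add[OF T] tensorial_scale[OF T] scaleR_diff_right)
qed

text \<open>The frame \<open>E\<close> is exchanged for an adapted one and \<open>Z\<close> is
  expanded in the lifts of its horizontal members; on these, \<open>tau_lift\<close> gives the lift
  of a vanishing field.\<close>

lemma harmonic_ah_imp_tau_zero:
  assumes harm: "harmonic_ah B h J' nab'"
    and U: "open U" and E: "orthonormal_frame A g U E" and Z: "hor U Z" and p: "p \<in> U"
  shows "tau_end nab bnab E (act \<phi>) Z p = 0"
proof -
  obtain V F where V: "open V" "\<pi> p \<in> V" and F: "orthonormal_frame B h V F"
    using N.local_orthonormal_frame by blast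
  let ?O = "U \<inter> \<pi> -` V" let ?n = "DIM('f)"
  have O: "open ?O" "p \<in> ?O" using U p V preimage_open by auto
  have EO: "orthonormal_frame A g ?O E" by (rule frame_subset[OF E]) auto
  have FO: "orthonormal_frame A g ?O (adapted_frame F)"
    by (rule frame_subset[OF adapted_frame_orthonormal[OF V(1) F]]) auto
  have ZO: "hor ?O Z" using B.S_subset[OF Z] by auto
  have l: "hor ?O (lift (F i))" if "i < ?n" for i
    using B.S_subset[OF hor_lift[OF V(1) N.frame_smooth[OF F that]]] by auto
  note M = module_on_hor[OF O(1)] and T = tau_tensorial[OF O(1) FO]
  have a: "smooth_fun A ?O (\<lambda>q. g q (Z q) (lift (F i) q))" if "i < ?n" for i
    by (intro g_smooth O hor_smooth ZO l that)
  have ne: "finite {..<?n}" "{..<?n} \<noteq> {}" using DIM_positive[where 'a='f] by (auto simp del: DIM_positive)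
  have s: "hor ?O (\<lambda>q. \<Sum>i<?n. g q (Z q) (lift (F i) q) *\<^sub>R lift (F i) q)"
    by (rule module_on_sum[OF M ne]) (use a l in auto)
  \<comment> \<open>The term of the expansion along \<xi> drops out, because \<open>Z\<close> is
    horizontal.\<close>
  have exp: "Z q = (\<Sum>i<?n. g q (Z q) (lift (F i) q) *\<^sub>R lift (F i) q)" if q: "q \<in> ?O" for q
    using frame_expansion[OF FO q, of "Z q"]
      sum_adapted[of "\<lambda>X. g q (Z q) (X q) *\<^sub>R X q" F] hor_eta[OF ZO q]
    by (simp add: eta_eq g_sym[of q "Z q" "\<xi> q"])
  have t: "tau_end nab bnab (adapted_frame F) (act \<phi>) (lift (F i)) p = 0" if "i < ?n" for i
    using tau_lift[OF V(1) F V(2) N.frame_smooth[OF F that]] harm V F N.frame_smooth[OF F that]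
    by (auto simp: harmonic_ah_def intro: lift_eq_zero)
  have "tau_end nab bnab E (act \<phi>) Z p = tau_end nab bnab (adapted_frame F) (act \<phi>) Z p"
    by (rule tau_frame_independent[OF O EO FO ZO])
  also have "\<dots> = tau_end nab bnab (adapted_frame F) (act \<phi>) (\<lambda>q. \<Sum>i<?n. g q (Z q) (lift (F i) q) *\<^sub>R lift (F i) q) p"
    by (rule tensorial_cong[OF O(1) M T ZO s exp O(2)])
  also have "\<dots> = (\<Sum>i<?n. g p (Z p) (lift (F i) p) *\<^sub>R tau_end nab bnab (adapted_frame F) (act \<phi>) (lift (F i)) p)"
    by (rule tensorial_sum[OF T M ne _ _ O(2)]) (use a l in auto)
  also have "\<dots> = 0" by (simp add: t)
  finally show ?thesis .
qed

text \<open>The tension field of the base is the image of that of its lift; surjectivity of \<pi>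
  lets this reach every point of the base.\<close>

lemma harmonic_acm_imp_harmonic_ah:
  assumes harm: "harmonic_acm A \<phi> \<xi> \<eta> g nab"
  shows "harmonic_ah B h J' nab'"
  unfolding harmonic_ah_def
proof (intro allI impI ballI)
  fix V F W q assume VF: "open V \<and> orthonormal_frame B h V F" and W: "smooth_vf B V W" and q: "q \<in> V"
  then have V: "open V" and F: "orthonormal_frame B h V F" by auto
  obtain p where p: "q = \<pi> p" using pi_surj by (metis surjD)
  have "tau_end nab bnab (adapted_frame F) (act \<phi>) (lift W) p = 0"
    using harm preimage_open[OF V] adapted_frame_orthonormal[OF V F] lift_smooth[OF V W] q p
    unfolding harmonic_acm_def Let_def by (metis eta_lift vimage_eq)
  then have "lift (tau_end nab' nab' F (act J') W) p = 0"
    using tau_lift[OF V F _ W] q p by simp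
  then show "tau_end nab' nab' F (act J') W q = 0"
    using dpi_lift[of p "tau_end nab' nab' F (act J') W"] p by simp
qed

section \<open>The divergence of J vanishes\<close>

context
  fixes U and p :: 'm
  assumes U: "open U" and p: "p \<in> U"
begin

text \<open>Metric compatibility with \<phi> moved to the outer arguments; the projection is
  invisible against a horizontal \<open>Z\<close>. In a cyclic sum the two connection terms pair up
  to brackets.\<close>

lemma g_covJ:
  assumes X: "smooth_vf A U X" and Y: "smooth_vf A U Y" and Z: "hor U Z"
  shows "g p (covJ X Y p) (Z p) = dir_deriv A X (\<lambda>q. g q (\<phi> q (Y q)) (Z q)) p
    - g p (\<phi> p (Y p)) (nab X Z p) + g p (nab X Y p) (\<phi> p (Z p))"
proof -
  have "g p (\<xi> p) (Z p) = 0" using hor_eta[OF Z p] by (simp add: eta_eq)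
  then show ?thesis
    using metric_compatible[OF U X phi_smooth[OF U Y] hor_smooth[OF Z] p]
    by (simp add: cov_end_def bar_nabla_def act_def[of \<phi>] phi_skew)
qed

text \<open>J is skew and the projected connection is metric on horizontal fields.\<close>

lemma covJ_skew:
  assumes X: "smooth_vf A U X" and Y: "hor U Y" and Z: "hor U Z"
  shows "g p (covJ X Y p) (Z p) = - g p (Y p) (covJ X Z p)"
proof -
  have s: "g q (\<phi> q (Z q)) (Y q) = - g q (\<phi> q (Y q)) (Z q)" for q
    using phi_skew[of q "Z q" "Y q"] by (simp add: g_sym[of q "Z q"])
  have f: "smooth_fun A U (\<lambda>q. g q (\<phi> q (Y q)) (Z q))"
    using g_smooth[OF U phi_smooth[OF U hor_smooth[OF Y]] hor_smooth[OF Z]] by (simp add: act_def)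
  have "dir_deriv A X (\<lambda>q. g q (\<phi> q (Z q)) (Y q)) p = - dir_deriv A X (\<lambda>q. g q (\<phi> q (Y q)) (Z q)) p"
    unfolding s by (rule dir_deriv_minus[OF U f p])
  then show ?thesis
    using g_covJ[OF X hor_smooth[OF Y] Z] g_covJ[OF X hor_smooth[OF Z] Y]
    by (simp add: g_sym[of p "Y p"] g_sym[of p "nab X _ p"])
qed

text \<open>Obtained by differentiating the identity that the square of J is -1.\<close>

lemma covJ_phi:
  assumes X: "smooth_vf A U X" and Y: "hor U Y"
  shows "covJ X (act \<phi> Y) p = - \<phi> p (covJ X Y p)"
proof -
  have m: "hor U (\<lambda>q. (-1) *\<^sub>R Y q)" by (rule B.S_scale[OF U smooth_fun_const Y])
  have "bnab X (act \<phi> (act \<phi> Y)) p = bnab X (\<lambda>q. (-1) *\<^sub>R Y q) p"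
    by (rule B.D_cong[OF U X X hor_phi[OF U phi_smooth[OF U hor_smooth[OF Y]]] m refl _ p])
      (simp add: act_def phi_phi hor_eta[OF Y])
  then have "bnab X (act \<phi> (act \<phi> Y)) p = - bnab X Y p"
    using B.D_uminus[OF U X Y p] by simp
  then show ?thesis
    by (simp add: cov_end_def act_def[of \<phi> "bnab _ _"] phi_phi)
qed

text \<open>\<open>d\<Phi> = d\<^sup>2\<eta> = 0\<close>; on horizontal fields \<open>2 \<Phi>(X, Y) = - \<eta>([X, Y])\<close>, so that this is the Jacobi identity.\<close>

lemma covJ_cyclic:
  assumes X: "hor U X" and Y: "hor U Y" and Z: "hor U Z"
  shows "g p (covJ X Y p) (Z p) + g p (covJ Y Z p) (X p) + g p (covJ Z X p) (Y p) = 0"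
proof -
  let ?b = "lie_bracket A"
  note s = hor_smooth[OF X] hor_smooth[OF Y] hor_smooth[OF Z]
  have d: "2 * dir_deriv A P (\<lambda>q. g q (\<phi> q (Q q)) (R q)) p = dir_deriv A P (\<lambda>q. \<eta> q (?b Q R q)) p"
    if Q: "hor U Q" and R: "hor U R" for P Q R
  proof -
    have f: "smooth_fun A U (\<lambda>q. g q (\<phi> q (Q q)) (R q))"
      using g_smooth[OF U phi_smooth[OF U hor_smooth[OF Q]] hor_smooth[OF R]] by (simp add: act_def)
    have "dir_deriv A P (\<lambda>q. \<eta> q (?b Q R q)) p = dir_deriv A P (\<lambda>q. 2 * g q (\<phi> q (Q q)) (R q)) p"
      by (rule dir_deriv_cong[OF U p _ refl])
        (use eta_lie_bracket[OF U hor_smooth[OF Q] hor_smooth[OF R]] hor_eta[OF Q] hor_eta[OF R] in \<open>simp add: phi_skew\<close>)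
    then show ?thesis using dir_deriv_mult[OF smooth_fun_const p f, of P 2] by simp
  qed
  \<comment> \<open>The contact condition for \<open>?b P Q\<close> and \<open>R\<close>; one of the
    two derivatives is zero because \<open>R\<close> is horizontal.\<close>
  have e: "2 * g p (?b P Q p) (\<phi> p (R p)) = - dir_deriv A R (\<lambda>q. \<eta> q (?b P Q q)) p - \<eta> p (?b (?b P Q) R p)"
    if P: "hor U P" and Q: "hor U Q" and R: "hor U R" for P Q R
    using ext_deriv_eta[OF U smooth_lie_bracket[OF U hor_smooth[OF P] hor_smooth[OF Q]] hor_smooth[OF R] p]
      dir_deriv_zero_on[OF U p, of "\<lambda>q. \<eta> q (R q)" 0 "?b P Q"] hor_eta[OF R] by (simp add: ext_deriv_def)
  have t: "g p (nab P Q p) v - g p v (nab Q P p) = g p (?b P Q p) v" if "hor U P" "hor U Q" for P Q v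
    using torsion_free[OF U hor_smooth hor_smooth p, OF that] by (simp add: g_sym[of p v] g_simps(3)[symmetric])
  have "\<eta> p (?b (?b X Y) Z p + ?b (?b Y Z) X p + ?b (?b Z X) Y p) = 0"
    by (subst jacobi_identity[OF U s smooth_lie_bracket[OF U s(1,2)] smooth_lie_bracket[OF U s(2,3)]
        smooth_lie_bracket[OF U s(3,1)] p]) simp
  then have "\<eta> p (?b (?b X Y) Z p) + \<eta> p (?b (?b Y Z) X p) + \<eta> p (?b (?b Z X) Y p) = 0"
    by simp
  \<comment> \<open>By \<open>d\<close> and \<open>e\<close> the derivatives of \<eta> on brackets
    cancel in the cyclic sum, which leaves the double brackets.\<close>
  then show ?thesis
    using g_covJ[OF s(1,2) Z] g_covJ[OF s(2,3) X] g_covJ[OF s(3,1) Y] d[OF Y Z, of X] d[OF Z X, of Y]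
      d[OF X Y, of Z] e[OF X Y Z] e[OF Y Z X] e[OF Z X Y]
      t[OF X Y, of "\<phi> p (Z p)"] t[OF Y Z, of "\<phi> p (X p)"] t[OF Z X, of "\<phi> p (Y p)"]
    by linarith
qed

text \<open>The derivative of J along Z is skew and anticommutes with J, so
  g((\<open>covJ Z\<close>) X, \<phi> X) equals its own negative. The cyclic identity for X, \<phi>
  X, Z is thus left with two terms.\<close>

lemma covJ_phi_swap:
  assumes X: "hor U X" and Z: "hor U Z"
  shows "g p (covJ X (act \<phi> X) p) (Z p) = g p (covJ (act \<phi> X) X p) (Z p)"
proof -
  note s = hor_smooth[OF X] hor_smooth[OF Z] and P = hor_phi[OF U hor_smooth[OF X]]
  have "g p (covJ Z (act \<phi> X) p) (X p) = - g p (act \<phi> X p) (covJ Z X p)"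
    by (rule covJ_skew[OF s(2) P X])
  then have "g p (covJ Z X p) (act \<phi> X p) = 0"
    using covJ_phi[OF s(2) X] phi_skew[of p "covJ Z X p" "X p"]
    by (simp add: act_def[of \<phi> X] g_sym[of p "\<phi> p (X p)"])
  then show ?thesis
    using covJ_cyclic[OF X P Z] covJ_skew[OF hor_smooth[OF P] Z X] by (simp add: g_sym[of p "Z p"])
qed

lemma covJ_phi_trace_independent:
  assumes "orthonormal_frame A g U E" "orthonormal_frame A g U E'"
  shows "(\<Sum>i<DIM('e). covJ (E i) (act \<phi> (E i)) p) = (\<Sum>i<DIM('e). covJ (E' i) (act \<phi> (E' i)) p)"
proof (rule trace_frame_independent[OF U p assms, of "\<lambda>X Y. covJ X (act \<phi> Y)"])
  fix X assume X: "smooth_vf A U X"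
  show "tensorial U (smooth_vf A U) (\<lambda>Y. covJ Y (act \<phi> X))"
    by (rule B.cov_end_tensorial[OF U phi_endo hor_phi[OF U X]])
  note T = B.endo_on_tensorial[OF covJ_endo[OF U X] U]
  have s: "act \<phi> (\<lambda>p. Y p + Z p) = (\<lambda>p. act \<phi> Y p + act \<phi> Z p)"
    "act \<phi> (\<lambda>p. f p *\<^sub>R Z p) = (\<lambda>p. f p *\<^sub>R act \<phi> Z p)" for Y Z f
    by (simp_all add: act_def fun_eq_iff)
  show "tensorial U (smooth_vf A U) (\<lambda>Y. covJ X (act \<phi> Y))"
    by (rule tensorialI)
      (simp_all add: s tensorial_add[OF T] tensorial_scale[OF T] hor_phi[OF U])
qed

lemma covJ_phi_xi:
  assumes X: "smooth_vf A U X"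
  shows "covJ X (act \<phi> \<xi>) p = 0"
  by (rule B.endo_on_zero[OF covJ_endo[OF U X] U hor_phi[OF U xi_smooth] _ p]) (simp add: act_def)

end

text \<open>
  The structure is almost Kaehler transversally, which makes the divergence of \<open>J\<close> vanish: the
  traces \<open>\<Sum> covJ l\<^sub>i (\<phi> l\<^sub>i)\<close> and \<open>\<Sum> covJ (\<phi> l\<^sub>i) l\<^sub>i\<close> are equal by \<open>covJ_phi_swap\<close>, and opposite
  because the first one does not change when the frame \<open>l\<^sub>i\<close> is replaced by \<open>\<phi> l\<^sub>i\<close>.
\<close>

lemma sum_covJ_phi_lift:
  assumes V: "open V" "orthonormal_frame B h V F" and pV: "\<pi> p \<in> V"
  shows "(\<Sum>i<DIM('f). covJ (lift (F i)) (act \<phi> (lift (F i))) p) = 0" (is "?S = 0")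
proof -
  let ?U = "\<pi> -` V" and ?n = "DIM('f)"
  note U = preimage_open[OF V(1)]
  have p: "p \<in> ?U" using pV by simp
  define G where "G i = act J' (F i)" for i
  have G: "orthonormal_frame B h V G"
    using V by (auto simp: orthonormal_frame_def G_def J'_smooth) (simp_all add: act_def h_J'_J')
  have l: "hor ?U (lift (F i))" if "i < ?n" for i
    by (rule hor_lift[OF V(1) N.frame_smooth[OF V(2) that]])
  have lG: "lift (G i) = act \<phi> (lift (F i))" for i
    by (simp add: G_def phi_lift)
  let ?S' = "\<Sum>i<?n. covJ (act \<phi> (lift (F i))) (lift (F i)) p"
  have "?S = (\<Sum>i<DIM('e). covJ (adapted_frame F i) (act \<phi> (adapted_frame F i)) p)"
    by (subst sum_adapted[of "\<lambda>X. covJ X (act \<phi> X) p"]) (simp add: covJ_phi_xi[OF U p xi_smooth])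
  also have "\<dots> = (\<Sum>i<DIM('e). covJ (adapted_frame G i) (act \<phi> (adapted_frame G i)) p)"
    by (intro covJ_phi_trace_independent[OF U p] adapted_frame_orthonormal V G)
  also have "\<dots> = (\<Sum>i<?n. covJ (lift (G i)) (act \<phi> (lift (G i))) p)"
    by (subst sum_adapted[of "\<lambda>X. covJ X (act \<phi> X) p"]) (simp add: covJ_phi_xi[OF U p xi_smooth])
  also have "\<dots> = (\<Sum>i<?n. - covJ (act \<phi> (lift (F i))) (lift (F i)) p)"
  proof (rule sum.cong)
    fix i assume "i \<in> {..<?n}"
    then have i: "hor ?U (lift (F i))" using l by simp
    note P = hor_phi[OF U hor_smooth[OF i]]
    \<comment> \<open>Two uses of \<open>covJ_phi\<close> take both factors \<phi> out of the
      argument; on horizontal vectors their product is -1.\<close>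
    show "covJ (lift (G i)) (act \<phi> (lift (G i))) p = - covJ (act \<phi> (lift (F i))) (lift (F i)) p"
      using covJ_phi[OF U p hor_smooth[OF P] P] covJ_phi[OF U p hor_smooth[OF P] i]
      by (simp add: lG phi_phi)
  qed simp
  finally have neg: "?S = - ?S'" by (simp add: sum_negf)
  show ?thesis
  proof (rule g_eq_zero_lift)
    show "g p ?S (\<xi> p) = 0"
      using eta_covJ by (simp add: g_sum eta_eq g_sym[of p _ "\<xi> p"])
    fix V' W assume V': "open V'" "\<pi> p \<in> V'" "smooth_vf B V' W"
    let ?O = "\<pi> -` (V \<inter> V')"
    have O: "open ?O" "p \<in> ?O" using V V' pV by (auto intro!: preimage_open)
    have Z: "hor ?O (lift W)" using B.S_subset[OF hor_lift[OF V'(1,3)]] by auto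
    have "hor ?O (lift (F i))" if "i < ?n" for i using B.S_subset[OF l[OF that]] by auto
    then have "g p ?S (lift W p) = g p ?S' (lift W p)"
      using covJ_phi_swap[OF O _ Z] by (simp add: g_sum)
    moreover have "g p ?S (lift W p) = - g p ?S' (lift W p)" by (simp add: neg)
    ultimately show "g p ?S (lift W p) = 0" by simp
  qed
qed

text \<open>By \<open>covJ_phi\<close>, the sum in \<open>sum_covJ_phi_lift\<close> is -\<phi> of
  this one, and \<phi> is injective on horizontal vectors.\<close>

lemma sum_covJ_lift:
  assumes V: "open V" "orthonormal_frame B h V F" and p: "\<pi> p \<in> V"
  shows "(\<Sum>i<DIM('f). covJ (lift (F i)) (lift (F i)) p) = 0" (is "?S = 0")
proof -
  have "covJ (lift (F i)) (act \<phi> (lift (F i))) p = - \<phi> p (covJ (lift (F i)) (lift (F i)) p)" if "i < DIM('f)" for i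
    using covJ_phi[OF preimage_open[OF V(1)] _ lift_smooth hor_lift] V N.frame_smooth[OF V(2) that] p by simp
  then have "\<phi> p ?S = 0"
    using sum_covJ_phi_lift[OF assms] by (simp add: sum_negf)
  then have "\<phi> p (\<phi> p ?S) = 0" by (simp only: phi_simps)
  moreover have "\<eta> p ?S = 0" by simp
  ultimately show ?thesis using phi_phi[of p ?S] by (simp only: neg_equal_0_iff_equal scale_zero_left add_0_right)
qed

section \<open>The equation for \<xi> holds identically\<close>

context
  fixes U E and p :: 'm
  assumes U: "open U" and E: "orthonormal_frame A g U E" and p: "p \<in> U"
begin

text \<open>As \<nabla>\<xi> = -\<phi>, this is minus a trace that may be evaluated in an adapted
  frame, where \<open>sum_covJ_phi_lift\<close> applies.\<close>

lemma T_phi_zero: "T_phi nab bnab E \<xi> (act \<phi>) p = 0"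
proof -
  obtain V F where V: "open V" "\<pi> p \<in> V" and F: "orthonormal_frame B h V F"
    using N.local_orthonormal_frame by blast
  let ?O = "U \<inter> \<pi> -` V"
  have O: "open ?O" "p \<in> ?O" using U p V preimage_open by auto
  have EO: "orthonormal_frame A g ?O E" by (rule frame_subset[OF E]) auto
  have FO: "orthonormal_frame A g ?O (adapted_frame F)"
    by (rule frame_subset[OF adapted_frame_orthonormal[OF V(1) F]]) auto
  have "covJ (E i) (nab (E i) \<xi>) p = - covJ (E i) (act \<phi> (E i)) p" if "i < DIM('e)" for i
  proof -
    note s = frame_smooth[OF E that]
    note T = B.endo_on_tensorial[OF covJ_endo[OF U s] U] and h = hor_phi[OF U s]
    have n: "hor U (nab (E i) \<xi>)"
      using nab_smooth[OF U s xi_smooth] by (simp add: hor_def nab_xi[OF U s])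
    have "covJ (E i) (nab (E i) \<xi>) p = covJ (E i) (\<lambda>q. (-1) *\<^sub>R act \<phi> (E i) q) p"
      by (rule B.endo_on_cong[OF covJ_endo[OF U s] U n B.S_scale[OF U smooth_fun_const h] _ p])
        (simp add: nab_xi[OF U s] act_def)
    then show ?thesis using tensorial_scale[OF T smooth_fun_const h p, of "-1"] by simp
  qed
  then have "T_phi nab bnab E \<xi> (act \<phi>) p = - (\<Sum>i<DIM('e). covJ (E i) (act \<phi> (E i)) p)"
    by (simp add: T_phi_def sum_negf)
  also have "\<dots> = - (\<Sum>i<DIM('e). covJ (adapted_frame F i) (act \<phi> (adapted_frame F i)) p)"
    by (simp only: covJ_phi_trace_independent[OF O EO FO])
  also have "\<dots> = 0"
    by (subst sum_adapted[of "\<lambda>X. covJ X (act \<phi> X) p"])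
      (simp add: covJ_phi_xi[OF U p xi_smooth] sum_covJ_phi_lift[OF V(1) F V(2)])
  finally show ?thesis .
qed

text \<open>Each of the 2n lifts in an adapted frame contributes a divergence term and -\<xi> to the
  trace of the second derivative of \<xi>, so the Laplacian of \<xi> is 2n \<xi>; and 2n is the
  squared norm of \<nabla>\<xi>.\<close>

lemma tau_xi_zero: "tau_xi g nab E \<xi> p = 0"
proof -
  obtain V F where V: "open V" "\<pi> p \<in> V" and F: "orthonormal_frame B h V F"
    using N.local_orthonormal_frame by blast
  let ?O = "U \<inter> \<pi> -` V" and ?n = "DIM('f)"
  have O: "open ?O" "p \<in> ?O" using U p V preimage_open by auto
  have EO: "orthonormal_frame A g ?O E" by (rule frame_subset[OF E]) auto
  have FO: "orthonormal_frame A g ?O (adapted_frame F)"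
    by (rule frame_subset[OF adapted_frame_orthonormal[OF V(1) F]]) auto
  \<comment> \<open>The squared length of \<phi> (E i); with Parseval for the unit vector \<xi>
    these add up to \<open>DIM('e) - 1\<close>.\<close>
  have "g p (nab (E i) \<xi> p) (nab (E i) \<xi> p) = 1 - g p (\<xi> p) (E i p) * g p (\<xi> p) (E i p)" if "i < DIM('e)" for i
    using frame_orthonormal[OF E p that that]
    by (simp add: nab_xi[OF U frame_smooth[OF E that] p] g_phi_phi eta_eq)
  then have norm: "(\<Sum>i<DIM('e). g p (nab (E i) \<xi> p) (nab (E i) \<xi> p)) = real ?n"
    using frame_parseval[OF E p, of "\<xi> p" "\<xi> p"] by (simp add: sum_subtractf dims)
  have l: "cov2_vf nab (lift (F i)) (lift (F i)) \<xi> p = - covJ (lift (F i)) (lift (F i)) p - \<xi> p" if "i < ?n" for i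
  proof -
    let ?l = "lift (F i)" and ?P = "\<pi> -` V"
    note W = N.frame_smooth[OF F that] and PO = preimage_open[OF V(1)]
    note s = lift_smooth[OF V(1) W]
    have pP: "p \<in> ?P" using V by simp
    note ps = phi_smooth[OF PO s]
    have "nab ?l (nab ?l \<xi>) p = nab ?l (\<lambda>q. - act \<phi> ?l q) p"
      by (rule TM.D_cong[OF PO s s nab_smooth[OF PO s xi_smooth] smooth_vf_minus[OF PO ps] refl _ pP])
        (simp add: nab_xi[OF PO s] act_def)
    also have "\<dots> = - nab ?l (act \<phi> ?l) p"
      by (rule TM.D_uminus[OF PO s ps pP])
    finally have 1: "nab ?l (nab ?l \<xi>) p = - nab ?l (act \<phi> ?l) p" .
    have 2: "nab (nab ?l ?l) \<xi> p = - \<phi> p (nab ?l ?l p)"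
      by (rule nab_xi[OF PO nab_smooth[OF PO s s] pP])
    \<comment> \<open>The component along \<xi>, equal to the squared length of
      \<open>\<phi> p (?l p)\<close>, is what the projection in \<open>covJ\<close> discards; it
      accounts for the term -\<xi>.\<close>
    have "\<eta> p (nab ?l (act \<phi> ?l) p) = g p (\<phi> p (?l p)) (act \<phi> ?l p)"
      unfolding phi_lift by (rule eta_nab_lift[OF V(1) W J'_smooth[OF V(1) W] V(2)])
    also have "\<dots> = 1"
      using N.frame_orthonormal[OF F V(2) that that] by (simp add: act_def g_phi_phi g_lift)
    finally have 3: "\<eta> p (nab ?l (act \<phi> ?l) p) = 1" .
    show ?thesis
      by (simp add: cov2_vf_def 1 2 cov_end_def bar_nabla_def 3 act_def[of \<phi> "bar_nabla _ _ _ _ _"])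
  qed
  have x: "cov2_vf nab \<xi> \<xi> \<xi> p = 0"
    using TM.D_zero_on[OF U xi_smooth nab_smooth[OF U xi_smooth xi_smooth] nab_xi_xi p]
      TM.D_X_zero[OF U nab_smooth[OF U xi_smooth xi_smooth] xi_smooth nab_xi_xi p]
    by (simp add: cov2_vf_def)
  have "(\<Sum>i<DIM('e). cov2_vf nab (E i) (E i) \<xi> p)
      = (\<Sum>i<DIM('e). cov2_vf nab (adapted_frame F i) (adapted_frame F i) \<xi> p)"
    using trace_frame_independent[OF O EO FO, of "\<lambda>X Y. cov2_vf nab X Y \<xi>"]
      cov2_vf_tensorial_left[OF O(1) xi_smooth xi_smooth] cov2_vf_tensorial_right[OF O(1) _ xi_smooth] by simp
  also have "\<dots> = (\<Sum>i<?n. - covJ (lift (F i)) (lift (F i)) p - \<xi> p)"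
    by (subst sum_adapted[of "\<lambda>X. cov2_vf nab X X \<xi> p"]) (simp add: l x)
  also have "\<dots> = - real ?n *\<^sub>R \<xi> p"
    using sum_covJ_lift[OF V(1) F V(2)] by (simp add: sum_subtractf sum_negf sum_constant_scaleR)
  finally show ?thesis
    by (simp add: tau_xi_def rough_laplacian_vf_def norm)
qed

end

lemma harmonic_ah_imp_harmonic_acm:
  assumes "harmonic_ah B h J' nab'"
  shows "harmonic_acm A \<phi> \<xi> \<eta> g nab"
  unfolding harmonic_acm_def Let_def
proof (intro allI impI conjI ballI)
  fix U E p assume "open U \<and> orthonormal_frame A g U E" and p: "p \<in> U"
  then have U: "open U" and E: "orthonormal_frame A g U E" by auto
  show "tau_xi g nab E \<xi> p + (1/2) *\<^sub>R act \<phi> (T_phi nab bnab E \<xi> (act \<phi>)) p = 0"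
    using tau_xi_zero[OF U E p] T_phi_zero[OF U E p] by (simp add: act_def[of \<phi> "T_phi _ _ _ _ _"])
  show "tau_end nab bnab E (act \<phi>) Z p = 0" if "smooth_vf A U Z \<and> (\<forall>p\<in>U. \<eta> p (Z p) = 0)" for Z
    by (rule harmonic_ah_imp_tau_zero[OF assms U E _ p]) (use that in \<open>simp add: hor_def\<close>)
qed

end

theorem theorem3p1:
  fixes n :: nat
    and A :: "('m::{t2_space, second_countable_topology}, 'e::euclidean_space) chart set"
    and \<phi> :: "'m \<Rightarrow> 'e \<Rightarrow> 'e" and \<xi> :: "'m \<Rightarrow> 'e"
    and \<eta> :: "'m \<Rightarrow> 'e \<Rightarrow> real" and g :: "'m \<Rightarrow> 'e \<Rightarrow> 'e \<Rightarrow> real"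
    and nab :: "('m, 'e) connection"
    and B :: "('b::{t2_space, second_countable_topology}, 'f::euclidean_space) chart set"
    and h :: "'b \<Rightarrow> 'f \<Rightarrow> 'f \<Rightarrow> real" and J' :: "'b \<Rightarrow> 'f \<Rightarrow> 'f"
    and nab' :: "('b, 'f) connection"
    and \<pi> :: "'m \<Rightarrow> 'b"
  assumes "DIM('e) = 2 * n + 1" and "DIM('f) = 2 * n"
    and "smooth_atlas A" and "smooth_atlas B"
    and "contact_metric A \<phi> \<xi> \<eta> g"
    and "submersive_onto A \<phi> \<xi> \<eta> g B h J' \<pi>"
    and "levi_civita A g nab" and "levi_civita B h nab'"
  shows "harmonic_acm A \<phi> \<xi> \<eta> g nab \<longleftrightarrow> harmonic_ah B h J' nab'"
proof -
  interpret submersive_contact A g nab B h nab' \<phi> \<xi> \<eta> J' \<pi>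
    using assms
    by unfold_locales
      (simp_all add: contact_metric_def almost_contact_metric_def submersive_onto_def almost_hermitian_def)
  show ?thesis
    using harmonic_acm_imp_harmonic_ah harmonic_ah_imp_harmonic_acm by blast
qed

end
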